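(* Let $X$ be a Banach space. Suppose that the linear equation $v'=A(t)v$ admits a $\mu$-nonuniform polynomial trichotomy (with constants $a,b,c,d,D,\varepsilon$) and let $f\colon\mathbb{R}\times X\to X$ be a continuous function such that $f(t,0)=0$ and $\operatorname{Lip}(f_t)<+\infty$ for every $t\in\mathbb{R}$, and $$\operatorname{Lip}(f_r)\le\delta\,\mu'(r)\,(|\mu(r)|+1)^{-\gamma}\quad\text{for every } r\in\mathbb{R},$$ with $\gamma>0$. If $$a+b+\varepsilon<0\quad\text{and}\quad c+d+\varepsilon<0,$$ $\delta$ is sufficiently small and $$a,c\le0,\qquad 2\varepsilon\le\gamma\qquad\text{and}\qquad \varepsilon-\gamma+1<0,$$ then the equation $v'=A(t)v+f(t,v)$ admits a global Lipschitz invariant center manifold, i.e., there is $N\in(0,1)$ and a unique $\varphi\in\mathcal{A}_N$ such that $\Psi_\tau(\mathcal{V}_\varphi)\subseteq\mathcal{V}_\varphi$ for every $\tau\in\mathbb{R}$ and $$\|\Psi_{t-s}(p_{s,\xi})-\Psi_{t-s}(p_{s,\bar\xi})\|\le\begin{cases}\dfrac{DN}{\omega}\,(\mu(t)-\mu(s)+1)^a(|\mu(s)|+1)^\varepsilon\,\|\xi-\bar\xi\|&\text{if } t\ge s,\\[3mm]\dfrac{DN}{\omega}\,(\mu(s)-\mu(t)+1)^c(|\mu(s)|+1)^\varepsilon\,\|\xi-\bar\xi\|&\text{if } t\le s,\end{cases}$$ for all $(s,\xi),(s,\bar\xi)\in G$, where $p_{s,\xi}=(s,\xi,\varphi(s,\xi))$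 and $p_{s,\bar\xi}=(s,\bar\xi,\varphi(s,\bar\xi))$.
   Context: $X$ is a Banach space, $B(X)$ the Banach algebra of bounded linear operators on $X$, and $A\colon\mathbb{R}\to B(X)$ is continuous. $T_{t,s}$ ($t,s\in\mathbb{R}$) is the evolution operator of $v'=A(t)v$ (whose solutions are assumed global): every solution satisfies $v(t)=T_{t,s}v(s)$. Invariant splitting: for every $t\in\mathbb{R}$ there are bounded projections $P_t,Q^+_t,Q^-_t\in B(X)$ such that, for all $t,s\in\mathbb{R}$: $P_t+Q^+_t+Q^-_t=\mathrm{Id}$; $P_tQ^+_t=0$; $P_tT_{t,s}=T_{t,s}P_s$; $Q^+_tT_{t,s}=T_{t,s}Q^+_s$. Put $E_t=P_t(X)$, $F^+_t=Q^+_t(X)$, $F^-_t=Q^-_t(X)$; $E_t\times F^+_t\times F^-_t$ is identified with $E_t\oplus F^+_t\oplus F^-_t=X$. Generalized trichotomy: let $\mathbb{R}^2_{\ge}=\{(t,s)\in\mathbb{R}^2: t\ge s\}$, $\mathbb{R}^2_{\le}=\{(t,s)\in\mathbb{R}^2: t\le s\}$. Given positive functions $\alpha_{t,s}$ on $\mathbb{R}^2$, $\beta^+_{t,s}$ on $\mathbb{R}^2_\ge$, $\beta^-_{t,s}$ on $\mathbb{R}^2_\le$, the equation $v'=A(t)v$ admits a generalized trichotomy with these bounds if it admits an invariant splitting such that $\|T_{t,s}P_s\|\le\alpha_{t,s}$ for all $(t,s)\in\mathbb{R}^2$, $\|T_{t,s}Q^+_s\|\le\beta^+_{t,s}$ for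 all $(t,s)\in\mathbb{R}^2_\ge$, and $\|T_{t,s}Q^-_s\|\le\beta^-_{t,s}$ for all $(t,s)\in\mathbb{R}^2_\le$. $\mu$-nonuniform polynomial trichotomy: a generalized trichotomy with bounds $\alpha_{t,s}=D(\mu(t)-\mu(s)+1)^a(|\mu(s)|+1)^\varepsilon$ for $t\ge s$, $\alpha_{t,s}=D(\mu(s)-\mu(t)+1)^c(|\mu(s)|+1)^\varepsilon$ for $t\le s$; $\beta^+_{t,s}=D(\mu(t)-\mu(s)+1)^d(|\mu(s)|+1)^\varepsilon$ for $t\ge s$; $\beta^-_{t,s}=D(\mu(s)-\mu(t)+1)^b(|\mu(s)|+1)^\varepsilon$ for $t\le s$, where $\mu\colon\mathbb{R}\to\mathbb{R}$ is a differentiable function with positive derivative and $\lim_{t\to+\infty}\mu(t)=\lim_{t\to-\infty}-\mu(t)=+\infty$, and $a,b,c,d,D,\varepsilon$ are real constants with $D\ge1$ and $\varepsilon\ge0$. For $f\colon\mathbb{R}\times X\to X$, $f_t(x)=f(t,x)$ and $\operatorname{Lip}(f_t)=\sup\{\|f(t,x)-f(t,y)\|/\|x-y\|: x,y\in X,\ x\ne y\}$. The constant $\omega$ is $$\omega:=\sup_{s\in\mathbb{R}}\left[\int_{-\infty}^s\beta^+_{s,r}\operatorname{Lip}(f_r)\,\alpha_{r,s}\,dr+\int_s^{+\infty}\beta^-_{s,r}\operatorname{Lip}(f_r)\,\alpha_{r,s}\,dr\right].$$ Flow: for $s\in\mathbb{R}$ and $v_s=(\xi,\eta^+,\eta^-)\in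 E_s\times F^+_s\times F^-_s$, let $(x(t,s,v_s),y^+(t,s,v_s),y^-(t,s,v_s))\in E_t\times F^+_t\times F^-_t$, $t\in\mathbb{R}$, be the only solution of $v'=A(t)v+f(t,v)$, $v(s)=v_s$. For $\tau\in\mathbb{R}$, $\Psi_\tau(s,v_s)=(s+\tau,x(s+\tau,s,v_s),y^+(s+\tau,s,v_s),y^-(s+\tau,s,v_s))\in\mathbb{R}\times X$. A difference of two points of $\mathbb{R}\times X$ with the same first coordinate is measured by the norm of $X$ of its second component. $G=\bigcup_{t\in\mathbb{R}}\{t\}\times E_t$. For $N>0$, $\mathcal{A}_N$ is the set of all continuous $\varphi\colon G\to X$ such that $\varphi(t,0)=0$ for all $t\in\mathbb{R}$; $\varphi(t,\xi)\in F^+_t\oplus F^-_t$ for all $(t,\xi)\in G$; and $\|\varphi(t,\xi)-\varphi(t,\bar\xi)\|\le N\|\xi-\bar\xi\|$ for all $(t,\xi),(t,\bar\xi)\in G$. The graph of $\varphi$ is $\mathcal{V}_\varphi=\{(s,\xi,\varphi(s,\xi)):(s,\xi)\in G\}\subseteq\mathbb{R}\times X$. *)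

theory Defs
  imports "HOL-Analysis.Analysis"
begin

section \<open>Equations and evolution operators\<close>

definition global_solution :: "(real \<Rightarrow> 'a \<Rightarrow> 'a) \<Rightarrow> (real \<Rightarrow> 'a::real_normed_vector) \<Rightarrow> bool" where
  "global_solution g v \<longleftrightarrow> (\<forall>t. (v has_vector_derivative g t (v t)) (at t))"

text \<open>The first conjunct says that every initial value problem for the linear equation has a
  global solution; together with the second it determines \<open>T\<close> uniquely.\<close>

definition evolution_operator ::
    "(real \<Rightarrow> 'a \<Rightarrow>\<^sub>L 'a) \<Rightarrow> (real \<Rightarrow> real \<Rightarrow> 'a \<Rightarrow>\<^sub>L 'a::real_normed_vector) \<Rightarrow> bool" where
  "evolution_operator A T \<longleftrightarrow>
     (\<forall>s x. global_solution (\<lambda>t. blinfun_apply (A t)) (\<lambda>t. T t s x) \<and> T s s x = x) \<and>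
     (\<forall>v. global_solution (\<lambda>t. blinfun_apply (A t)) v \<longrightarrow> (\<forall>t s. v t = T t s (v s)))"


section \<open>Trichotomies\<close>

definition invariant_splitting ::
    "(real \<Rightarrow> real \<Rightarrow> 'a \<Rightarrow>\<^sub>L 'a::real_normed_vector) \<Rightarrow> (real \<Rightarrow> 'a \<Rightarrow>\<^sub>L 'a) \<Rightarrow>
     (real \<Rightarrow> 'a \<Rightarrow>\<^sub>L 'a) \<Rightarrow> (real \<Rightarrow> 'a \<Rightarrow>\<^sub>L 'a) \<Rightarrow> bool" where
  "invariant_splitting T P Qp Qm \<longleftrightarrow>
     (\<forall>t. P t o\<^sub>L P t = P t \<and> Qp t o\<^sub>L Qp t = Qp t \<and> Qm t o\<^sub>L Qm t = Qm t) \<and>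
     (\<forall>t. P t + Qp t + Qm t = id_blinfun) \<and>
     (\<forall>t. P t o\<^sub>L Qp t = 0) \<and>
     (\<forall>t s. P t o\<^sub>L T t s = T t s o\<^sub>L P s) \<and>
     (\<forall>t s. Qp t o\<^sub>L T t s = T t s o\<^sub>L Qp s)"

text \<open>\<open>\<beta>p\<close> is only relevant on pairs \<open>t \<ge> s\<close>, and \<open>\<beta>m\<close> only on pairs \<open>t \<le> s\<close>.\<close>

definition generalized_trichotomy ::
    "(real \<Rightarrow> real \<Rightarrow> 'a \<Rightarrow>\<^sub>L 'a::real_normed_vector) \<Rightarrow> (real \<Rightarrow> 'a \<Rightarrow>\<^sub>L 'a) \<Rightarrow>
     (real \<Rightarrow> 'a \<Rightarrow>\<^sub>L 'a) \<Rightarrow> (real \<Rightarrow> 'a \<Rightarrow>\<^sub>L 'a) \<Rightarrow>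
     (real \<Rightarrow> real \<Rightarrow> real) \<Rightarrow> (real \<Rightarrow> real \<Rightarrow> real) \<Rightarrow> (real \<Rightarrow> real \<Rightarrow> real) \<Rightarrow> bool" where
  "generalized_trichotomy T P Qp Qm \<alpha> \<beta>p \<beta>m \<longleftrightarrow>
     (\<forall>t s. \<alpha> t s > 0) \<and> (\<forall>t s. t \<ge> s \<longrightarrow> \<beta>p t s > 0) \<and> (\<forall>t s. t \<le> s \<longrightarrow> \<beta>m t s > 0) \<and>
     invariant_splitting T P Qp Qm \<and>
     (\<forall>t s. norm (T t s o\<^sub>L P s) \<le> \<alpha> t s) \<and>
     (\<forall>t s. t \<ge> s \<longrightarrow> norm (T t s o\<^sub>L Qp s) \<le> \<beta>p t s) \<and>
     (\<forall>t s. t \<le> s \<longrightarrow> norm (T t s o\<^sub>L Qm s) \<le> \<beta>m t s)"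

definition poly_alpha ::
    "(real \<Rightarrow> real) \<Rightarrow> real \<Rightarrow> real \<Rightarrow> real \<Rightarrow> real \<Rightarrow> real \<Rightarrow> real \<Rightarrow> real" where
  "poly_alpha \<mu> D a c \<epsilon> t s =
     (if t \<ge> s then D * (\<mu> t - \<mu> s + 1) powr a * (\<bar>\<mu> s\<bar> + 1) powr \<epsilon>
      else D * (\<mu> s - \<mu> t + 1) powr c * (\<bar>\<mu> s\<bar> + 1) powr \<epsilon>)"

definition poly_beta_plus ::
    "(real \<Rightarrow> real) \<Rightarrow> real \<Rightarrow> real \<Rightarrow> real \<Rightarrow> real \<Rightarrow> real \<Rightarrow> real" where
  "poly_beta_plus \<mu> D d \<epsilon> t s = D * (\<mu> t - \<mu> s + 1) powr d * (\<bar>\<mu> s\<bar> + 1) powr \<epsilon>"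

definition poly_beta_minus ::
    "(real \<Rightarrow> real) \<Rightarrow> real \<Rightarrow> real \<Rightarrow> real \<Rightarrow> real \<Rightarrow> real \<Rightarrow> real" where
  "poly_beta_minus \<mu> D b \<epsilon> t s = D * (\<mu> s - \<mu> t + 1) powr b * (\<bar>\<mu> s\<bar> + 1) powr \<epsilon>"

definition growth_rate :: "(real \<Rightarrow> real) \<Rightarrow> bool" where
  "growth_rate \<mu> \<longleftrightarrow> (\<forall>t. \<mu> differentiable (at t)) \<and> (\<forall>t. deriv \<mu> t > 0) \<and>
     filterlim \<mu> at_top at_top \<and> filterlim (\<lambda>t. - \<mu> t) at_top at_bot"

definition nonuniform_polynomial_trichotomy ::
    "(real \<Rightarrow> real) \<Rightarrow> (real \<Rightarrow> real \<Rightarrow> 'a \<Rightarrow>\<^sub>L 'a::real_normed_vector) \<Rightarrow>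
     (real \<Rightarrow> 'a \<Rightarrow>\<^sub>L 'a) \<Rightarrow> (real \<Rightarrow> 'a \<Rightarrow>\<^sub>L 'a) \<Rightarrow> (real \<Rightarrow> 'a \<Rightarrow>\<^sub>L 'a) \<Rightarrow>
     real \<Rightarrow> real \<Rightarrow> real \<Rightarrow> real \<Rightarrow> real \<Rightarrow> real \<Rightarrow> bool" where
  "nonuniform_polynomial_trichotomy \<mu> T P Qp Qm a b c d D \<epsilon> \<longleftrightarrow>
     growth_rate \<mu> \<and> D \<ge> 1 \<and> \<epsilon> \<ge> 0 \<and>
     generalized_trichotomy T P Qp Qm
       (poly_alpha \<mu> D a c \<epsilon>) (poly_beta_plus \<mu> D d \<epsilon>) (poly_beta_minus \<mu> D b \<epsilon>)"


section \<open>Lipschitz constants and the constant omega\<close>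

text \<open>Both are valued in \<open>[0, \<infinity>]\<close>, so that they are meaningful without any a priori finiteness;
  the supremum over the empty set (trivial space) is \<open>0\<close>.\<close>

definition Lip :: "('a::real_normed_vector \<Rightarrow> 'a) \<Rightarrow> ennreal" where
  "Lip g = Sup {ennreal (norm (g x - g y) / norm (x - y)) | x y. x \<noteq> y}"

definition omega ::
    "(real \<Rightarrow> real \<Rightarrow> real) \<Rightarrow> (real \<Rightarrow> real \<Rightarrow> real) \<Rightarrow> (real \<Rightarrow> real \<Rightarrow> real) \<Rightarrow>
     (real \<Rightarrow> 'a::real_normed_vector \<Rightarrow> 'a) \<Rightarrow> ennreal" where
  "omega \<alpha> \<beta>p \<beta>m f = (SUP s.
     (\<integral>\<^sup>+ r\<in>{..s}. (ennreal (\<beta>p s r) * Lip (f r) * ennreal (\<alpha> r s)) \<partial>lborel) +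
     (\<integral>\<^sup>+ r\<in>{s..}. (ennreal (\<beta>m s r) * Lip (f r) * ennreal (\<alpha> r s)) \<partial>lborel))"


section \<open>The flow and Lipschitz graphs over the center bundle\<close>

text \<open>\<open>E\<^sub>t \<times> F\<^sup>+\<^sub>t \<times> F\<^sup>-\<^sub>t\<close> is identified with the whole space by addition, so a triple is represented
  by its sum, and the solution with components \<open>x\<close>, \<open>y\<^sup>+\<close>, \<open>y\<^sup>-\<close> by a single vector-valued function.\<close>

definition solution_through ::
    "(real \<Rightarrow> 'a \<Rightarrow>\<^sub>L 'a) \<Rightarrow> (real \<Rightarrow> 'a \<Rightarrow> 'a) \<Rightarrow> real \<Rightarrow> 'a::real_normed_vector \<Rightarrow> real \<Rightarrow> 'a" where
  "solution_through A f s v0 = (THE v. global_solution (\<lambda>t x. A t x + f t x) v \<and> v s = v0)"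

definition flow_map ::
    "(real \<Rightarrow> 'a \<Rightarrow>\<^sub>L 'a) \<Rightarrow> (real \<Rightarrow> 'a \<Rightarrow> 'a) \<Rightarrow> real \<Rightarrow>
     real \<times> 'a::real_normed_vector \<Rightarrow> real \<times> 'a" where
  "flow_map A f \<tau> p = (fst p + \<tau>, solution_through A f (fst p) (snd p) (fst p + \<tau>))"

definition center_bundle :: "(real \<Rightarrow> 'a \<Rightarrow>\<^sub>L 'a::real_normed_vector) \<Rightarrow> (real \<times> 'a) set" where
  "center_bundle P = (SIGMA t:UNIV. range (blinfun_apply (P t)))"

text \<open>Functions with domain \<^term>\<open>center_bundle P\<close> are represented by extensional functions, so that
  equality of representatives is equality on the domain.\<close>

definition lipschitz_sections ::
    "(real \<Rightarrow> 'a \<Rightarrow>\<^sub>L 'a::real_normed_vector) \<Rightarrow> (real \<Rightarrow> 'a \<Rightarrow>\<^sub>L 'a) \<Rightarrow> (real \<Rightarrow> 'a \<Rightarrow>\<^sub>L 'a) \<Rightarrow>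
     real \<Rightarrow> (real \<times> 'a \<Rightarrow> 'a) set" where
  "lipschitz_sections P Qp Qm N = {\<phi> \<in> extensional (center_bundle P).
     continuous_on (center_bundle P) \<phi> \<and>
     (\<forall>t. \<phi> (t, 0) = 0) \<and>
     (\<forall>(t, \<xi>) \<in> center_bundle P.
        \<exists>\<eta>p \<in> range (blinfun_apply (Qp t)). \<exists>\<eta>m \<in> range (blinfun_apply (Qm t)).
          \<phi> (t, \<xi>) = \<eta>p + \<eta>m) \<and>
     (\<forall>t \<xi> \<xi>'. (t, \<xi>) \<in> center_bundle P \<longrightarrow> (t, \<xi>') \<in> center_bundle P \<longrightarrow>
        norm (\<phi> (t, \<xi>) - \<phi> (t, \<xi>')) \<le> N * norm (\<xi> - \<xi>'))}"

definition graph_point :: "(real \<times> 'a::real_normed_vector \<Rightarrow> 'a) \<Rightarrow> real \<Rightarrow> 'a \<Rightarrow> real \<times> 'a" where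
  "graph_point \<phi> s \<xi> = (s, \<xi> + \<phi> (s, \<xi>))"

definition section_graph ::
    "(real \<Rightarrow> 'a \<Rightarrow>\<^sub>L 'a::real_normed_vector) \<Rightarrow> (real \<times> 'a \<Rightarrow> 'a) \<Rightarrow> (real \<times> 'a) set" where
  "section_graph P \<phi> = {graph_point \<phi> s \<xi> | s \<xi>. (s, \<xi>) \<in> center_bundle P}"

end

theory Submission imports Defs begin

text \<open>A center manifold is the graph of a section \<open>\<phi>\<close> over the center bundle, and invariance of the graph
under the flow of \<open>v' = A(t) v + f(t, v)\<close> is a fixed point equation for \<open>\<phi>\<close>. If a solution stays in the
graph, its center component \<open>x\<close> satisfies an equation of its own,
\<open>x' = A x + P f(t, x + \<phi>(t, x))\<close>, so that \<open>\<phi>\<close> and \<open>x(s)\<close> already determine the forcing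
\<open>h(r) = f(r, x(r) + \<phi>(r, x(r)))\<close> along the orbit. The hyperbolic component is then forced as well: because
\<open>\<beta>\<^sup>+ \<alpha>\<close> tends to \<open>0\<close> in the past and \<open>\<beta>\<^sup>- \<alpha>\<close> tends to \<open>0\<close> in the future, it must be the integral of
\<open>T Q\<^sup>+ h\<close> from \<open>-\<infinity>\<close> minus the integral of \<open>T Q\<^sup>- h\<close> to \<open>+\<infinity>\<close>. The value of this expression at time \<open>s\<close> defines
the graph transform of \<open>\<phi>\<close> at \<open>(s, x(s))\<close>. Its fixed points are exactly the sections with
invariant graph (\<open>fixed_point_invariant\<close>, \<open>invariant_fixed_point\<close>), and it is a contraction for
the distance \<open>sup \<parallel>\<phi>(s, \<xi>) - \<psi>(s, \<xi>)\<parallel> / \<parallel>\<xi>\<parallel>\<close> (\<open>graph_transform_contraction\<close>); this gives existence and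
uniqueness in \<open>center_manifold_theorem\<close>.

The center equation has to be solved for each \<open>\<phi>\<close> separately. A single Lyapunov-Perron equation for the
whole solution in a space weighted by \<open>\<alpha>\<close> would need bounds of the hyperbolic integrals at
all times in terms of \<open>\<alpha>\<close>, and only the bound at the base time \<open>s\<close>, which is the constant
\<open>\<omega>\<close>, is at hand. At the other times the hyperbolic component is controlled by
the Lipschitz constant of \<open>\<phi>\<close>.

The constants: the Lipschitz constant is \<open>N = 1/2\<close>. If \<open>\<alpha>(t,r) Lip(f\<^sub>r) \<alpha>(r,s) / \<alpha>(t,s)\<close> has a majorant,
independent of \<open>s\<close> and \<open>t\<close>, whose primitive \<open>\<kappa>\<close> has variation at most \<open>1/3\<close>, then differences of center
components grow at most like \<open>2 \<alpha>\<close> (\<open>center_estimate\<close>), and differences of solutions in the graph at most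
like \<open>3/2\<close> times that. If moreover the two integrals in \<open>\<omega>\<close> have majorants that integrate
to at most \<open>1/16\<close>, then \<open>\<omega> \<le> 1/8\<close>, the graph transform is a \<open>1/2\<close>-contraction on
sections with Lipschitz constant \<open>1/2\<close>, and \<open>3 \<alpha> \<le> \<alpha> N / \<omega>\<close>, which is the asserted
growth bound.

For polynomial bounds, \<open>a, c \<le> 0\<close> gives \<open>\<alpha>(t,r) \<alpha>(r,s) \<le> D (\<bar>\<mu>(r)\<bar> + 1)\<^sup>\<epsilon> \<alpha>(t,s)\<close> for \<open>r\<close> between \<open>s\<close> and \<open>t\<close>
(\<open>poly_alpha_composition\<close>), which leaves the integrable density \<open>\<mu>'(r) (\<bar>\<mu>(r)\<bar> + 1)\<close> to the power
\<open>\<epsilon> - \<gamma> < -1\<close>. For the integrals defining \<open>\<omega>\<close> the factor \<open>(\<bar>\<mu>(s)\<bar> + 1)\<^sup>\<epsilon>\<close> is absorbed by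
\<open>powr_kernel_bound\<close>, uniformly in \<open>s\<close>.

The derivative of \<open>\<mu>\<close> may be discontinuous and locally unbounded. Estimates are therefore not
carried out with integrals but by comparing a function with an explicit
antiderivative that is a function of \<open>\<mu>\<close> (\<open>norm_diff_le_majorant\<close>).\<close>

section \<open>Comparison with antiderivatives\<close>

text \<open>The mean value inequality in the form that replaces every estimate of an integral over a finite
interval. The interval is a closed segment because the center equation is solved in both time directions.\<close>

lemma norm_diff_le_majorant:
  fixes u :: "real \<Rightarrow> 'a::real_normed_vector"
  assumes u: "\<And>r. r \<in> closed_segment s t \<Longrightarrow> (u has_vector_derivative u' r) (at r)"
    and b: "\<And>r. r \<in> closed_segment s t \<Longrightarrow> (b has_real_derivative b' r) (at r)"
    and le: "\<And>r. r \<in> closed_segment s t \<Longrightarrow> norm (u' r) \<le> b' r"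
  shows "norm (u t - u s) \<le> \<bar>b t - b s\<bar>"
proof -
  have main: "norm (u y - u x) \<le> b y - b x" if "x < y" "{x..y} = closed_segment s t" for x y
  proof (rule differentiable_bound_general[OF \<open>x < y\<close>, where f' = u' and \<phi>' = b'])
    show "continuous_on {x..y} u"
      using u that(2) by (intro continuous_at_imp_continuous_on) (auto dest: has_vector_derivative_continuous)
    show "continuous_on {x..y} b"
      using b that(2) by (intro continuous_at_imp_continuous_on) (auto dest: DERIV_isCont)
    fix r assume "x < r" "r < y"
    then have r: "r \<in> closed_segment s t" using that(2) by force
    show "(u has_vector_derivative u' r) (at r)" "(b has_vector_derivative b' r) (at r)" "norm (u' r) \<le> b' r"
      using u b le r by (auto simp: has_real_derivative_iff_has_vector_derivative)
  qed
  consider "s = t" | "s < t" | "t < s" by linarith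
  then show ?thesis
  proof cases
    case 2 then show ?thesis using main[of s t] by (auto simp: closed_segment_eq_real_ivl)
  next
    case 3 then show ?thesis using main[of t s] by (auto simp: closed_segment_eq_real_ivl norm_minus_commute)
  qed auto
qed

text \<open>A primitive on the whole line: on each interval around the origin it differs by a constant from
the indefinite integral that starts at the left end point.\<close>

lemma continuous_has_antiderivative:
  fixes G :: "real \<Rightarrow> 'a::banach"
  assumes cont: "continuous_on UNIV G"
  shows "\<exists>H. \<forall>t. (H has_vector_derivative G t) (at t)"
proof -
  define H where "H t = (if t \<ge> 0 then integral {0..t} G else - integral {t..0} G)" for t
  have int: "G integrable_on {x..y}" for x y
    using cont continuous_on_subset integrable_continuous_real by blast
  have "(H has_vector_derivative G t) (at t)" for t
  proof -
    define R where "R = \<bar>t\<bar> + 1"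
    have H: "H u = integral {-R..u} G - integral {-R..0} G" if "u \<in> {-R<..<R}" for u
    proof (cases "u \<ge> 0")
      case True
      then have "integral {-R..0} G + integral {0..u} G = integral {-R..u} G"
        using int by (intro Henstock_Kurzweil_Integration.integral_combine) (auto simp: R_def)
      then show ?thesis using True by (simp add: H_def algebra_simps)
    next
      case False
      then have "integral {-R..u} G + integral {u..0} G = integral {-R..0} G"
        using int that by (intro Henstock_Kurzweil_Integration.integral_combine) (auto simp: R_def)
      then show ?thesis using False by (simp add: H_def algebra_simps)
    qed
    have "((\<lambda>u. integral {-R..u} G) has_vector_derivative G t) (at t within {-R..R})"
      using cont by (intro integral_has_vector_derivative continuous_on_subset[OF cont]) (auto simp: R_def)
    then have "((\<lambda>u. integral {-R..u} G) has_vector_derivative G t) (at t)"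
      by (subst (asm) at_within_interior) (auto simp: R_def)
    then have "((\<lambda>u. integral {-R..u} G - integral {-R..0} G) has_vector_derivative G t) (at t)"
      by (auto intro!: derivative_eq_intros)
    then show ?thesis
      by (rule has_vector_derivative_transform_within_open[where S="{-R<..<R}"]) (auto simp: R_def H)
  qed
  then show ?thesis by blast
qed

text \<open>This identifies improper integrals from \<open>-\<infinity>\<close> or to \<open>+\<infinity>\<close>: they are the primitives that vanish there.\<close>

lemma same_derivative_same_limit:
  fixes Y Z :: "real \<Rightarrow> 'a::real_normed_vector"
  assumes Y: "\<And>t. (Y has_vector_derivative G t) (at t)"
    and Z: "\<And>t. (Z has_vector_derivative G t) (at t)"
    and lim: "(Y \<longlongrightarrow> l) F" "(Z \<longlongrightarrow> l) F" and F: "F \<noteq> bot"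
  shows "Y = Z"
proof -
  have "((\<lambda>t. Y t - Z t) has_vector_derivative 0) (at t)" for t
    using has_vector_derivative_diff[OF Y Z] by simp
  then obtain c where c: "\<And>t. Y t - Z t = c"
    using has_vector_derivative_zero_constant[of UNIV "\<lambda>t. Y t - Z t"] by auto
  have "((\<lambda>t. Y t - Z t) \<longlongrightarrow> l - l) F" by (intro tendsto_diff lim)
  then have "c = 0" using c F by (simp add: tendsto_const_iff)
  then show ?thesis using c by (auto simp: fun_eq_iff)
qed

text \<open>The improper integral from \<open>-\<infinity>\<close> of a function dominated by a derivative \<open>b'\<close>. The
monotone function \<open>b\<close> is bounded below, so \<open>b(r)\<close> is close to its infimum for small \<open>r\<close>; hence any
primitive is Cauchy at \<open>-\<infinity>\<close>, and one subtracts its limit.\<close>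

lemma antiderivative_vanishing_at_bot:
  fixes G :: "real \<Rightarrow> 'a::banach"
  assumes cont: "continuous_on UNIV G"
    and b: "\<And>r. r \<le> s \<Longrightarrow> (b has_real_derivative b' r) (at r)"
    and le: "\<And>r. r \<le> s \<Longrightarrow> norm (G r) \<le> b' r"
    and w: "\<And>r. r \<le> s \<Longrightarrow> b s - b r \<le> w"
  shows "\<exists>Y. (\<forall>t. (Y has_vector_derivative G t) (at t)) \<and> (Y \<longlongrightarrow> 0) at_bot \<and> norm (Y s) \<le> w"
proof -
  obtain H where H: "\<And>t. (H has_vector_derivative G t) (at t)"
    using continuous_has_antiderivative[OF cont] by blast
  have diff: "norm (H y - H x) \<le> b y - b x" if "x \<le> y" "y \<le> s" for x y
  proof -
    have "norm (H y - H x) \<le> \<bar>b y - b x\<bar>"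
      using that by (intro norm_diff_le_majorant[OF H b le]) (auto simp: closed_segment_eq_real_ivl)
    moreover have "b x \<le> b y"
    proof (rule DERIV_nonneg_imp_nondecreasing[OF \<open>x \<le> y\<close>])
      fix r assume "x \<le> r" "r \<le> y"
      then have "r \<le> s" using that by simp
      then show "\<exists>D. (b has_real_derivative D) (at r) \<and> 0 \<le> D"
        using b le order_trans[OF norm_ge_zero] by blast
    qed
    ultimately show ?thesis by linarith
  qed
  define i where "i = Inf (b ` {..s})"
  have bdd: "bdd_below (b ` {..s})" using w by (intro bdd_belowI[of _ "b s - w"]) force
  have i_le: "i \<le> b r" if "r \<le> s" for r
    unfolding i_def using that bdd by (intro cInf_lower) auto
  have b_lim: "\<exists>r0\<le>s. b r0 < i + e" if "e > 0" for e
    using cInf_less_iff[of "b ` {..s}" "i + e"] bdd that by (auto simp: i_def)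
  have "convergent (\<lambda>n. H (s - real n))"
  proof (rule Cauchy_convergent, rule CauchyI)
    fix e :: real assume "e > 0"
    then obtain r0 where r0: "r0 \<le> s" "b r0 < i + e/2" using b_lim[of "e/2"] by auto
    obtain M :: nat where M: "real M \<ge> s - r0" using real_arch_simple by blast
    have *: "norm (H (s - real n) - H r0) < e/2" if "n \<ge> M" for n
    proof -
      have "s - real n \<le> r0" using that M by linarith
      from diff[OF this r0(1)] i_le[of "s - real n"] r0 show ?thesis by (simp add: norm_minus_commute)
    qed
    show "\<exists>M. \<forall>m\<ge>M. \<forall>n\<ge>M. norm (H (s - real m) - H (s - real n)) < e"
    proof (intro exI[of _ M] allI impI)
      fix m n assume "m \<ge> M" "n \<ge> M"
      then show "norm (H (s - real m) - H (s - real n)) < e"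
        using norm_triangle_half_l[OF *[of m] *[of n]] by simp
    qed
  qed
  then obtain l where l: "(\<lambda>n. H (s - real n)) \<longlonglongrightarrow> l" by (auto simp: convergent_def)
  have bound: "norm (H r - l) \<le> b r - i" if "r \<le> s" for r
  proof (rule tendsto_upperbound)
    show "(\<lambda>n. norm (H r - H (s - real n))) \<longlonglongrightarrow> norm (H r - l)"
      by (intro tendsto_intros l)
    obtain M :: nat where M: "real M \<ge> s - r" using real_arch_simple by blast
    show "\<forall>\<^sub>F n in sequentially. norm (H r - H (s - real n)) \<le> b r - i"
      using eventually_ge_at_top[of M]
    proof eventually_elim
      case (elim n)
      then have "s - real n \<le> r" using M by linarith
      from diff[OF this that] i_le[of "s - real n"] that this show ?case by linarith
    qed
  qed simp
  have "((\<lambda>t. H t - l) \<longlongrightarrow> 0) at_bot"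
  proof (rule tendstoI)
    fix e :: real assume "e > 0"
    then obtain r0 where r0: "r0 \<le> s" "b r0 < i + e" using b_lim by auto
    show "\<forall>\<^sub>F r in at_bot. dist (H r - l) 0 < e"
      using eventually_le_at_bot[of r0]
    proof eventually_elim
      case (elim r)
      have "b r \<le> b r0" using diff[OF elim r0(1)] norm_ge_zero[of "H r0 - H r"] by linarith
      then show ?case using bound[of r] elim r0 by simp
    qed
  qed
  moreover have "norm (H s - l) \<le> w"
  proof -
    have "b s - w \<le> i" unfolding i_def
      using w by (intro cInf_greatest) (auto simp: algebra_simps)
    then show ?thesis using bound[of s] by simp
  qed
  moreover have "((\<lambda>t. H t - l) has_vector_derivative G t) (at t)" for t
    using H[of t] by (auto intro!: derivative_eq_intros)
  ultimately show ?thesis by (intro exI[of _ "\<lambda>t. H t - l"]) auto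
qed

lemma has_vector_derivative_mirror:
  assumes "(u has_vector_derivative v) (at (- t))"
  shows "((\<lambda>r. u (- r)) has_vector_derivative - v) (at t)"
proof -
  have "((u \<circ> uminus) has_vector_derivative (-1) *\<^sub>R v) (at t)"
    using assms by (intro vector_diff_chain_at) (auto intro!: derivative_eq_intros)
  then show ?thesis by (simp add: o_def)
qed

lemma antiderivative_vanishing_at_top:
  fixes G :: "real \<Rightarrow> 'a::banach"
  assumes cont: "continuous_on UNIV G"
    and b: "\<And>r. r \<ge> s \<Longrightarrow> (b has_real_derivative b' r) (at r)"
    and le: "\<And>r. r \<ge> s \<Longrightarrow> norm (G r) \<le> b' r"
    and w: "\<And>r. r \<ge> s \<Longrightarrow> b r - b s \<le> w"
  shows "\<exists>Y. (\<forall>t. (Y has_vector_derivative G t) (at t)) \<and> (Y \<longlongrightarrow> 0) at_top \<and> norm (Y s) \<le> w"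
proof -
  have "\<exists>Y. (\<forall>t. (Y has_vector_derivative - G (- t)) (at t)) \<and> (Y \<longlongrightarrow> 0) at_bot \<and> norm (Y (- s)) \<le> w"
  proof (rule antiderivative_vanishing_at_bot)
    show "continuous_on UNIV (\<lambda>t. - G (- t))"
      by (intro continuous_intros continuous_on_compose2[OF cont]) auto
    show "((\<lambda>r. - b (- r)) has_real_derivative b' (- r)) (at r)" if "r \<le> - s" for r
      using that has_vector_derivative_mirror[of b "b' (- r)" r] b[of "- r"]
      by (auto simp: has_real_derivative_iff_has_vector_derivative intro!: derivative_eq_intros)
    show "norm (- G (- r)) \<le> b' (- r)" if "r \<le> - s" for r using le[of "- r"] that by simp
    show "- b (- (- s)) - - b (- r) \<le> w" if "r \<le> - s" for r using w[of "- r"] that by simp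
  qed
  then obtain Y where Y: "\<And>t. (Y has_vector_derivative - G (- t)) (at t)"
    "(Y \<longlongrightarrow> 0) at_bot" "norm (Y (- s)) \<le> w" by blast
  show ?thesis
  proof (intro exI[of _ "\<lambda>t. Y (- t)"] conjI allI)
    show "((\<lambda>t. Y (- t)) has_vector_derivative G t) (at t)" for t
      using has_vector_derivative_mirror[OF Y(1)[of "- t"]] by simp
    show "((\<lambda>t. Y (- t)) \<longlongrightarrow> 0) at_top" using Y(2) by (simp add: filterlim_at_bot_mirror)
  qed (use Y in simp)
qed

text \<open>Bielecki's trick: in the weight \<open>exp (2 C \<bar>\<Lambda>(t) - \<Lambda>(s)\<bar>)\<close> integration of a function with
Lipschitz density \<open>C \<Lambda>'\<close> gains the factor \<open>1/2\<close>, on intervals of any length.\<close>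

lemma exp_weight_bound:
  fixes u :: "real \<Rightarrow> 'a::real_normed_vector"
  assumes \<Lambda>: "\<And>r. (\<Lambda> has_real_derivative \<Lambda>' r) (at r)" and nonneg: "\<And>r. \<Lambda>' r \<ge> 0"
    and C: "C > 0" and c: "c \<ge> 0"
    and u: "\<And>r. r \<in> closed_segment s t \<Longrightarrow> (u has_vector_derivative u' r) (at r)"
    and le: "\<And>r. r \<in> closed_segment s t \<Longrightarrow>
       norm (u' r) \<le> C * \<Lambda>' r * (c * exp (2 * C * \<bar>\<Lambda> r - \<Lambda> s\<bar>))"
  shows "norm (u t - u s) \<le> c / 2 * exp (2 * C * \<bar>\<Lambda> t - \<Lambda> s\<bar>)"
proof -
  \<comment> \<open>The sign turns the absolute value into a differentiable function on the segment.\<close>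
  define \<sigma> :: real where "\<sigma> = (if s \<le> t then 1 else -1)"
  have mono: "\<Lambda> x \<le> \<Lambda> y" if "x \<le> y" for x y
    using that \<Lambda> nonneg by (intro DERIV_nonneg_imp_nondecreasing[of x y \<Lambda>]) auto
  have abs: "\<bar>\<Lambda> r - \<Lambda> s\<bar> = \<sigma> * (\<Lambda> r - \<Lambda> s)" if "r \<in> closed_segment s t" for r
    using that mono[of s r] mono[of r s]
    by (auto simp: \<sigma>_def closed_segment_eq_real_ivl split: if_splits)
  define b where "b r = \<sigma> * c / 2 * exp (2 * C * (\<sigma> * (\<Lambda> r - \<Lambda> s)))" for r
  have s2: "\<sigma> * \<sigma> = 1" by (simp add: \<sigma>_def)
  have bd: "(b has_real_derivative C * \<Lambda>' r * (c * exp (2 * C * (\<sigma> * (\<Lambda> r - \<Lambda> s))))) (at r)" for r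
    unfolding b_def using s2 by (auto intro!: derivative_eq_intros \<Lambda> simp: algebra_simps)
  have "norm (u t - u s) \<le> \<bar>b t - b s\<bar>"
    by (rule norm_diff_le_majorant[OF u bd]) (use le abs in auto)
  also have "b t - b s = \<sigma> * (c / 2 * (exp (2 * C * \<bar>\<Lambda> t - \<Lambda> s\<bar>) - 1))"
    unfolding b_def abs[OF ends_in_segment(2), symmetric] by (simp add: algebra_simps)
  also have "\<bar>\<dots>\<bar> = c / 2 * (exp (2 * C * \<bar>\<Lambda> t - \<Lambda> s\<bar>) - 1)"
    using c C by (subst abs_mult) (auto simp: \<sigma>_def)
  also have "\<dots> \<le> c / 2 * exp (2 * C * \<bar>\<Lambda> t - \<Lambda> s\<bar>)" using c by (simp add: algebra_simps)
  finally show ?thesis .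
qed

text \<open>Gronwall's inequality from the previous lemma: at a point where the weighted norm is
maximal, at most half of it comes from the integral, so the initial value accounts for the other half.\<close>

lemma gronwall_exp_bound:
  fixes u :: "real \<Rightarrow> 'a::real_normed_vector"
  assumes \<Lambda>: "\<And>r. (\<Lambda> has_real_derivative \<Lambda>' r) (at r)" and nonneg: "\<And>r. \<Lambda>' r \<ge> 0"
    and C: "C > 0"
    and u: "\<And>r. r \<in> closed_segment s t \<Longrightarrow> (u has_vector_derivative u' r) (at r)"
    and le: "\<And>r. r \<in> closed_segment s t \<Longrightarrow> norm (u' r) \<le> C * \<Lambda>' r * norm (u r)"
  shows "norm (u t) \<le> 2 * norm (u s) * exp (2 * C * \<bar>\<Lambda> t - \<Lambda> s\<bar>)"
proof -
  define w where "w r = exp (2 * C * \<bar>\<Lambda> r - \<Lambda> s\<bar>)" for r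
  have w: "w r \<ge> 1" for r using C by (simp add: w_def)
  have "continuous_on (closed_segment s t) (\<lambda>r. norm (u r) / w r)"
  proof -
    have "continuous_on (closed_segment s t) u" "continuous_on (closed_segment s t) \<Lambda>"
      using u \<Lambda> by (auto intro!: continuous_at_imp_continuous_on
        dest: has_vector_derivative_continuous DERIV_isCont)
    then show ?thesis unfolding w_def by (intro continuous_intros) auto
  qed
  then obtain x where x: "x \<in> closed_segment s t"
    and max: "\<And>r. r \<in> closed_segment s t \<Longrightarrow> norm (u r) / w r \<le> norm (u x) / w x"
    using continuous_attains_sup[of "closed_segment s t"] by force
  define c where "c = norm (u x) / w x"
  have c0: "c \<ge> 0" using w[of x] by (simp add: c_def)
  have uc: "norm (u r) \<le> c * w r" if "r \<in> closed_segment s t" for r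
    using max[OF that] w[of r] by (simp add: c_def[symmetric] field_simps)
  have sub: "closed_segment s x \<subseteq> closed_segment s t"
    using x by (simp add: subset_closed_segment)
  have "norm (u x - u s) \<le> c / 2 * w x"
    unfolding w_def
  proof (rule exp_weight_bound[OF \<Lambda> nonneg C c0])
    fix r assume "r \<in> closed_segment s x"
    then have r: "r \<in> closed_segment s t" using sub by auto
    show "(u has_vector_derivative u' r) (at r)" by (rule u[OF r])
    have "norm (u' r) \<le> C * \<Lambda>' r * norm (u r)" by (rule le[OF r])
    also have "\<dots> \<le> C * \<Lambda>' r * (c * w r)"
      using uc[OF r] C nonneg by (intro mult_left_mono) auto
    finally show "norm (u' r) \<le> C * \<Lambda>' r * (c * exp (2 * C * \<bar>\<Lambda> r - \<Lambda> s\<bar>))" by (simp add: w_def)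
  qed
  moreover have "norm (u x) = c * w x" using w[of x] by (simp add: c_def)
  moreover have "norm (u x) \<le> norm (u s) + norm (u x - u s)"
    by (metis add.commute diff_add_cancel norm_triangle_ineq)
  moreover have "c \<le> c * w x" using c0 w[of x] mult_left_mono[of 1 "w x" c] by simp
  ultimately have "c \<le> 2 * norm (u s)" by linarith
  then have "c * w t \<le> 2 * norm (u s) * w t" using w[of t] by (intro mult_right_mono) auto
  then show ?thesis using uc[OF ends_in_segment(2)] unfolding w_def by linarith
qed

text \<open>The link between the antiderivatives and the Lebesgue integrals in the definition of \<open>\<omega>\<close>.\<close>

lemma nn_integral_le_antiderivative:
  fixes g b :: "real \<Rightarrow> real"
  assumes g: "g \<in> borel_measurable borel"
    and deriv: "\<And>n r. r \<in> {x n..y n} \<Longrightarrow> (b has_real_derivative g r) (at r)"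
    and nonneg: "\<And>n r. r \<in> {x n..y n} \<Longrightarrow> g r \<ge> 0"
    and xy: "\<And>n. x n \<le> y n" and w: "\<And>n. b (y n) - b (x n) \<le> w"
    and inc: "incseq (\<lambda>n :: nat. {x n..y n})" and S: "(\<Union>n. {x n..y n}) = S"
  shows "(\<integral>\<^sup>+ r\<in>S. ennreal (g r) \<partial>lborel) \<le> ennreal w"
proof -
  let ?M = "density lborel (\<lambda>r. ennreal (g r))"
  have eq: "(\<integral>\<^sup>+ r\<in>B. ennreal (g r) \<partial>lborel) = emeasure ?M B" if "B \<in> sets borel" for B
    using g that by (subst emeasure_density) auto
  have "S \<in> sets borel" unfolding S[symmetric] by auto
  then have "(\<integral>\<^sup>+ r\<in>S. ennreal (g r) \<partial>lborel) = (SUP n. emeasure ?M {x n..y n})"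
    unfolding S[symmetric] using inc by (subst eq) (auto intro!: SUP_emeasure_incseq[symmetric])
  also have "\<dots> \<le> ennreal w"
  proof (rule SUP_least)
    fix n
    have "emeasure ?M {x n..y n} = (\<integral>\<^sup>+ r\<in>{x n..y n}. ennreal (g r) \<partial>lborel)" by (rule eq[symmetric]) simp
    also have "\<dots> = ennreal (b (y n) - b (x n))"
      by (rule nn_integral_FTC_Icc[OF g]) (use deriv nonneg xy in auto)
    finally show "emeasure ?M {x n..y n} \<le> ennreal w" using w[of n] by (simp add: ennreal_leI)
  qed
  finally show ?thesis .
qed

section \<open>Contractions for families of weights\<close>

lemma weighted_contraction_step:
  fixes F :: "('i \<Rightarrow> 'b::banach) \<Rightarrow> 'i \<Rightarrow> 'b"
  assumes F: "\<And>\<phi>. \<phi> \<in> S \<Longrightarrow> F \<phi> \<in> S"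
    and contr: "\<And>\<phi> \<psi> c. \<phi> \<in> S \<Longrightarrow> \<psi> \<in> S \<Longrightarrow> c \<ge> 0 \<Longrightarrow>
        \<forall>i\<in>I. norm (\<phi> i - \<psi> i) \<le> c * w i \<Longrightarrow> \<forall>i\<in>I. norm (F \<phi> i - F \<psi> i) \<le> c / 2 * w i"
    and "\<phi> \<in> S" "\<psi> \<in> S" "c \<ge> 0" "\<forall>i\<in>I. norm (\<phi> i - \<psi> i) \<le> c * w i"
  shows "\<forall>i\<in>I. norm ((F ^^ n) \<phi> i - (F ^^ n) \<psi> i) \<le> c / 2 ^ n * w i"
proof (induction n)
  case 0 show ?case using assms by simp
next
  case (Suc n)
  have "(F ^^ n) \<phi> \<in> S" "(F ^^ n) \<psi> \<in> S" by (induction n) (use assms in auto)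
  from contr[OF this _ Suc] \<open>c \<ge> 0\<close> show ?case by (simp add: field_simps)
qed

text \<open>Banach's fixed point theorem for functions, with distances measured by a family of weighted sup norms,
each on its own index set, all contracted by \<open>1/2\<close>. The family is needed for differential
equations on the whole line, where the weight depends on the compact interval; for the graph
transform one weight suffices. The distances need not be finite on all of \<open>S\<close>, only between the
starting point and its image.\<close>

lemma weighted_contraction_fixpoint:
  fixes F :: "('i \<Rightarrow> 'b::banach) \<Rightarrow> 'i \<Rightarrow> 'b"
    and I :: "'j \<Rightarrow> 'i set" and w :: "'j \<Rightarrow> 'i \<Rightarrow> real"
  assumes S0: "\<phi>0 \<in> S" and F: "\<And>\<phi>. \<phi> \<in> S \<Longrightarrow> F \<phi> \<in> S"
    and cover: "\<And>i. \<exists>j. i \<in> I j"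
    and contr: "\<And>j \<phi> \<psi> c. \<phi> \<in> S \<Longrightarrow> \<psi> \<in> S \<Longrightarrow> c \<ge> 0 \<Longrightarrow>
        \<forall>i\<in>I j. norm (\<phi> i - \<psi> i) \<le> c * w j i \<Longrightarrow> \<forall>i\<in>I j. norm (F \<phi> i - F \<psi> i) \<le> c / 2 * w j i"
    and init: "\<And>j. \<exists>C\<ge>0. \<forall>i\<in>I j. norm (F \<phi>0 i - \<phi>0 i) \<le> C * w j i"
    and closed: "\<And>\<phi>s \<phi>. (\<And>n. \<phi>s n \<in> S) \<Longrightarrow>
        (\<And>j. \<exists>e. e \<longlonglongrightarrow> 0 \<and> (\<forall>n. \<forall>i\<in>I j. norm (\<phi>s n i - \<phi> i) \<le> e n * w j i)) \<Longrightarrow> \<phi> \<in> S"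
  shows "\<exists>\<phi>\<in>S. F \<phi> = \<phi>"
proof -
  define \<phi>s where "\<phi>s n = (F ^^ n) \<phi>0" for n
  have \<phi>s_S: "\<phi>s n \<in> S" for n by (induction n) (auto simp: \<phi>s_def S0 F)
  obtain C where C0: "\<And>j. C j \<ge> 0" and C: "\<And>j i. i \<in> I j \<Longrightarrow> norm (F \<phi>0 i - \<phi>0 i) \<le> C j * w j i"
    using init by metis
  have step: "norm (\<phi>s (Suc n) i - \<phi>s n i) \<le> C j / 2 ^ n * w j i" if "i \<in> I j" for n i j
  proof -
    have "\<forall>i\<in>I j. norm ((F ^^ n) (F \<phi>0) i - (F ^^ n) \<phi>0 i) \<le> C j / 2 ^ n * w j i"
      by (rule weighted_contraction_step[where S=S, OF F contr]) (use S0 F C C0 in auto)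
    then show ?thesis using that by (simp add: \<phi>s_def funpow_swap1)
  qed
  \<comment> \<open>A finite geometric sum, written in closed form.\<close>
  have far: "norm (\<phi>s (n + k) i - \<phi>s n i) \<le> (2 - 2 / 2 ^ k) * (C j / 2 ^ n * w j i)"
    if "i \<in> I j" for n k i j
  proof (induction k)
    case (Suc k)
    have "norm (\<phi>s (n + Suc k) i - \<phi>s n i)
        \<le> norm (\<phi>s (Suc (n + k)) i - \<phi>s (n + k) i) + norm (\<phi>s (n + k) i - \<phi>s n i)"
      by (metis add_Suc_right diff_add_cancel norm_triangle_ineq add_diff_eq)
    also have "\<dots> \<le> C j / 2 ^ (n + k) * w j i + (2 - 2 / 2 ^ k) * (C j / 2 ^ n * w j i)"
      by (intro add_mono step Suc that)
    also have "\<dots> = (2 - 2 / 2 ^ Suc k) * (C j / 2 ^ n * w j i)"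
      by (simp add: field_simps power_add)
    finally show ?case .
  qed simp
  have w0: "0 \<le> C j * w j i" if "i \<in> I j" for i j using C[OF that] norm_ge_zero order_trans by blast
  have far': "norm (\<phi>s m i - \<phi>s n i) \<le> 2 * C j / 2 ^ n * w j i" if "i \<in> I j" and mn: "m \<ge> n" for m n i j
  proof -
    obtain k where m: "m = n + k" using mn le_Suc_ex by blast
    have "norm (\<phi>s m i - \<phi>s n i) \<le> (2 - 2 / 2 ^ k) * (C j / 2 ^ n * w j i)"
      unfolding m by (rule far[OF that(1)])
    also have "\<dots> \<le> 2 * (C j / 2 ^ n * w j i)"
      using w0[OF that(1)] by (intro mult_right_mono) (auto intro!: divide_nonneg_pos)
    finally show ?thesis by simp
  qed
  have lim0: "(\<lambda>n. 2 * C j / 2 ^ n * x) \<longlonglongrightarrow> 0" for j x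
    using LIMSEQ_divide_realpow_zero[of 2 "2 * C j * x"] by (simp add: field_simps)
  have "convergent (\<lambda>n. \<phi>s n i)" for i
  proof -
    obtain j where j: "i \<in> I j" using cover by blast
    show ?thesis
    proof (rule Cauchy_convergent, rule CauchyI)
      fix e :: real assume "e > 0"
      then have "\<forall>\<^sub>F n in sequentially. 2 * C j / 2 ^ n * w j i < e/2"
        using order_tendstoD(2)[OF lim0, of "e/2"] by simp
      then obtain M where M: "2 * C j / 2 ^ M * w j i < e/2"
        by (auto simp: eventually_sequentially)
      have *: "norm (\<phi>s m i - \<phi>s M i) < e/2" if "m \<ge> M" for m
        using far'[OF j that] M by linarith
      show "\<exists>M. \<forall>m\<ge>M. \<forall>n\<ge>M. norm (\<phi>s m i - \<phi>s n i) < e"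
        using norm_triangle_half_l[OF * *] by blast
    qed
  qed
  then obtain \<phi> where \<phi>: "\<And>i. (\<lambda>n. \<phi>s n i) \<longlonglongrightarrow> \<phi> i" unfolding convergent_def by metis
  have rate: "norm (\<phi>s n i - \<phi> i) \<le> 2 * C j / 2 ^ n * w j i" if "i \<in> I j" for n i j
  proof (rule tendsto_upperbound)
    show "(\<lambda>m. norm (\<phi>s n i - \<phi>s m i)) \<longlonglongrightarrow> norm (\<phi>s n i - \<phi> i)" by (intro tendsto_intros \<phi>)
    show "\<forall>\<^sub>F m in sequentially. norm (\<phi>s n i - \<phi>s m i) \<le> 2 * C j / 2 ^ n * w j i"
      using eventually_ge_at_top[of n] 
      by eventually_elim (metis far'[OF that] norm_minus_commute)
  qed simp
  have \<phi>_S: "\<phi> \<in> S"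
  proof (rule closed[OF \<phi>s_S])
    fix j show "\<exists>e. e \<longlonglongrightarrow> 0 \<and> (\<forall>n. \<forall>i\<in>I j. norm (\<phi>s n i - \<phi> i) \<le> e n * w j i)"
      using lim0[of j 1] rate by (intro exI[of _ "\<lambda>n. 2 * C j / 2 ^ n"]) simp
  qed
  moreover have "F \<phi> i = \<phi> i" for i
  proof -
    obtain j where j: "i \<in> I j" using cover by blast
    have "norm (\<phi>s (Suc n) i - F \<phi> i) \<le> 2 * C j / 2 ^ n / 2 * w j i" for n
      using contr[OF \<phi>s_S \<phi>_S, of "2 * C j / 2 ^ n" j n] rate j C0[of j] by (auto simp: \<phi>s_def)
    then have "norm (\<phi>s (Suc n) i - F \<phi> i) \<le> 2 * C j / 2 ^ n * (w j i / 2)" for n by simp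
    then have "(\<lambda>n. \<phi>s (Suc n) i - F \<phi> i) \<longlonglongrightarrow> 0"
      by (intro Lim_null_comparison[OF always_eventually lim0[of j "w j i / 2"]]) auto
    then have "(\<lambda>n. \<phi>s (Suc n) i) \<longlonglongrightarrow> F \<phi> i" by (simp add: LIM_zero_iff)
    then show ?thesis using LIMSEQ_unique LIMSEQ_Suc[OF \<phi>] by blast
  qed
  ultimately show ?thesis by (intro bexI[of _ \<phi>]) auto
qed

lemma weighted_contraction_unique:
  fixes F :: "('i \<Rightarrow> 'b::banach) \<Rightarrow> 'i \<Rightarrow> 'b"
  assumes F: "\<And>\<phi>. \<phi> \<in> S \<Longrightarrow> F \<phi> \<in> S"
    and contr: "\<And>\<phi> \<psi> c. \<phi> \<in> S \<Longrightarrow> \<psi> \<in> S \<Longrightarrow> c \<ge> 0 \<Longrightarrow>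
        \<forall>i\<in>I. norm (\<phi> i - \<psi> i) \<le> c * w i \<Longrightarrow> \<forall>i\<in>I. norm (F \<phi> i - F \<psi> i) \<le> c / 2 * w i"
    and "\<phi> \<in> S" "\<psi> \<in> S" "F \<phi> = \<phi>" "F \<psi> = \<psi>" "c \<ge> 0" "\<forall>i\<in>I. norm (\<phi> i - \<psi> i) \<le> c * w i"
    and "i \<in> I"
  shows "\<phi> i = \<psi> i"
proof -
  have iter: "(F ^^ n) \<phi> = \<phi>" "(F ^^ n) \<psi> = \<psi>" for n by (induction n) (use assms in auto)
  have "norm (\<phi> i - \<psi> i) \<le> (c * w i) / 2 ^ n" for n
  proof -
    have "\<forall>i\<in>I. norm ((F ^^ n) \<phi> i - (F ^^ n) \<psi> i) \<le> c / 2 ^ n * w i"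
      by (rule weighted_contraction_step[OF F contr assms(3,4,7,8)])
    then show ?thesis using \<open>i \<in> I\<close> unfolding iter by simp
  qed
  then have "norm (\<phi> i - \<psi> i) \<le> 0"
    using LIMSEQ_le_const[OF LIMSEQ_divide_realpow_zero[of 2 "c * w i"], of "norm (\<phi> i - \<psi> i)"] by simp
  then show ?thesis by simp
qed

section \<open>Global solutions\<close>

text \<open>Picard iteration with a Lipschitz density \<open>C \<Lambda>'\<close>, where \<open>C\<close> may depend on the compact
interval. The iteration takes place on the whole line, so that no solutions have to be glued.\<close>

lemma picard_global_solution:
  fixes g :: "real \<Rightarrow> 'a \<Rightarrow> 'a::banach"
  assumes cont: "continuous_on UNIV (\<lambda>(t, x). g t x)"
    and \<Lambda>: "\<And>r. (\<Lambda> has_real_derivative \<Lambda>' r) (at r)" and nonneg: "\<And>r. \<Lambda>' r \<ge> 0"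
    and lip: "\<And>R. \<exists>C>0. \<forall>t\<in>{-R..R}. \<forall>x y. norm (g t x - g t y) \<le> C * \<Lambda>' t * norm (x - y)"
  shows "\<exists>z. global_solution g z \<and> z s = x0"
proof -
  define AD where "AD G = (SOME H. \<forall>t. (H has_vector_derivative G t) (at t))" for G :: "real \<Rightarrow> 'a"
  have AD: "(AD G has_vector_derivative G t) (at t)" if "continuous_on UNIV G" for G t
    using someI_ex[OF continuous_has_antiderivative[OF that]] by (simp add: AD_def)
  define F where "F z t = x0 + (AD (\<lambda>r. g r (z r)) t - AD (\<lambda>r. g r (z r)) s)" for z t
  define S where "S = {z :: real \<Rightarrow> 'a. continuous_on UNIV z}"
  have gz: "continuous_on UNIV (\<lambda>r. g r (z r))" if "z \<in> S" for z
  proof -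
    have "continuous_on UNIV (\<lambda>r. (r, z r))"
      using that by (intro continuous_on_Pair continuous_on_id) (simp add: S_def)
    then show ?thesis using continuous_on_compose2[OF cont, of UNIV "\<lambda>r. (r, z r)"] by simp
  qed
  have F_deriv: "(F z has_vector_derivative g t (z t)) (at t)" if "z \<in> S" for z t
    unfolding F_def using AD[OF gz[OF that], of t] by (auto intro!: derivative_eq_intros)
  have F_S: "F z \<in> S" if "z \<in> S" for z
    unfolding S_def using F_deriv[OF that]
    by (auto intro!: continuous_at_imp_continuous_on dest: has_vector_derivative_continuous)
  define I where "I j = {- (\<bar>s\<bar> + real j)..\<bar>s\<bar> + real j}" for j
  obtain C where C0: "\<And>j. C j > 0"
    and C: "\<And>j t x y. t \<in> I j \<Longrightarrow> norm (g t x - g t y) \<le> C j * \<Lambda>' t * norm (x - y)"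
    using lip[of "\<bar>s\<bar> + real j" for j] unfolding I_def by metis
  define w where "w j t = exp (2 * C j * \<bar>\<Lambda> t - \<Lambda> s\<bar>)" for j t
  have w1: "w j t \<ge> 1" for j t using C0[of j] by (simp add: w_def)
  have seg: "closed_segment s t \<subseteq> I j" if "t \<in> I j" for t j
    using that by (auto simp: I_def closed_segment_eq_real_ivl)
  have \<Lambda>_cont: "continuous_on B \<Lambda>" for B
    using \<Lambda> by (auto intro!: continuous_at_imp_continuous_on dest: DERIV_isCont)
  have "\<exists>z\<in>S. F z = z"
  proof (rule weighted_contraction_fixpoint[where I = I and w = w])
    show "(\<lambda>_. x0) \<in> S" by (simp add: S_def)
    show "F z \<in> S" if "z \<in> S" for z using F_S that .
    show "\<exists>j. t \<in> I j" for t
    proof -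
      obtain j :: nat where "real j \<ge> \<bar>t\<bar>" using real_arch_simple by blast
      then show ?thesis by (intro exI[of _ j]) (auto simp: I_def)
    qed
    show "\<forall>t\<in>I j. norm (F y t - F z t) \<le> c / 2 * w j t"
      if yz: "y \<in> S" "z \<in> S" and c: "c \<ge> 0" and le: "\<forall>t\<in>I j. norm (y t - z t) \<le> c * w j t" for j y z c
    proof
      fix t assume t: "t \<in> I j"
      have "norm ((F y t - F z t) - (F y s - F z s)) \<le> c / 2 * exp (2 * C j * \<bar>\<Lambda> t - \<Lambda> s\<bar>)"
      proof (rule exp_weight_bound[OF \<Lambda> nonneg C0 c])
        fix r assume "r \<in> closed_segment s t"
        then have r: "r \<in> I j" using seg[OF t] by blast
        show "((\<lambda>t. F y t - F z t) has_vector_derivative g r (y r) - g r (z r)) (at r)"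
          by (intro has_vector_derivative_diff F_deriv yz)
        have "norm (g r (y r) - g r (z r)) \<le> C j * \<Lambda>' r * norm (y r - z r)" by (rule C[OF r])
        also have "\<dots> \<le> C j * \<Lambda>' r * (c * w j r)"
          using le r C0[of j] nonneg[of r] by (intro mult_left_mono) auto
        finally show "norm (g r (y r) - g r (z r)) \<le> C j * \<Lambda>' r * (c * exp (2 * C j * \<bar>\<Lambda> r - \<Lambda> s\<bar>))"
          by (simp add: w_def)
      qed
      then show "norm (F y t - F z t) \<le> c / 2 * w j t" by (simp add: F_def w_def)
    qed
    show "\<exists>K\<ge>0. \<forall>t\<in>I j. norm (F (\<lambda>_. x0) t - x0) \<le> K * w j t" for j
    proof -
      have "continuous_on UNIV (F (\<lambda>_. x0))" using F_S[of "\<lambda>_. x0"] by (simp add: S_def)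
      then have "continuous_on (I j) (\<lambda>t. F (\<lambda>_. x0) t - x0)"
        by (intro continuous_intros) (auto intro: continuous_on_subset)
      then have "bounded ((\<lambda>t. F (\<lambda>_. x0) t - x0) ` I j)"
        by (intro compact_imp_bounded compact_continuous_image) (auto simp: I_def)
      then obtain K where K: "K > 0" "\<And>t. t \<in> I j \<Longrightarrow> norm (F (\<lambda>_. x0) t - x0) \<le> K"
        unfolding bounded_pos by auto
      have "norm (F (\<lambda>_. x0) t - x0) \<le> K * w j t" if "t \<in> I j" for t
      proof -
        have "K * 1 \<le> K * w j t" using K(1) w1 by (intro mult_left_mono) auto
        then show ?thesis using K(2)[OF that] by simp
      qed
      then show ?thesis using K(1) by (intro exI[of _ K]) auto
    qed
    fix \<phi>s \<phi>
    assume \<phi>s: "\<And>n :: nat. \<phi>s n \<in> S"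
      and lim: "\<And>j. \<exists>e. e \<longlonglongrightarrow> 0 \<and> (\<forall>n. \<forall>i\<in>I j. norm (\<phi>s n i - \<phi> i) \<le> e n * w j i)"
    have "isCont \<phi> t" for t
    proof -
      obtain j :: nat where j: "real j \<ge> \<bar>t\<bar> + 1" using real_arch_simple by blast
      obtain e where e: "e \<longlonglongrightarrow> 0" and le: "\<And>n i. i \<in> I j \<Longrightarrow> norm (\<phi>s n i - \<phi> i) \<le> e n * w j i"
        using lim[of j] by blast
      have "continuous_on (I j) (w j)" unfolding w_def by (intro continuous_intros \<Lambda>_cont)
      then have "bounded (w j ` I j)"
        by (intro compact_imp_bounded compact_continuous_image) (auto simp: I_def)
      then obtain W where W: "W > 0" "\<And>t. t \<in> I j \<Longrightarrow> w j t \<le> W"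
        unfolding bounded_pos by (force simp: abs_le_iff)
      have "uniform_limit (I j) \<phi>s \<phi> sequentially"
      proof (rule uniform_limitI)
        fix \<epsilon> :: real assume "\<epsilon> > 0"
        moreover have "(\<lambda>n. \<bar>e n\<bar> * W) \<longlonglongrightarrow> 0" using e by (auto intro!: tendsto_eq_intros)
        ultimately have "\<forall>\<^sub>F n in sequentially. \<bar>e n\<bar> * W < \<epsilon>" using order_tendstoD(2) by blast
        then show "\<forall>\<^sub>F n in sequentially. \<forall>x\<in>I j. dist (\<phi>s n x) (\<phi> x) < \<epsilon>"
        proof eventually_elim
          case (elim n)
          have "dist (\<phi>s n x) (\<phi> x) < \<epsilon>" if "x \<in> I j" for x
          proof -
            have "e n * w j x \<le> \<bar>e n\<bar> * W"
              using W that w1[of j x] by (intro mult_mono) auto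
            then show ?thesis using le[OF that, of n] elim by (simp add: dist_norm)
          qed
          then show ?case by blast
        qed
      qed
      then have "continuous_on (I j) \<phi>"
        using \<phi>s by (intro uniform_limit_theorem[of _ \<phi>s sequentially])
          (auto simp: S_def intro!: always_eventually intro: continuous_on_subset)
      then show ?thesis
        by (rule continuous_on_interior) (use j in \<open>auto simp: I_def\<close>)
    qed
    then show "\<phi> \<in> S" by (simp add: S_def continuous_at_imp_continuous_on)
  qed
  then obtain z where z: "z \<in> S" "F z = z" by blast
  have "z s = x0" using fun_cong[OF z(2), of s] by (simp add: F_def)
  moreover have "global_solution g z" using F_deriv[OF z(1)] z(2) by (simp add: global_solution_def)
  ultimately show ?thesis by blast
qed

lemma picard_solution_unique:
  fixes g :: "real \<Rightarrow> 'a \<Rightarrow> 'a::real_normed_vector"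
  assumes \<Lambda>: "\<And>r. (\<Lambda> has_real_derivative \<Lambda>' r) (at r)" and nonneg: "\<And>r. \<Lambda>' r \<ge> 0"
    and lip: "\<And>R. \<exists>C>0. \<forall>t\<in>{-R..R}. \<forall>x y. norm (g t x - g t y) \<le> C * \<Lambda>' t * norm (x - y)"
    and y: "global_solution g y" and z: "global_solution g z" and eq: "y s = z s"
  shows "y = z"
proof
  fix t
  obtain C where C: "C > 0"
    "\<And>r x x'. r \<in> {- (\<bar>s\<bar> + \<bar>t\<bar>)..\<bar>s\<bar> + \<bar>t\<bar>} \<Longrightarrow> norm (g r x - g r x') \<le> C * \<Lambda>' r * norm (x - x')"
    using lip[of "\<bar>s\<bar> + \<bar>t\<bar>"] by blast
  have "norm (y t - z t) \<le> 2 * norm (y s - z s) * exp (2 * C * \<bar>\<Lambda> t - \<Lambda> s\<bar>)"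
  proof (rule gronwall_exp_bound[OF \<Lambda> nonneg C(1)])
    fix r assume "r \<in> closed_segment s t"
    then have r: "r \<in> {- (\<bar>s\<bar> + \<bar>t\<bar>)..\<bar>s\<bar> + \<bar>t\<bar>}" by (auto simp: closed_segment_eq_real_ivl split: if_splits)
    show "((\<lambda>r. y r - z r) has_vector_derivative g r (y r) - g r (z r)) (at r)"
      using y z by (auto intro: has_vector_derivative_diff simp: global_solution_def)
    show "norm (g r (y r) - g r (z r)) \<le> C * \<Lambda>' r * norm (y r - z r)" by (rule C(2)[OF r])
  qed
  then show "y t = z t" using eq by simp
qed

lemma has_vector_derivative_iff_quotient:
  fixes u :: "real \<Rightarrow> 'a::real_normed_vector"
  shows "(u has_vector_derivative v) (at t) \<longleftrightarrow> ((\<lambda>r. (u r - u t) /\<^sub>R (r - t)) \<longlongrightarrow> v) (at t)"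
proof -
  have "(u has_vector_derivative v) (at t) \<longleftrightarrow>
      ((\<lambda>r. norm (u r - u t - (r - t) *\<^sub>R v) / norm (r - t)) \<longlongrightarrow> 0) (at t)"
    by (simp add: has_vector_derivative_def has_derivative_iff_norm bounded_linear_scaleR_left)
  also have "\<dots> \<longleftrightarrow> ((\<lambda>r. norm ((u r - u t) /\<^sub>R (r - t) - v)) \<longlongrightarrow> 0) (at t)"
  proof (rule filterlim_cong[OF refl refl])
    show "\<forall>\<^sub>F r in at t. norm (u r - u t - (r - t) *\<^sub>R v) / norm (r - t) = norm ((u r - u t) /\<^sub>R (r - t) - v)"
      unfolding eventually_at_filter
    proof (intro always_eventually allI impI)
      fix r :: real assume "r \<noteq> t"
      then have "(u r - u t) /\<^sub>R (r - t) - v = (u r - u t - (r - t) *\<^sub>R v) /\<^sub>R (r - t)"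
        by (simp add: scaleR_diff_right)
      then show "norm (u r - u t - (r - t) *\<^sub>R v) / norm (r - t) = norm ((u r - u t) /\<^sub>R (r - t) - v)"
        by (simp add: divide_inverse mult.commute)
    qed
  qed
  also have "\<dots> \<longleftrightarrow> ((\<lambda>r. (u r - u t) /\<^sub>R (r - t)) \<longlongrightarrow> v) (at t)"
    by (simp add: tendsto_norm_zero_iff LIM_zero_iff)
  finally show ?thesis .
qed

section \<open>Evolution operators and invariant splittings\<close>

locale evolution =
  fixes A :: "real \<Rightarrow> 'a::banach \<Rightarrow>\<^sub>L 'a" and T :: "real \<Rightarrow> real \<Rightarrow> 'a \<Rightarrow>\<^sub>L 'a"
  assumes A_cont: "continuous_on UNIV A" and T_evolution: "evolution_operator A T"
begin

lemma T_deriv: "((\<lambda>t. T t s x) has_vector_derivative A t (T t s x)) (at t)"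
  using T_evolution by (simp add: evolution_operator_def global_solution_def)

lemma T_id [simp]: "T s s x = x"
  using T_evolution by (simp add: evolution_operator_def)

lemma T_comp [simp]: "T t r (T r s x) = T t s x"
  using T_evolution unfolding evolution_operator_def by metis

text \<open>Gronwall's inequality, applied forwards and backwards, bounds both \<open>T t s\<close> and its inverse.\<close>

lemma T_bounded: "\<exists>B>0. \<forall>t\<in>{-R..R}. \<forall>s\<in>{-R..R}. \<forall>x. norm (T t s x) \<le> B * norm x"
proof -
  have "bounded (A ` {-R..R})"
    using A_cont by (intro compact_imp_bounded compact_continuous_image) (auto intro: continuous_on_subset)
  then obtain K where K: "K > 0" "\<And>r. r \<in> {-R..R} \<Longrightarrow> norm (A r) \<le> K"
    unfolding bounded_pos by auto
  have "norm (T t s x) \<le> 2 * exp (2 * K * (2 * \<bar>R\<bar>)) * norm x" if "t \<in> {-R..R}" "s \<in> {-R..R}" for t s x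
  proof -
    have "norm (T t s x) \<le> 2 * norm (T s s x) * exp (2 * K * \<bar>t - s\<bar>)"
    proof (rule gronwall_exp_bound[where \<Lambda> = "\<lambda>r. r" and \<Lambda>' = "\<lambda>_. 1", OF _ _ K(1) T_deriv])
      fix r assume "r \<in> closed_segment s t"
      then have "r \<in> {-R..R}" using that by (auto simp: closed_segment_eq_real_ivl split: if_splits)
      then show "norm (A r (T r s x)) \<le> K * 1 * norm (T r s x)"
        using norm_blinfun[of "A r" "T r s x"] K(2)[of r]
        by (smt (verit) mult_right_mono norm_ge_zero mult.right_neutral)
    qed auto
    also have "\<dots> \<le> 2 * norm x * exp (2 * K * (2 * \<bar>R\<bar>))"
      using that K(1) by (intro mult_mono) auto
    finally show ?thesis by (simp add: mult_ac)
  qed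
  then show ?thesis by (intro exI[of _ "2 * exp (2 * K * (2 * \<bar>R\<bar>))"]) auto
qed

text \<open>Joint continuity. The identity \<open>T t s\<^sub>0 = T t s T s s\<^sub>0\<close> reduces the dependence on the initial time
to the dependence on the final time, which is differentiable.\<close>

lemma tendsto_T [tendsto_intros]:
  assumes a: "(a \<longlongrightarrow> t) F" and b: "(b \<longlongrightarrow> s) F" and c: "(c \<longlongrightarrow> x) F"
  shows "((\<lambda>p. T (a p) (b p) (c p)) \<longlongrightarrow> T t s x) F"
proof -
  define R where "R = \<bar>t\<bar> + \<bar>s\<bar> + 1"
  obtain B where B: "\<And>t s x. t \<in> {-R..R} \<Longrightarrow> s \<in> {-R..R} \<Longrightarrow> norm (T t s x) \<le> B * norm x"
    using T_bounded[of R] by blast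
  have T_lim: "((\<lambda>p. T (a' p) s x) \<longlongrightarrow> T t' s x) F" if "(a' \<longlongrightarrow> t') F" for a' t'
    using isCont_tendsto_compose[OF has_vector_derivative_continuous[OF T_deriv] that] by simp
  have "((\<lambda>p. B * norm (c p - T (b p) s x) + norm (T (a p) s x - T t s x)) \<longlongrightarrow> 0) F"
    by (rule tendsto_eq_intros tendsto_norm_zero c T_lim[OF b] T_lim[OF a] refl | simp)+
  moreover have "t \<in> {-R<..<R}" "s \<in> {-R<..<R}" by (auto simp: R_def)
  then have "\<forall>\<^sub>F p in F. a p \<in> {-R<..<R}" "\<forall>\<^sub>F p in F. b p \<in> {-R<..<R}"
    using topological_tendstoD[OF a open_greaterThanLessThan] topological_tendstoD[OF b open_greaterThanLessThan]
    by blast+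
  then have "\<forall>\<^sub>F p in F. norm (T (a p) (b p) (c p) - T t s x)
      \<le> B * norm (c p - T (b p) s x) + norm (T (a p) s x - T t s x)"
  proof eventually_elim
    case (elim p)
    have "T (a p) (b p) (c p) - T t s x = T (a p) (b p) (c p - T (b p) s x) + (T (a p) s x - T t s x)"
      by (simp add: blinfun.diff_right)
    then have "norm (T (a p) (b p) (c p) - T t s x)
        \<le> norm (T (a p) (b p) (c p - T (b p) s x)) + norm (T (a p) s x - T t s x)"
      by (metis norm_triangle_ineq)
    moreover have "norm (T (a p) (b p) (c p - T (b p) s x)) \<le> B * norm (c p - T (b p) s x)"
      using elim by (intro B) auto
    ultimately show ?case by linarith
  qed
  ultimately have "((\<lambda>p. T (a p) (b p) (c p) - T t s x) \<longlongrightarrow> 0) F" by (rule Lim_null_comparison[rotated])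
  then show ?thesis by (simp add: LIM_zero_iff)
qed

lemma continuous_on_T [continuous_intros]:
  "continuous_on S a \<Longrightarrow> continuous_on S b \<Longrightarrow> continuous_on S c \<Longrightarrow>
   continuous_on S (\<lambda>p. T (a p) (b p) (c p))"
  unfolding continuous_on_def by (auto intro!: tendsto_T)

text \<open>In the moving frame \<open>z(t) = T 0 t (v(t))\<close> the linear part disappears and the projections become
constant. This lemma and the next one are the change of frame in the two directions; together they are the
variation of constants formula.\<close>

lemma pull_back_deriv:
  assumes "(v has_vector_derivative v') (at t)"
  shows "((\<lambda>t. T 0 t (v t)) has_vector_derivative T 0 t (v' - A t (v t))) (at t)"
proof -
  have "((\<lambda>r. v r - T r t (v t)) has_vector_derivative v' - A t (T t t (v t))) (at t)"
    by (intro has_vector_derivative_diff assms T_deriv)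
  then have "((\<lambda>r. (v r - T r t (v t)) /\<^sub>R (r - t)) \<longlongrightarrow> v' - A t (v t)) (at t)"
    by (simp add: has_vector_derivative_iff_quotient)
  then have "((\<lambda>r. T 0 r ((v r - T r t (v t)) /\<^sub>R (r - t))) \<longlongrightarrow> T 0 t (v' - A t (v t))) (at t)"
    by (intro tendsto_T) auto
  then show ?thesis
    by (simp add: has_vector_derivative_iff_quotient blinfun.scaleR_right blinfun.diff_right)
qed

lemma push_forward_deriv:
  assumes "(z has_vector_derivative z') (at t)"
  shows "((\<lambda>t. T t 0 (z t)) has_vector_derivative A t (T t 0 (z t)) + T t 0 z') (at t)"
proof -
  have "((\<lambda>r. (T r 0 (z t) - T t 0 (z t)) /\<^sub>R (r - t) + T r 0 ((z r - z t) /\<^sub>R (r - t)))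
      \<longlongrightarrow> A t (T t 0 (z t)) + T t 0 z') (at t)"
    using T_deriv[of 0 "z t" t] assms
    by (intro tendsto_add tendsto_T) (auto simp: has_vector_derivative_iff_quotient)
  moreover have "(T r 0 (z t) - T t 0 (z t)) /\<^sub>R (r - t) + T r 0 ((z r - z t) /\<^sub>R (r - t))
      = (T r 0 (z r) - T t 0 (z t)) /\<^sub>R (r - t)" for r
    by (simp add: blinfun.scaleR_right blinfun.diff_right scaleR_diff_right)
  ultimately show ?thesis by (simp add: has_vector_derivative_iff_quotient)
qed

lemma solution_pull_back_iff:
  "global_solution (\<lambda>t x. A t x + f t x) v \<longleftrightarrow>
     (\<forall>t. ((\<lambda>t. T 0 t (v t)) has_vector_derivative T 0 t (f t (v t))) (at t))"
proof
  assume v: "global_solution (\<lambda>t x. A t x + f t x) v"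
  show "\<forall>t. ((\<lambda>t. T 0 t (v t)) has_vector_derivative T 0 t (f t (v t))) (at t)"
  proof
    fix t
    have "(v has_vector_derivative A t (v t) + f t (v t)) (at t)" using v by (simp add: global_solution_def)
    from pull_back_deriv[OF this]
    show "((\<lambda>t. T 0 t (v t)) has_vector_derivative T 0 t (f t (v t))) (at t)" by simp
  qed
next
  assume z: "\<forall>t. ((\<lambda>t. T 0 t (v t)) has_vector_derivative T 0 t (f t (v t))) (at t)"
  show "global_solution (\<lambda>t x. A t x + f t x) v"
    unfolding global_solution_def
  proof
    fix t
    from push_forward_deriv[OF z[rule_format, of t]]
    show "(v has_vector_derivative A t (v t) + f t (v t)) (at t)" by simp
  qed
qed

end

locale splitting = evolution A T for A :: "real \<Rightarrow> 'a::banach \<Rightarrow>\<^sub>L 'a" and T +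
  fixes P Qp Qm :: "real \<Rightarrow> 'a \<Rightarrow>\<^sub>L 'a"
  assumes split: "invariant_splitting T P Qp Qm"
begin

lemma proj_idem [simp]: "P t (P t x) = P t x" "Qp t (Qp t x) = Qp t x" "Qm t (Qm t x) = Qm t x"
  using split unfolding invariant_splitting_def by (metis blinfun_apply_blinfun_compose)+

lemma proj_sum: "P t x + Qp t x + Qm t x = x"
proof -
  have "P t + Qp t + Qm t = id_blinfun" using split by (simp add: invariant_splitting_def)
  then show ?thesis by (metis blinfun.add_left id_blinfun.rep_eq)
qed

lemma P_Qp [simp]: "P t (Qp t x) = 0"
  using split unfolding invariant_splitting_def
  by (metis blinfun_apply_blinfun_compose zero_blinfun.rep_eq)

lemma P_Qm [simp]: "P t (Qm t x) = 0"
proof -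
  have "P t x + P t (Qp t x) + P t (Qm t x) = P t x"
    using proj_sum[of t x] by (metis blinfun.add_right proj_idem(1))
  then show ?thesis by simp
qed

lemma P_T: "P t (T t s x) = T t s (P s x)"
  using split unfolding invariant_splitting_def by (metis blinfun_apply_blinfun_compose)

lemma Qp_T: "Qp t (T t s x) = T t s (Qp s x)"
  using split unfolding invariant_splitting_def by (metis blinfun_apply_blinfun_compose)

lemma Qm_eq: "Qm t x = x - P t x - Qp t x"
  using proj_sum[of t x] by (simp add: algebra_simps)

lemma Qm_T: "Qm t (T t s x) = T t s (Qm s x)"
  by (simp add: Qm_eq P_T Qp_T blinfun.diff_right)

lemma continuous_on_P [continuous_intros]:
  assumes "continuous_on S a" "continuous_on S c"
  shows "continuous_on S (\<lambda>p. P (a p) (c p))"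
proof -
  have "continuous_on S (\<lambda>p. T (a p) 0 (P 0 (T 0 (a p) (c p))))"
    by (intro continuous_intros assms)
  then show ?thesis by (simp add: P_T[symmetric])
qed

lemma center_bundle_iff [simp]: "(t, x) \<in> center_bundle P \<longleftrightarrow> P t x = x"
  by (auto simp: center_bundle_def image_iff) metis

text \<open>The sum \<open>F\<^sup>+ \<oplus> F\<^sup>-\<close> as the kernel of \<open>P\<close>, a condition that is visibly closed.\<close>

lemma kernel_P: "(\<exists>\<eta>p\<in>range (Qp t). \<exists>\<eta>m\<in>range (Qm t). x = \<eta>p + \<eta>m) \<longleftrightarrow> P t x = 0"
proof
  assume "P t x = 0"
  then have "x = Qp t x + Qm t x" using proj_sum[of t x] by simp
  then show "\<exists>\<eta>p\<in>range (Qp t). \<exists>\<eta>m\<in>range (Qm t). x = \<eta>p + \<eta>m" by blast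
qed (auto simp: blinfun.add_right)

lemma lipschitz_sections_iff:
  "\<phi> \<in> lipschitz_sections P Qp Qm N \<longleftrightarrow>
     \<phi> \<in> extensional (center_bundle P) \<and> continuous_on (center_bundle P) \<phi> \<and>
     (\<forall>t. \<phi> (t, 0) = 0) \<and> (\<forall>t \<xi>. P t \<xi> = \<xi> \<longrightarrow> P t (\<phi> (t, \<xi>)) = 0) \<and>
     (\<forall>t \<xi> \<xi>'. P t \<xi> = \<xi> \<longrightarrow> P t \<xi>' = \<xi>' \<longrightarrow> norm (\<phi> (t, \<xi>) - \<phi> (t, \<xi>')) \<le> N * norm (\<xi> - \<xi>'))"
  unfolding lipschitz_sections_def kernel_P by (auto simp: Ball_def)

end

section \<open>Small perturbations of a trichotomy\<close>

text \<open>A trichotomy with arbitrary bounds and a perturbation whose Lipschitz constants \<open>L\<close> are small with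
respect to them. The functions \<open>\<kappa>\<close>, \<open>\<nu>p s\<close> and \<open>\<nu>m s\<close> are antiderivatives of majorants of the
three kernels that occur: \<open>\<kappa>\<close> for the center equation, where the bound must be relative to
\<open>\<alpha> t s\<close>, and \<open>\<nu>p s\<close>, \<open>\<nu>m s\<close> for the two integrals in \<open>\<omega>\<close>, whose values
they bound by \<open>1/16\<close> each. The function \<open>\<Lambda>\<close> only serves to
solve differential equations; it carries no smallness. The last two assumptions make the hyperbolic
components of a solution that grows at most like \<open>\<alpha>\<close> vanish in the past and in the future, respectively.\<close>

locale small_perturbation = splitting A T P Qp Qm
  for A :: "real \<Rightarrow> 'a::banach \<Rightarrow>\<^sub>L 'a" and T P Qp Qm +
  fixes f :: "real \<Rightarrow> 'a \<Rightarrow> 'a" and L \<Lambda> \<Lambda>' \<kappa> \<kappa>' :: "real \<Rightarrow> real"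
    and \<alpha> \<beta>p \<beta>m \<nu>p \<nu>p' \<nu>m \<nu>m' :: "real \<Rightarrow> real \<Rightarrow> real"
  assumes f_cont: "continuous_on UNIV (\<lambda>(t, x). f t x)" and f_zero [simp]: "f t 0 = 0"
    and f_lip: "norm (f t x - f t y) \<le> L t * norm (x - y)" and L_nonneg: "L t \<ge> 0"
    and \<Lambda>_deriv: "(\<Lambda> has_real_derivative \<Lambda>' t) (at t)" and L_le: "L t \<le> \<Lambda>' t"
    and \<alpha>_pos: "\<alpha> t s > 0" and \<alpha>_cont: "continuous_on UNIV (\<lambda>t. \<alpha> t s)"
    and \<alpha>_bound: "norm (T t s (P s x)) \<le> \<alpha> t s * norm x"
    and \<beta>p_bound: "s \<le> t \<Longrightarrow> norm (T t s (Qp s x)) \<le> \<beta>p t s * norm x"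
    and \<beta>m_bound: "t \<le> s \<Longrightarrow> norm (T t s (Qm s x)) \<le> \<beta>m t s * norm x"
    and \<beta>p_nonneg: "s \<le> t \<Longrightarrow> \<beta>p t s \<ge> 0" and \<beta>m_nonneg: "t \<le> s \<Longrightarrow> \<beta>m t s \<ge> 0"
    and \<kappa>_deriv: "(\<kappa> has_real_derivative \<kappa>' t) (at t)" and \<kappa>_var: "\<bar>\<kappa> t - \<kappa> s\<bar> \<le> 1 / 3"
    and \<kappa>_bound: "r \<in> closed_segment s t \<Longrightarrow> \<alpha> t r * L r * \<alpha> r s \<le> \<alpha> t s * \<kappa>' r"
    and \<nu>p_deriv: "r \<le> s \<Longrightarrow> (\<nu>p s has_real_derivative \<nu>p' s r) (at r)"
    and \<nu>p_var: "r \<le> s \<Longrightarrow> \<nu>p s s - \<nu>p s r \<le> 1 / 16"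
    and \<nu>p_bound: "r \<le> s \<Longrightarrow> \<beta>p s r * L r * \<alpha> r s \<le> \<nu>p' s r"
    and \<nu>m_deriv: "r \<ge> s \<Longrightarrow> (\<nu>m s has_real_derivative \<nu>m' s r) (at r)"
    and \<nu>m_var: "r \<ge> s \<Longrightarrow> \<nu>m s r - \<nu>m s s \<le> 1 / 16"
    and \<nu>m_bound: "r \<ge> s \<Longrightarrow> \<beta>m s r * L r * \<alpha> r s \<le> \<nu>m' s r"
    and \<beta>p_lim: "((\<lambda>r. \<beta>p s r * \<alpha> r s) \<longlongrightarrow> 0) at_bot"
    and \<beta>m_lim: "((\<lambda>r. \<beta>m s r * \<alpha> r s) \<longlongrightarrow> 0) at_top"
begin

abbreviation "sections \<equiv> lipschitz_sections P Qp Qm (1 / 2)"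

lemma \<Lambda>'_nonneg: "\<Lambda>' t \<ge> 0"
  using L_nonneg[of t] L_le[of t] by linarith

lemma continuous_on_f:
  assumes "continuous_on S a" "continuous_on S c"
  shows "continuous_on S (\<lambda>p. f (a p) (c p))"
  using continuous_on_compose2[OF f_cont continuous_on_Pair[OF assms]] by simp

lemma solution_exists: "\<exists>v. global_solution (\<lambda>t x. A t x + f t x) v \<and> v s = v0"
  and solution_unique: "global_solution (\<lambda>t x. A t x + f t x) v \<Longrightarrow>
    global_solution (\<lambda>t x. A t x + f t x) v' \<Longrightarrow> v s = v' s \<Longrightarrow> v = v'"
proof -
  define g where "g t z = T 0 t (f t (T t 0 z))" for t z
  have cont: "continuous_on UNIV (\<lambda>(t, z). g t z)"
    unfolding g_def case_prod_unfold by (intro continuous_intros continuous_on_f)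
  have lip: "\<exists>C>0. \<forall>t\<in>{-R..R}. \<forall>x y. norm (g t x - g t y) \<le> C * \<Lambda>' t * norm (x - y)" for R
  proof (cases "R \<ge> 0")
    case True
    obtain B where B: "B > 0"
      "\<And>t s x. t \<in> {-R..R} \<Longrightarrow> s \<in> {-R..R} \<Longrightarrow> norm (T t s x) \<le> B * norm x"
      using T_bounded[of R] by blast
    have "norm (g t x - g t y) \<le> B * B * \<Lambda>' t * norm (x - y)" if t: "t \<in> {-R..R}" for t x y
    proof -
      have z: "0 \<in> {-R..R}" using True by simp
      have "norm (g t x - g t y) = norm (T 0 t (f t (T t 0 x) - f t (T t 0 y)))"
        by (simp add: g_def blinfun.diff_right)
      also have "\<dots> \<le> B * norm (f t (T t 0 x) - f t (T t 0 y))" by (rule B(2)[OF z t])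
      also have "\<dots> \<le> B * (\<Lambda>' t * norm (T t 0 x - T t 0 y))"
        using B(1) by (intro mult_left_mono order_trans[OF f_lip] mult_right_mono L_le) auto
      also have "\<dots> \<le> B * (\<Lambda>' t * (B * norm (x - y)))"
        using B \<Lambda>'_nonneg[of t] B(2)[OF t z, of "x - y"] by (intro mult_left_mono) (auto simp: blinfun.diff_right)
      finally show ?thesis by (simp add: mult_ac)
    qed
    then show ?thesis using B(1) by (intro exI[of _ "B * B"]) auto
  qed (auto intro: exI[of _ 1])
  have to_g: "global_solution g (\<lambda>t. T 0 t (v t))" if "global_solution (\<lambda>t x. A t x + f t x) v" for v
    using that by (simp add: solution_pull_back_iff global_solution_def[of g] g_def)
  show "\<exists>v. global_solution (\<lambda>t x. A t x + f t x) v \<and> v s = v0"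
  proof -
    obtain z where z: "global_solution g z" "z s = T 0 s v0"
      using picard_global_solution[OF cont \<Lambda>_deriv \<Lambda>'_nonneg lip] by blast
    then show ?thesis
      by (intro exI[of _ "\<lambda>t. T t 0 (z t)"])
        (simp add: solution_pull_back_iff global_solution_def[of g] g_def)
  qed
  show "v = v'" if v: "global_solution (\<lambda>t x. A t x + f t x) v" "global_solution (\<lambda>t x. A t x + f t x) v'"
    "v s = v' s"
  proof
    fix t
    have "(\<lambda>t. T 0 t (v t)) = (\<lambda>t. T 0 t (v' t))"
      by (rule picard_solution_unique[OF \<Lambda>_deriv \<Lambda>'_nonneg lip to_g to_g, where s = s]) (use v in auto)
    from arg_cong[OF fun_cong[OF this, of t], of "T t 0"] show "v t = v' t" by simp
  qed
qed

lemma solution_through_eq: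
  assumes "global_solution (\<lambda>t x. A t x + f t x) v" "v s = v0"
  shows "solution_through A f s v0 = v"
  unfolding solution_through_def
  by (rule the_equality) (use assms solution_unique in auto)

text \<open>Sections are only continuous on the bundle, hence the side condition that the curve stays in it.\<close>

lemma sections_cont:
  assumes \<phi>: "\<phi> \<in> sections" and "continuous_on S a" "continuous_on S c" "\<And>p. p \<in> S \<Longrightarrow> P (a p) (c p) = c p"
  shows "continuous_on S (\<lambda>p. \<phi> (a p, c p))"
proof -
  have "continuous_on (center_bundle P) \<phi>" using \<phi> by (simp add: lipschitz_sections_iff)
  then show ?thesis by (rule continuous_on_compose2[OF _ continuous_on_Pair[OF assms(2,3)]]) (use assms in auto)
qed

lemma sections_lip:
  "\<phi> \<in> sections \<Longrightarrow> P t x = x \<Longrightarrow> P t y = y \<Longrightarrow> norm (\<phi> (t, x) - \<phi> (t, y)) \<le> 1 / 2 * norm (x - y)"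
  unfolding lipschitz_sections_iff by blast

lemma sections_zero: "\<phi> \<in> sections \<Longrightarrow> \<phi> (t, 0) = 0"
  unfolding lipschitz_sections_iff by blast

lemma sections_bound: "\<phi> \<in> sections \<Longrightarrow> P t x = x \<Longrightarrow> norm (\<phi> (t, x)) \<le> 1 / 2 * norm x"
  using sections_lip[of \<phi> t x 0] by (simp add: sections_zero)

lemma sections_P: "\<phi> \<in> sections \<Longrightarrow> P t x = x \<Longrightarrow> P t (\<phi> (t, x)) = 0"
  unfolding lipschitz_sections_iff by blast

lemma sections_undefined: "\<phi> \<in> sections \<Longrightarrow> p \<notin> center_bundle P \<Longrightarrow> \<phi> p = undefined"
  unfolding lipschitz_sections_iff by (blast intro: extensional_arb)

text \<open>The factor \<open>3/2 = 1 + N\<close> is the Lipschitz constant of \<open>x \<mapsto> x + \<phi>(t, x)\<close>.\<close>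

lemma forcing_lip:
  assumes \<phi>: "\<phi> \<in> sections" and x: "P t x = x" and y: "P t y = y"
  shows "norm (f t (x + \<phi> (t, x)) - f t (y + \<psi>y)) \<le> L t * (3 / 2 * norm (x - y) + norm (\<phi> (t, y) - \<psi>y))"
proof -
  have "norm (f t (x + \<phi> (t, x)) - f t (y + \<psi>y)) \<le> L t * norm ((x + \<phi> (t, x)) - (y + \<psi>y))" by (rule f_lip)
  also have "(x + \<phi> (t, x)) - (y + \<psi>y) = (x - y) + (\<phi> (t, x) - \<phi> (t, y)) + (\<phi> (t, y) - \<psi>y)" by simp
  also have "norm \<dots> \<le> norm (x - y) + norm (\<phi> (t, x) - \<phi> (t, y)) + norm (\<phi> (t, y) - \<psi>y)"
    by (meson add_right_mono norm_triangle_ineq order_trans)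
  also have "\<dots> \<le> 3 / 2 * norm (x - y) + norm (\<phi> (t, y) - \<psi>y)" using sections_lip[OF \<phi> x y] by simp
  finally show ?thesis using L_nonneg[of t] by (simp add: mult_left_mono)
qed

section \<open>The center equation\<close>

text \<open>The equation \<open>x' = A x + P f(t, x + \<phi>(t, x))\<close> in the moving frame.\<close>

definition center_curve :: "(real \<times> 'a \<Rightarrow> 'a) \<Rightarrow> (real \<Rightarrow> 'a) \<Rightarrow> bool" where
  "center_curve \<phi> x \<longleftrightarrow> (\<forall>t. P t (x t) = x t) \<and>
     (\<forall>t. ((\<lambda>t. T 0 t (x t)) has_vector_derivative P 0 (T 0 t (f t (x t + \<phi> (t, x t))))) (at t))"

lemma center_curve_in: "center_curve \<phi> x \<Longrightarrow> P t (x t) = x t"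
  by (simp add: center_curve_def)

lemma center_curve_deriv:
  "center_curve \<phi> x \<Longrightarrow>
   ((\<lambda>t. T 0 t (x t)) has_vector_derivative P 0 (T 0 t (f t (x t + \<phi> (t, x t))))) (at t)"
  by (simp add: center_curve_def)

lemma pull_back_continuous:
  assumes "\<And>t. ((\<lambda>t. T 0 t (x t)) has_vector_derivative D t) (at t)"
  shows "continuous_on S x"
proof -
  have "continuous_on S (\<lambda>t. T 0 t (x t))"
    using assms by (auto intro!: continuous_at_imp_continuous_on dest: has_vector_derivative_continuous)
  then have "continuous_on S (\<lambda>t. T t 0 (T 0 t (x t)))"
    by (rule continuous_on_T[OF continuous_on_id continuous_on_const])
  then show ?thesis by simp
qed

lemma center_curve_cont: "center_curve \<phi> x \<Longrightarrow> continuous_on S x"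
  by (rule pull_back_continuous) (rule center_curve_deriv)

lemma forcing_cont:
  "\<phi> \<in> sections \<Longrightarrow> center_curve \<phi> x \<Longrightarrow> continuous_on S (\<lambda>r. f r (x r + \<phi> (r, x r)))"
  by (intro continuous_on_f continuous_intros sections_cont center_curve_cont) (auto simp: center_curve_in)

text \<open>The center equation is first solved on all of \<open>X\<close>, with the projection inserted into the argument of
\<open>\<phi>\<close>. Since the right-hand side lies in the range of \<open>P 0\<close>, the solution never leaves it.\<close>

lemma center_curve_exists:
  assumes \<phi>: "\<phi> \<in> sections" and \<xi>: "P s \<xi> = \<xi>"
  shows "\<exists>x. center_curve \<phi> x \<and> x s = \<xi>"
proof -
  define p where "p t z = T t 0 (P 0 z)" for t z
  have p: "P t (p t z) = p t z" for t z by (simp add: p_def P_T)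
  define g where "g t z = P 0 (T 0 t (f t (p t z + \<phi> (t, p t z))))" for t z
  have cont: "continuous_on UNIV (\<lambda>(t, z). g t z)"
  proof -
    have "continuous_on UNIV (\<lambda>q. p (fst q) (snd q))" unfolding p_def by (intro continuous_intros)
    then show ?thesis unfolding g_def case_prod_unfold
      by (intro continuous_intros continuous_on_f sections_cont[OF \<phi>] p)
  qed
  have lip: "\<exists>C>0. \<forall>t\<in>{-R..R}. \<forall>x y. norm (g t x - g t y) \<le> C * \<Lambda>' t * norm (x - y)" for R
  proof (cases "R \<ge> 0")
    case True
    obtain B where B: "B > 0"
      "\<And>t s x. t \<in> {-R..R} \<Longrightarrow> s \<in> {-R..R} \<Longrightarrow> norm (T t s x) \<le> B * norm x"
      using T_bounded[of R] by blast
    define K where "K = norm (P 0) + 1"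
    have K: "K > 0" "norm (P 0 x) \<le> K * norm x" for x
      using norm_blinfun[of "P 0" x] norm_ge_zero[of "P 0"] norm_ge_zero[of x]
      unfolding K_def ring_distribs by linarith+
    have "norm (g t x - g t y) \<le> K * B * (3 / 2) * B * K * \<Lambda>' t * norm (x - y)" if t: "t \<in> {-R..R}" for t x y
    proof -
      have z: "0 \<in> {-R..R}" using True by simp
      let ?d = "f t (p t x + \<phi> (t, p t x)) - f t (p t y + \<phi> (t, p t y))"
      have "norm ?d \<le> L t * (3 / 2 * norm (p t x - p t y))"
        using forcing_lip[OF \<phi> p p, of t x y "\<phi> (t, p t y)"] by simp
      also have "\<dots> \<le> \<Lambda>' t * (3 / 2 * norm (p t x - p t y))" by (intro mult_right_mono L_le) auto
      also have "\<dots> \<le> \<Lambda>' t * (3 / 2 * (B * (K * norm (x - y))))"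
      proof -
        have "norm (p t x - p t y) \<le> B * norm (P 0 (x - y))"
          using B(2)[OF t z, of "P 0 (x - y)"] by (simp add: p_def blinfun.diff_right)
        also have "\<dots> \<le> B * (K * norm (x - y))" using B(1) K by (intro mult_left_mono) auto
        finally show ?thesis using \<Lambda>'_nonneg[of t] by (intro mult_left_mono) auto
      qed
      finally have d: "norm ?d \<le> \<Lambda>' t * (3 / 2 * (B * (K * norm (x - y))))" .
      have "norm (g t x - g t y) = norm (P 0 (T 0 t ?d))" by (simp add: g_def blinfun.diff_right)
      also have "\<dots> \<le> K * (B * norm ?d)"
        using K(2)[of "T 0 t ?d"] B(2)[OF z t, of ?d] K(1) by (meson mult_left_mono less_imp_le order_trans)
      also have "\<dots> \<le> K * (B * (\<Lambda>' t * (3 / 2 * (B * (K * norm (x - y))))))"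
        using d K(1) B(1) by (intro mult_left_mono) auto
      finally show ?thesis by (simp add: mult_ac)
    qed
    then show ?thesis using B(1) K(1) by (intro exI[of _ "K * B * (3 / 2) * B * K"]) auto
  qed (auto intro: exI[of _ 1])
  obtain z where z: "global_solution g z" and z_s: "z s = T 0 s \<xi>"
    using picard_global_solution[OF cont \<Lambda>_deriv \<Lambda>'_nonneg lip] by blast
  have zd: "(z has_vector_derivative g t (z t)) (at t)" for t using z by (simp add: global_solution_def)
  have "((\<lambda>t. P 0 (z t) - z t) has_vector_derivative P 0 (g t (z t)) - g t (z t)) (at t)" for t
    by (intro has_vector_derivative_diff zd bounded_linear.has_vector_derivative[OF blinfun.bounded_linear_right])
  then have "((\<lambda>t. P 0 (z t) - z t) has_vector_derivative 0) (at t)" for t by (simp add: g_def)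
  then obtain c where c: "\<And>t. P 0 (z t) - z t = c"
    using has_vector_derivative_zero_constant[of UNIV "\<lambda>t. P 0 (z t) - z t"] by auto
  have "c = 0" using c[of s] z_s \<xi> by (simp add: P_T)
  then have Pz: "P 0 (z t) = z t" for t using c[of t] by simp
  then have pz: "p t (z t) = T t 0 (z t)" for t by (simp add: p_def)
  show ?thesis
  proof (intro exI[of _ "\<lambda>t. T t 0 (z t)"] conjI)
    show "center_curve \<phi> (\<lambda>t. T t 0 (z t))"
      unfolding center_curve_def using zd Pz by (simp add: P_T g_def pz)
    show "T s 0 (z s) = \<xi>" by (simp add: z_s)
  qed
qed

text \<open>Growth of solutions of the center equation, linear in the forcing bound. At the point where
\<open>\<parallel>u\<parallel> / \<alpha>\<close> is maximal, with maximum \<open>m\<close>, the integral contributes at most \<open>(3/2 m + q) / 3 = m/2 + q/3\<close>, so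
\<open>m \<le> \<parallel>u(s)\<parallel> + m/2 + q/3\<close>. The term with \<open>q\<close> allows to compare the center equations of two different sections.\<close>

lemma center_estimate:
  assumes u_P: "\<And>r. P r (u r) = u r"
    and u_deriv: "\<And>r. ((\<lambda>t. T 0 t (u t)) has_vector_derivative P 0 (T 0 r (k r))) (at r)"
    and k: "\<And>r. norm (k r) \<le> L r * (3 / 2 * norm (u r) + q * \<alpha> r s)" and q: "q \<ge> 0"
  shows "norm (u t) \<le> \<alpha> t s * (2 * norm (u s) + 2 / 3 * q)"
proof -
  have "continuous_on (closed_segment s t) (\<lambda>r. norm (u r) / \<alpha> r s)"
    using \<alpha>_pos by (intro continuous_intros pull_back_continuous[OF u_deriv] continuous_on_subset[OF \<alpha>_cont])
      (auto simp: less_le)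
  then obtain x where x: "x \<in> closed_segment s t"
    and max: "\<And>r. r \<in> closed_segment s t \<Longrightarrow> norm (u r) / \<alpha> r s \<le> norm (u x) / \<alpha> x s"
    using continuous_attains_sup[of "closed_segment s t"] by force
  define m where "m = norm (u x) / \<alpha> x s"
  have m0: "m \<ge> 0" using \<alpha>_pos[of x s] by (simp add: m_def)
  have um: "norm (u r) \<le> m * \<alpha> r s" if "r \<in> closed_segment s t" for r
    using max[OF that] \<alpha>_pos[of r s] by (simp add: m_def[symmetric] field_simps)
  have sub: "closed_segment s x \<subseteq> closed_segment s t"
    using x by (simp add: subset_closed_segment)
  let ?C = "3 / 2 * m + q"
  have "norm (T x 0 (T 0 x (u x)) - T x 0 (T 0 s (u s)))
      \<le> \<bar>\<alpha> x s * ?C * \<kappa> x - \<alpha> x s * ?C * \<kappa> s\<bar>"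
  proof (rule norm_diff_le_majorant)
    \<comment> \<open>Apply the fixed operator \<open>T x 0\<close>, so that all norms are taken at the time \<open>x\<close> of the maximum.\<close>
    fix r assume r: "r \<in> closed_segment s x"
    show "((\<lambda>r. T x 0 (T 0 r (u r))) has_vector_derivative T x 0 (P 0 (T 0 r (k r)))) (at r)"
      by (intro u_deriv bounded_linear.has_vector_derivative[OF blinfun.bounded_linear_right])
    show "((\<lambda>r. \<alpha> x s * ?C * \<kappa> r) has_real_derivative \<alpha> x s * ?C * \<kappa>' r) (at r)"
      by (intro DERIV_cmult \<kappa>_deriv)
    have "norm (k r) \<le> L r * (3 / 2 * (m * \<alpha> r s) + q * \<alpha> r s)"
      using k[of r] um[of r] r sub L_nonneg[of r]
      by (elim order_trans) (auto intro!: mult_left_mono)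
    then have kr: "norm (k r) \<le> L r * \<alpha> r s * ?C" by (simp add: algebra_simps)
    have "norm (T x 0 (P 0 (T 0 r (k r)))) = norm (T x r (P r (k r)))" by (simp add: P_T)
    also have "\<dots> \<le> \<alpha> x r * norm (k r)" by (rule \<alpha>_bound)
    also have "\<dots> \<le> \<alpha> x r * (L r * \<alpha> r s * ?C)" using kr \<alpha>_pos[of x r] by (intro mult_left_mono) auto
    also have "\<dots> = (\<alpha> x r * L r * \<alpha> r s) * ?C" by simp
    also have "\<dots> \<le> (\<alpha> x s * \<kappa>' r) * ?C" using m0 q by (intro mult_right_mono \<kappa>_bound r) auto
    finally show "norm (T x 0 (P 0 (T 0 r (k r)))) \<le> \<alpha> x s * ?C * \<kappa>' r" by (simp add: mult_ac)
  qed
  also have "\<bar>\<alpha> x s * ?C * \<kappa> x - \<alpha> x s * ?C * \<kappa> s\<bar> = \<alpha> x s * ?C * \<bar>\<kappa> x - \<kappa> s\<bar>"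
    using m0 q \<alpha>_pos[of x s] by (simp add: right_diff_distrib[symmetric] abs_mult)
  also have "\<dots> \<le> \<alpha> x s * ?C * (1 / 3)"
    using m0 q \<alpha>_pos[of x s] by (intro mult_left_mono \<kappa>_var) auto
  finally have "norm (u x - T x s (u s)) \<le> \<alpha> x s * ?C * (1 / 3)" by simp
  moreover have "norm (T x s (u s)) \<le> \<alpha> x s * norm (u s)" using \<alpha>_bound[of x s "u s"] u_P by simp
  moreover have "norm (u x) \<le> norm (T x s (u s)) + norm (u x - T x s (u s))"
    using norm_triangle_sub[of "u x" "T x s (u s)"] by simp
  moreover have "norm (u x) = \<alpha> x s * m" using \<alpha>_pos[of x s] by (simp add: m_def)
  ultimately have "\<alpha> x s * m \<le> \<alpha> x s * (norm (u s) + ?C * (1 / 3))" by (simp add: algebra_simps)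
  then have "m \<le> norm (u s) + ?C * (1 / 3)" using \<alpha>_pos[of x s] mult_le_cancel_left_pos by blast
  also have "?C * (1 / 3) = m / 2 + q / 3" by (simp add: field_simps)
  finally have "m \<le> 2 * norm (u s) + 2 / 3 * q" by linarith
  then have "m * \<alpha> t s \<le> (2 * norm (u s) + 2 / 3 * q) * \<alpha> t s"
    using \<alpha>_pos[of t s] by (intro mult_right_mono) auto
  then show ?thesis using um[OF ends_in_segment(2)] by (simp add: mult.commute)
qed

lemma center_curves_diff:
  assumes \<phi>: "\<phi> \<in> sections" and x: "center_curve \<phi> x" and y: "center_curve \<psi> y"
    and q: "q \<ge> 0" and close: "\<And>r. norm (\<phi> (r, y r) - \<psi> (r, y r)) \<le> q * \<alpha> r s"
  shows "norm (x t - y t) \<le> \<alpha> t s * (2 * norm (x s - y s) + 2 / 3 * q)"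
proof (rule center_estimate[where k = "\<lambda>r. f r (x r + \<phi> (r, x r)) - f r (y r + \<psi> (r, y r))" and s = s, OF _ _ _ q])
  fix r
  show "P r (x r - y r) = x r - y r" by (simp add: blinfun.diff_right center_curve_in[OF x] center_curve_in[OF y])
  show "((\<lambda>t. T 0 t (x t - y t)) has_vector_derivative
      P 0 (T 0 r (f r (x r + \<phi> (r, x r)) - f r (y r + \<psi> (r, y r))))) (at r)"
    unfolding blinfun.diff_right
    by (intro has_vector_derivative_diff center_curve_deriv x y)
  have "norm (f r (x r + \<phi> (r, x r)) - f r (y r + \<psi> (r, y r)))
      \<le> L r * (3 / 2 * norm (x r - y r) + norm (\<phi> (r, y r) - \<psi> (r, y r)))"
    by (rule forcing_lip[OF \<phi> center_curve_in[OF x] center_curve_in[OF y]])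
  also have "\<dots> \<le> L r * (3 / 2 * norm (x r - y r) + q * \<alpha> r s)"
    using close[of r] L_nonneg[of r] by (intro mult_left_mono) auto
  finally show "norm (f r (x r + \<phi> (r, x r)) - f r (y r + \<psi> (r, y r)))
      \<le> L r * (3 / 2 * norm (x r - y r) + q * \<alpha> r s)" .
qed

lemma center_curve_zero: "\<phi> \<in> sections \<Longrightarrow> center_curve \<phi> (\<lambda>_. 0)"
  by (auto simp: center_curve_def sections_zero blinfun.zero_right)

lemma center_curve_growth:
  assumes "\<phi> \<in> sections" "center_curve \<phi> x"
  shows "norm (x t) \<le> \<alpha> t s * (2 * norm (x s))"
  using center_curves_diff[OF assms center_curve_zero[OF assms(1)], of 0 s t] by simp

section \<open>The graph transform\<close>

text \<open>In the moving frame, \<open>Yp\<close> is the integral of \<open>T Q\<^sup>+ k\<close> from \<open>-\<infinity>\<close> and \<open>Ym\<close> is minus the integral of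
\<open>T Q\<^sup>- k\<close> to \<open>+\<infinity>\<close>. The description by limits does not refer to a base time, and this makes the
graph transform of a section compatible with its center curves.\<close>

definition hyperbolic_part :: "(real \<Rightarrow> 'a) \<Rightarrow> (real \<Rightarrow> 'a) \<Rightarrow> bool" where
  "hyperbolic_part k Y \<longleftrightarrow> (\<exists>Yp Ym. Y = (\<lambda>t. Yp t + Ym t) \<and>
     (\<forall>t. (Yp has_vector_derivative Qp 0 (T 0 t (k t))) (at t)) \<and> (Yp \<longlongrightarrow> 0) at_bot \<and>
     (\<forall>t. (Ym has_vector_derivative Qm 0 (T 0 t (k t))) (at t)) \<and> (Ym \<longlongrightarrow> 0) at_top)"

lemma hyperbolic_part_unique:
  assumes "hyperbolic_part k Y" "hyperbolic_part k Y'"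
  shows "Y = Y'"
proof -
  obtain Yp Ym where Y: "Y = (\<lambda>t. Yp t + Ym t)"
    "\<And>t. (Yp has_vector_derivative Qp 0 (T 0 t (k t))) (at t)" "(Yp \<longlongrightarrow> 0) at_bot"
    "\<And>t. (Ym has_vector_derivative Qm 0 (T 0 t (k t))) (at t)" "(Ym \<longlongrightarrow> 0) at_top"
    using assms(1) unfolding hyperbolic_part_def by blast
  obtain Yp' Ym' where Y': "Y' = (\<lambda>t. Yp' t + Ym' t)"
    "\<And>t. (Yp' has_vector_derivative Qp 0 (T 0 t (k t))) (at t)" "(Yp' \<longlongrightarrow> 0) at_bot"
    "\<And>t. (Ym' has_vector_derivative Qm 0 (T 0 t (k t))) (at t)" "(Ym' \<longlongrightarrow> 0) at_top"
    using assms(2) unfolding hyperbolic_part_def by blast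
  have "Yp = Yp'" by (rule same_derivative_same_limit[OF Y(2) Y'(2) Y(3) Y'(3)]) simp
  moreover have "Ym = Ym'" by (rule same_derivative_same_limit[OF Y(4) Y'(4) Y(5) Y'(5)]) simp
  ultimately show ?thesis by (simp add: Y(1) Y'(1))
qed

lemma hyperbolic_part_diff:
  assumes "hyperbolic_part k Y" "hyperbolic_part k' Y'"
  shows "hyperbolic_part (\<lambda>t. k t - k' t) (\<lambda>t. Y t - Y' t)"
proof -
  obtain Yp Ym where Y: "Y = (\<lambda>t. Yp t + Ym t)"
    "\<And>t. (Yp has_vector_derivative Qp 0 (T 0 t (k t))) (at t)" "(Yp \<longlongrightarrow> 0) at_bot"
    "\<And>t. (Ym has_vector_derivative Qm 0 (T 0 t (k t))) (at t)" "(Ym \<longlongrightarrow> 0) at_top"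
    using assms(1) unfolding hyperbolic_part_def by blast
  obtain Yp' Ym' where Y': "Y' = (\<lambda>t. Yp' t + Ym' t)"
    "\<And>t. (Yp' has_vector_derivative Qp 0 (T 0 t (k' t))) (at t)" "(Yp' \<longlongrightarrow> 0) at_bot"
    "\<And>t. (Ym' has_vector_derivative Qm 0 (T 0 t (k' t))) (at t)" "(Ym' \<longlongrightarrow> 0) at_top"
    using assms(2) unfolding hyperbolic_part_def by blast
  show ?thesis
    unfolding hyperbolic_part_def
  proof (rule exI[of _ "\<lambda>t. Yp t - Yp' t"], rule exI[of _ "\<lambda>t. Ym t - Ym' t"], intro conjI allI)
    show "((\<lambda>t. Yp t - Yp' t) has_vector_derivative Qp 0 (T 0 t (k t - k' t))) (at t)" for t
      unfolding blinfun.diff_right by (intro has_vector_derivative_diff Y Y')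
    show "((\<lambda>t. Ym t - Ym' t) has_vector_derivative Qm 0 (T 0 t (k t - k' t))) (at t)" for t
      unfolding blinfun.diff_right by (intro has_vector_derivative_diff Y Y')
    show "((\<lambda>t. Yp t - Yp' t) \<longlongrightarrow> 0) at_bot" using tendsto_diff[OF Y(3) Y'(3)] by simp
    show "((\<lambda>t. Ym t - Ym' t) \<longlongrightarrow> 0) at_top" using tendsto_diff[OF Y(5) Y'(5)] by simp
  qed (simp add: Y(1) Y'(1) algebra_simps)
qed

text \<open>The integrals converge at every time as soon as the forcing is dominated by \<open>L \<alpha>(\<cdot>, s)\<close> for one base time \<open>s\<close>,
and at that time their sum is at most \<open>q (1/16 + 1/16)\<close>.\<close>

lemma hyperbolic_part_exists_bounded:
  assumes k: "continuous_on UNIV k" and le: "\<And>r. norm (k r) \<le> q * (L r * \<alpha> r s)" and q: "q \<ge> 0"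
  shows "\<exists>Y. hyperbolic_part k Y \<and> norm (T s 0 (Y s)) \<le> q / 8"
proof -
  have "\<exists>Y. (\<forall>t. (Y has_vector_derivative T s 0 (Qp 0 (T 0 t (k t)))) (at t)) \<and> (Y \<longlongrightarrow> 0) at_bot \<and>
      norm (Y s) \<le> q / 16"
  proof (rule antiderivative_vanishing_at_bot)
    show "continuous_on UNIV (\<lambda>t. T s 0 (Qp 0 (T 0 t (k t))))"
      by (intro bounded_linear.continuous_on[OF blinfun.bounded_linear_right]
          continuous_on_T[OF continuous_on_const continuous_on_id k])
    fix r assume r: "r \<le> s"
    show "((\<lambda>r. q * \<nu>p s r) has_real_derivative q * \<nu>p' s r) (at r)" by (intro DERIV_cmult \<nu>p_deriv r)
    have "norm (T s 0 (Qp 0 (T 0 r (k r)))) = norm (T s r (Qp r (k r)))" by (simp add: Qp_T)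
    also have "\<dots> \<le> \<beta>p s r * norm (k r)" by (rule \<beta>p_bound[OF r])
    also have "\<dots> \<le> \<beta>p s r * (q * (L r * \<alpha> r s))"
      using le[of r] \<beta>p_nonneg[OF r] by (intro mult_left_mono)
    also have "\<dots> = q * (\<beta>p s r * L r * \<alpha> r s)" by simp
    also have "\<dots> \<le> q * \<nu>p' s r" by (intro mult_left_mono \<nu>p_bound r q)
    finally show "norm (T s 0 (Qp 0 (T 0 r (k r)))) \<le> q * \<nu>p' s r" .
    show "q * \<nu>p s s - q * \<nu>p s r \<le> q / 16"
      using mult_left_mono[OF \<nu>p_var[OF r] q] by (simp add: algebra_simps)
  qed
  then obtain Yp where Yp: "\<And>t. (Yp has_vector_derivative T s 0 (Qp 0 (T 0 t (k t)))) (at t)"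
    "(Yp \<longlongrightarrow> 0) at_bot" "norm (Yp s) \<le> q / 16" by blast
  have "\<exists>Y. (\<forall>t. (Y has_vector_derivative T s 0 (Qm 0 (T 0 t (k t)))) (at t)) \<and> (Y \<longlongrightarrow> 0) at_top \<and>
      norm (Y s) \<le> q / 16"
  proof (rule antiderivative_vanishing_at_top)
    show "continuous_on UNIV (\<lambda>t. T s 0 (Qm 0 (T 0 t (k t))))"
      by (intro bounded_linear.continuous_on[OF blinfun.bounded_linear_right]
          continuous_on_T[OF continuous_on_const continuous_on_id k])
    fix r assume r: "r \<ge> s"
    show "((\<lambda>r. q * \<nu>m s r) has_real_derivative q * \<nu>m' s r) (at r)" by (intro DERIV_cmult \<nu>m_deriv r)
    have "norm (T s 0 (Qm 0 (T 0 r (k r)))) = norm (T s r (Qm r (k r)))" by (simp add: Qm_T)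
    also have "\<dots> \<le> \<beta>m s r * norm (k r)" by (rule \<beta>m_bound[OF r])
    also have "\<dots> \<le> \<beta>m s r * (q * (L r * \<alpha> r s))"
      using le[of r] \<beta>m_nonneg[OF r] by (intro mult_left_mono)
    also have "\<dots> = q * (\<beta>m s r * L r * \<alpha> r s)" by simp
    also have "\<dots> \<le> q * \<nu>m' s r" by (intro mult_left_mono \<nu>m_bound r q)
    finally show "norm (T s 0 (Qm 0 (T 0 r (k r)))) \<le> q * \<nu>m' s r" .
    show "q * \<nu>m s r - q * \<nu>m s s \<le> q / 16"
      using mult_left_mono[OF \<nu>m_var[OF r] q] by (simp add: algebra_simps)
  qed
  then obtain Ym where Ym: "\<And>t. (Ym has_vector_derivative T s 0 (Qm 0 (T 0 t (k t)))) (at t)"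
    "(Ym \<longlongrightarrow> 0) at_top" "norm (Ym s) \<le> q / 16" by blast
  have pull: "((\<lambda>t. T 0 s (Z t)) has_vector_derivative z) (at t)"
    if "(Z has_vector_derivative T s 0 z) (at t)" for Z z t
    using bounded_linear.has_vector_derivative[OF blinfun.bounded_linear_right[of "T 0 s"] that] by simp
  have lim: "((\<lambda>t. T 0 s (Z t)) \<longlongrightarrow> 0) F" if "(Z \<longlongrightarrow> 0) F" for Z F
    using tendsto_T[OF tendsto_const tendsto_const that, of 0 s] by (simp add: blinfun.zero_right)
  have "hyperbolic_part k (\<lambda>t. T 0 s (Yp t) + T 0 s (Ym t))"
    unfolding hyperbolic_part_def
    by (rule exI[of _ "\<lambda>t. T 0 s (Yp t)"], rule exI[of _ "\<lambda>t. T 0 s (Ym t)"])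
      (intro conjI allI refl pull lim Yp Ym)
  moreover have "norm (T s 0 (T 0 s (Yp s) + T 0 s (Ym s))) \<le> q / 8"
    using Yp(3) Ym(3) norm_triangle_ineq[of "Yp s" "Ym s"] by (simp add: blinfun.add_right)
  ultimately show ?thesis by blast
qed

lemma hyperbolic_part_bound:
  assumes "hyperbolic_part k Y" "continuous_on UNIV k" "\<And>r. norm (k r) \<le> q * (L r * \<alpha> r s)" "q \<ge> 0"
  shows "norm (T s 0 (Y s)) \<le> q / 8"
  using hyperbolic_part_exists_bounded[OF assms(2-4)] hyperbolic_part_unique[OF assms(1)] by blast

lemma hyperbolic_part_deriv:
  assumes "hyperbolic_part k Y"
  shows "(Y has_vector_derivative T 0 t (k t) - P 0 (T 0 t (k t))) (at t)"
proof -
  obtain Yp Ym where Y: "Y = (\<lambda>t. Yp t + Ym t)"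
    "\<And>t. (Yp has_vector_derivative Qp 0 (T 0 t (k t))) (at t)"
    "\<And>t. (Ym has_vector_derivative Qm 0 (T 0 t (k t))) (at t)"
    using assms unfolding hyperbolic_part_def by blast
  from has_vector_derivative_add[OF Y(2) Y(3)] show ?thesis by (simp add: Y(1) Qm_eq)
qed

lemma hyperbolic_part_P:
  assumes "hyperbolic_part k Y"
  shows "P 0 (Y t) = 0"
proof -
  obtain Yp Ym where Y: "Y = (\<lambda>t. Yp t + Ym t)"
    "\<And>t. (Yp has_vector_derivative Qp 0 (T 0 t (k t))) (at t)" "(Yp \<longlongrightarrow> 0) at_bot"
    "\<And>t. (Ym has_vector_derivative Qm 0 (T 0 t (k t))) (at t)" "(Ym \<longlongrightarrow> 0) at_top"
    using assms(1) unfolding hyperbolic_part_def by blast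
  have deriv: "((\<lambda>t. P 0 (Z t)) has_vector_derivative P 0 z) (at t)" if "(Z has_vector_derivative z) (at t)" for Z z t
    by (intro bounded_linear.has_vector_derivative[OF blinfun.bounded_linear_right] that)
  have lim: "((\<lambda>t. P 0 (Z t)) \<longlongrightarrow> 0) F" if "(Z \<longlongrightarrow> 0) F" for Z F
    using bounded_linear.tendsto[OF blinfun.bounded_linear_right that] by (simp add: blinfun.zero_right)
  have "(\<lambda>t. P 0 (Yp t)) = (\<lambda>_. 0)"
    by (rule same_derivative_same_limit[where F = at_bot and l = 0 and G = "\<lambda>_. 0"])
      (use deriv[OF Y(2)] lim[OF Y(3)] in auto)
  moreover have "(\<lambda>t. P 0 (Ym t)) = (\<lambda>_. 0)"
    by (rule same_derivative_same_limit[where F = at_top and l = 0 and G = "\<lambda>_. 0"])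
      (use deriv[OF Y(4)] lim[OF Y(5)] in auto)
  ultimately show ?thesis by (simp add: Y(1) blinfun.add_right fun_eq_iff)
qed

lemma hyperbolic_part_cont: "hyperbolic_part k Y \<Longrightarrow> continuous_on S Y"
  by (auto intro!: continuous_at_imp_continuous_on dest: hyperbolic_part_deriv has_vector_derivative_continuous)

abbreviation forcing :: "(real \<times> 'a \<Rightarrow> 'a) \<Rightarrow> (real \<Rightarrow> 'a) \<Rightarrow> real \<Rightarrow> 'a" where
  "forcing \<phi> x r \<equiv> f r (x r + \<phi> (r, x r))"

text \<open>The Lipschitz estimate of the forcing, combined with the growth of the difference of the center curves:
\<open>3/2 (2 \<parallel>x(s) - y(s)\<parallel> + 2/3 q) + q\<close>.\<close>

lemma forcing_diff:
  assumes \<phi>: "\<phi> \<in> sections" and x: "center_curve \<phi> x" and y: "center_curve \<psi> y"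
    and q: "q \<ge> 0" and close: "\<And>r. norm (\<phi> (r, y r) - \<psi> (r, y r)) \<le> q * \<alpha> r s"
  shows "norm (forcing \<phi> x r - forcing \<psi> y r) \<le> (3 * norm (x s - y s) + 2 * q) * (L r * \<alpha> r s)"
proof -
  have "norm (forcing \<phi> x r - forcing \<psi> y r)
      \<le> L r * (3 / 2 * norm (x r - y r) + norm (\<phi> (r, y r) - \<psi> (r, y r)))"
    by (rule forcing_lip[OF \<phi> center_curve_in[OF x] center_curve_in[OF y]])
  also have "\<dots> \<le> L r * (3 / 2 * (\<alpha> r s * (2 * norm (x s - y s) + 2 / 3 * q)) + q * \<alpha> r s)"
    using center_curves_diff[OF \<phi> x y q close, of r] close[of r] L_nonneg[of r]
    by (intro mult_left_mono add_mono) auto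
  finally show ?thesis by (simp add: algebra_simps)
qed

lemma forcing_bound:
  assumes "\<phi> \<in> sections" "center_curve \<phi> x"
  shows "norm (forcing \<phi> x r) \<le> 3 * norm (x s) * (L r * \<alpha> r s)"
  using forcing_diff[OF assms center_curve_zero[OF assms(1)], of 0 s r] by (simp add: sections_zero[OF assms(1)])

lemma center_curve_unique:
  assumes \<phi>: "\<phi> \<in> sections" and x: "center_curve \<phi> x" "center_curve \<phi> y" "x s = y s"
  shows "x = y"
  using center_curves_diff[OF \<phi> x(1,2), of 0 s] x(3) by (auto simp: fun_eq_iff)

definition graph_transform :: "(real \<times> 'a \<Rightarrow> 'a) \<Rightarrow> real \<times> 'a \<Rightarrow> 'a" where
  "graph_transform \<phi> = restrict (\<lambda>(s, \<xi>). THE w. \<exists>x Y. center_curve \<phi> x \<and> x s = \<xi> \<and>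
     hyperbolic_part (forcing \<phi> x) Y \<and> w = T s 0 (Y s)) (center_bundle P)"

lemma graph_transform_eq:
  assumes \<phi>: "\<phi> \<in> sections" and x: "center_curve \<phi> x" and Y: "hyperbolic_part (forcing \<phi> x) Y"
  shows "graph_transform \<phi> (s, x s) = T s 0 (Y s)"
proof -
  have "(THE w. \<exists>x' Y. center_curve \<phi> x' \<and> x' s = x s \<and> hyperbolic_part (forcing \<phi> x') Y \<and> w = T s 0 (Y s))
      = T s 0 (Y s)"
  proof (rule the_equality)
    fix w assume "\<exists>x' Y. center_curve \<phi> x' \<and> x' s = x s \<and> hyperbolic_part (forcing \<phi> x') Y \<and> w = T s 0 (Y s)"
    then obtain x' Y' where x': "center_curve \<phi> x'" "x' s = x s"
      and Y': "hyperbolic_part (forcing \<phi> x') Y'" "w = T s 0 (Y' s)" by blast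
    have "x' = x" by (rule center_curve_unique[OF \<phi> x'(1) x x'(2)])
    then show "w = T s 0 (Y s)" using hyperbolic_part_unique[OF Y] Y' by simp
  qed (use x Y in blast)
  then show ?thesis by (simp add: graph_transform_def center_curve_in[OF x])
qed

lemma center_orbit:
  assumes \<phi>: "\<phi> \<in> sections" and \<xi>: "P s \<xi> = \<xi>"
  obtains x Y where "center_curve \<phi> x" "x s = \<xi>" "hyperbolic_part (forcing \<phi> x) Y"
proof -
  obtain x where x: "center_curve \<phi> x" "x s = \<xi>" using center_curve_exists[OF assms] by blast
  have "\<exists>Y. hyperbolic_part (forcing \<phi> x) Y \<and> norm (T s 0 (Y s)) \<le> 3 * norm (x s) / 8"
    by (rule hyperbolic_part_exists_bounded[OF forcing_cont[OF \<phi> x(1)] forcing_bound[OF \<phi> x(1)]]) simp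
  then show thesis using that x by blast
qed

text \<open>The estimate behind everything that follows: with \<open>\<psi> = \<phi>\<close> it gives the Lipschitz constant \<open>3/8\<close>, with
\<open>\<eta> = \<xi>\<close> the contraction constant \<open>1/2\<close>. Along the curve \<open>y\<close>, which grows like \<open>2 \<alpha>\<close>, the
two sections differ by at most \<open>2 c \<parallel>\<eta>\<parallel> \<alpha>\<close>; this is the \<open>q\<close> of the preceding lemma.\<close>

lemma graph_transform_diff:
  assumes \<phi>: "\<phi> \<in> sections" and \<psi>: "\<psi> \<in> sections" and \<xi>: "P s \<xi> = \<xi>" and \<eta>: "P s \<eta> = \<eta>" and c: "c \<ge> 0"
    and close: "\<And>r \<zeta>. P r \<zeta> = \<zeta> \<Longrightarrow> norm (\<phi> (r, \<zeta>) - \<psi> (r, \<zeta>)) \<le> c * norm \<zeta>"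
  shows "norm (graph_transform \<phi> (s, \<xi>) - graph_transform \<psi> (s, \<eta>)) \<le> 3 / 8 * norm (\<xi> - \<eta>) + c / 2 * norm \<eta>"
proof -
  obtain x Y where x: "center_curve \<phi> x" "x s = \<xi>" and Y: "hyperbolic_part (forcing \<phi> x) Y"
    using center_orbit[OF \<phi> \<xi>] by blast
  obtain y Z where y: "center_curve \<psi> y" "y s = \<eta>" and Z: "hyperbolic_part (forcing \<psi> y) Z"
    using center_orbit[OF \<psi> \<eta>] by blast
  have close': "norm (\<phi> (r, y r) - \<psi> (r, y r)) \<le> (2 * c * norm \<eta>) * \<alpha> r s" for r
  proof -
    have "norm (\<phi> (r, y r) - \<psi> (r, y r)) \<le> c * norm (y r)" by (rule close[OF center_curve_in[OF y(1)]])
    also have "\<dots> \<le> c * (\<alpha> r s * (2 * norm \<eta>))"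
      using center_curve_growth[OF \<psi> y(1), of r s] y(2) c by (intro mult_left_mono) auto
    finally show ?thesis by (simp add: mult_ac)
  qed
  have "norm (T s 0 (Y s - Z s)) \<le> (3 * norm (x s - y s) + 2 * (2 * c * norm \<eta>)) / 8"
  proof (rule hyperbolic_part_bound[OF hyperbolic_part_diff[OF Y Z]])
    show "continuous_on UNIV (\<lambda>r. forcing \<phi> x r - forcing \<psi> y r)"
      by (intro continuous_on_diff forcing_cont[OF \<phi> x(1)] forcing_cont[OF \<psi> y(1)])
    show "norm (forcing \<phi> x r - forcing \<psi> y r)
        \<le> (3 * norm (x s - y s) + 2 * (2 * c * norm \<eta>)) * (L r * \<alpha> r s)" for r
      by (rule forcing_diff[OF \<phi> x(1) y(1) _ close']) (use c in simp)
  qed (use c in simp)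
  moreover have "graph_transform \<phi> (s, \<xi>) = T s 0 (Y s)" "graph_transform \<psi> (s, \<eta>) = T s 0 (Z s)"
    using graph_transform_eq[OF \<phi> x(1) Y, of s] graph_transform_eq[OF \<psi> y(1) Z, of s] x(2) y(2) by auto
  ultimately show ?thesis by (simp add: blinfun.diff_right x(2) y(2))
qed

lemma graph_transform_lip:
  assumes "\<phi> \<in> sections" "P s \<xi> = \<xi>" "P s \<eta> = \<eta>"
  shows "norm (graph_transform \<phi> (s, \<xi>) - graph_transform \<phi> (s, \<eta>)) \<le> 3 / 8 * norm (\<xi> - \<eta>)"
  using graph_transform_diff[OF assms(1,1,2,3), of 0] by simp

text \<open>Continuity in \<open>(s, \<xi>)\<close> follows from the Lipschitz estimate in \<open>\<xi>\<close> alone: along the center curve \<open>x\<close> through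
\<open>(s\<^sub>0, \<xi>\<^sub>0)\<close> the transform is the continuous curve \<open>T s 0 (Y s)\<close>, and \<open>\<xi>\<close> is compared with \<open>x(s)\<close>.\<close>

lemma graph_transform_sections:
  assumes \<phi>: "\<phi> \<in> sections"
  shows "graph_transform \<phi> \<in> sections"
  unfolding lipschitz_sections_iff
proof (intro conjI allI impI)
  show "graph_transform \<phi> \<in> extensional (center_bundle P)" by (simp add: graph_transform_def)
  show zero: "graph_transform \<phi> (t, 0) = 0" for t
  proof -
    have "hyperbolic_part (forcing \<phi> (\<lambda>_. 0)) (\<lambda>_. 0)"
      unfolding hyperbolic_part_def
      by (intro exI[of _ "\<lambda>_. 0"]) (simp add: sections_zero[OF \<phi>] blinfun.zero_right)
    from graph_transform_eq[OF \<phi> center_curve_zero[OF \<phi>] this, of t] show ?thesis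
      by (simp add: blinfun.zero_right)
  qed
  show "P t (graph_transform \<phi> (t, \<xi>)) = 0" if \<xi>: "P t \<xi> = \<xi>" for t \<xi>
  proof -
    obtain x Y where x: "center_curve \<phi> x" "x t = \<xi>" and Y: "hyperbolic_part (forcing \<phi> x) Y"
      using center_orbit[OF \<phi> \<xi>] by blast
    show ?thesis
      using graph_transform_eq[OF \<phi> x(1) Y, of t] x(2)
      by (simp add: P_T hyperbolic_part_P[OF Y] blinfun.zero_right)
  qed
  show "norm (graph_transform \<phi> (t, \<xi>) - graph_transform \<phi> (t, \<eta>)) \<le> 1 / 2 * norm (\<xi> - \<eta>)"
    if "P t \<xi> = \<xi>" "P t \<eta> = \<eta>" for t \<xi> \<eta>
    using graph_transform_lip[OF \<phi> that] norm_ge_zero[of "\<xi> - \<eta>"] by linarith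
  show "continuous_on (center_bundle P) (graph_transform \<phi>)"
    unfolding continuous_on_def
  proof
    fix p0 assume "p0 \<in> center_bundle P"
    then obtain s0 \<xi>0 where p0: "p0 = (s0, \<xi>0)" and \<xi>0: "P s0 \<xi>0 = \<xi>0" by (cases p0) auto
    obtain x Y where x: "center_curve \<phi> x" "x s0 = \<xi>0" and Y: "hyperbolic_part (forcing \<phi> x) Y"
      using center_orbit[OF \<phi> \<xi>0] by blast
    let ?F = "at p0 within center_bundle P"
    have fst: "(fst \<longlongrightarrow> s0) ?F" and snd: "(snd \<longlongrightarrow> \<xi>0) ?F"
      using tendsto_fst[OF tendsto_ident_at, of p0] tendsto_snd[OF tendsto_ident_at, of p0] by (auto simp: p0)
    have comp: "((\<lambda>p. u (fst p)) \<longlongrightarrow> u s0) ?F" if "continuous_on UNIV u" for u :: "real \<Rightarrow> 'a"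
      using that fst by (intro isCont_tendsto_compose[of s0 u]) (auto simp: continuous_on_eq_continuous_at)
    have "((\<lambda>p. 3 / 8 * norm (snd p - x (fst p)) + norm (T (fst p) 0 (Y (fst p)) - T s0 0 (Y s0))) \<longlongrightarrow>
        3 / 8 * norm (\<xi>0 - x s0) + norm (T s0 0 (Y s0) - T s0 0 (Y s0))) ?F"
      by (intro tendsto_add tendsto_mult tendsto_norm tendsto_diff tendsto_const snd tendsto_T fst
          comp[OF center_curve_cont[OF x(1)]] comp[OF hyperbolic_part_cont[OF Y]])
    then have lim: "((\<lambda>p. 3 / 8 * norm (snd p - x (fst p)) + norm (T (fst p) 0 (Y (fst p)) - T s0 0 (Y s0)))
        \<longlongrightarrow> 0) ?F" by (simp add: x(2))
    have "\<forall>\<^sub>F p in ?F. norm (graph_transform \<phi> p - graph_transform \<phi> p0)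
        \<le> 3 / 8 * norm (snd p - x (fst p)) + norm (T (fst p) 0 (Y (fst p)) - T s0 0 (Y s0))"
      unfolding eventually_at_filter
    proof (intro always_eventually allI impI)
      fix p assume "p \<in> center_bundle P"
      then obtain s \<xi> where p: "p = (s, \<xi>)" and \<xi>: "P s \<xi> = \<xi>" by (cases p) auto
      have "norm (graph_transform \<phi> (s, \<xi>) - graph_transform \<phi> (s, x s)) \<le> 3 / 8 * norm (\<xi> - x s)"
        by (rule graph_transform_lip[OF \<phi> \<xi> center_curve_in[OF x(1)]])
      moreover have "graph_transform \<phi> (s, x s) = T s 0 (Y s)" "graph_transform \<phi> (s0, \<xi>0) = T s0 0 (Y s0)"
        using graph_transform_eq[OF \<phi> x(1) Y] x(2) by auto
      moreover have "norm (graph_transform \<phi> (s, \<xi>) - T s0 0 (Y s0))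
          \<le> norm (graph_transform \<phi> (s, \<xi>) - T s 0 (Y s)) + norm (T s 0 (Y s) - T s0 0 (Y s0))"
        by (metis add.commute diff_add_cancel add_diff_eq norm_triangle_ineq)
      ultimately show "norm (graph_transform \<phi> p - graph_transform \<phi> p0)
        \<le> 3 / 8 * norm (snd p - x (fst p)) + norm (T (fst p) 0 (Y (fst p)) - T s0 0 (Y s0))"
        by (simp add: p p0)
    qed
    from Lim_null_comparison[OF this lim]
    show "(graph_transform \<phi> \<longlongrightarrow> graph_transform \<phi> p0) ?F" by (simp add: LIM_zero_iff)
  qed
qed

text \<open>The weight vanishes off the bundle, where all sections have the same default value.\<close>

definition section_weight :: "real \<times> 'a \<Rightarrow> real" where
  "section_weight p = (if p \<in> center_bundle P then norm (snd p) else 0)"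

lemma graph_transform_contraction:
  assumes \<phi>: "\<phi> \<in> sections" and \<psi>: "\<psi> \<in> sections" and c: "c \<ge> 0"
    and close: "\<forall>p\<in>UNIV. norm (\<phi> p - \<psi> p) \<le> c * section_weight p"
  shows "\<forall>p\<in>UNIV. norm (graph_transform \<phi> p - graph_transform \<psi> p) \<le> c / 2 * section_weight p"
proof
  fix p :: "real \<times> 'a"
  show "norm (graph_transform \<phi> p - graph_transform \<psi> p) \<le> c / 2 * section_weight p"
  proof (cases "p \<in> center_bundle P")
    case True
    then obtain s \<xi> where p: "p = (s, \<xi>)" and \<xi>: "P s \<xi> = \<xi>" by (cases p) auto
    have "norm (\<phi> (r, \<zeta>) - \<psi> (r, \<zeta>)) \<le> c * norm \<zeta>" if "P r \<zeta> = \<zeta>" for r \<zeta>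
      using bspec[OF close, of "(r, \<zeta>)"] that by (simp add: section_weight_def)
    from graph_transform_diff[OF \<phi> \<psi> \<xi> \<xi> c this] show ?thesis
      using True by (simp add: p section_weight_def)
  next
    case False
    then show ?thesis by (simp add: graph_transform_def section_weight_def)
  qed
qed

lemma sections_close:
  assumes "\<phi> \<in> sections" "\<psi> \<in> sections"
  shows "norm (\<phi> p - \<psi> p) \<le> 1 * section_weight p"
proof (cases "p \<in> center_bundle P")
  case True
  then obtain s \<xi> where p: "p = (s, \<xi>)" and \<xi>: "P s \<xi> = \<xi>" by (cases p) auto
  show ?thesis
    using sections_bound[OF assms(1) \<xi>] sections_bound[OF assms(2) \<xi>] True
      norm_triangle_ineq4[of "\<phi> p" "\<psi> p"] by (simp add: p section_weight_def)
next
  case False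
  then have "\<phi> p = undefined" "\<psi> p = undefined" using assms sections_undefined by blast+
  then show ?thesis using False by (simp add: section_weight_def)
qed

lemma sections_closed:
  assumes \<phi>s: "\<And>n :: nat. \<phi>s n \<in> sections" and e: "e \<longlonglongrightarrow> 0"
    and rate: "\<And>n p. norm (\<phi>s n p - \<phi> p) \<le> e n * section_weight p"
  shows "\<phi> \<in> sections"
proof -
  have lim: "(\<lambda>n. \<phi>s n p) \<longlonglongrightarrow> \<phi> p" for p
  proof -
    have "(\<lambda>n. e n * section_weight p) \<longlonglongrightarrow> 0" using e by (auto intro!: tendsto_eq_intros)
    then have "(\<lambda>n. \<phi>s n p - \<phi> p) \<longlonglongrightarrow> 0" by (rule Lim_null_comparison[rotated]) (simp add: rate)
    then show ?thesis by (simp add: LIM_zero_iff)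
  qed
  show ?thesis
    unfolding lipschitz_sections_iff
  proof (intro conjI allI impI)
    show "\<phi> \<in> extensional (center_bundle P)"
      unfolding extensional_def
    proof (intro CollectI allI impI)
      fix p assume "p \<notin> center_bundle P"
      then show "\<phi> p = undefined"
        using rate[of 0 p] sections_undefined[OF \<phi>s[of 0]] by (simp add: section_weight_def)
    qed
    show "\<phi> (t, 0) = 0" for t
      using lim[of "(t, 0)"] \<phi>s by (simp add: sections_zero LIMSEQ_const_iff)
    show "P t (\<phi> (t, \<xi>)) = 0" if "P t \<xi> = \<xi>" for t \<xi>
    proof -
      have "(\<lambda>n. P t (\<phi>s n (t, \<xi>))) \<longlonglongrightarrow> P t (\<phi> (t, \<xi>))"
        by (rule bounded_linear.tendsto[OF blinfun.bounded_linear_right lim])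
      then show ?thesis by (simp add: sections_P[OF \<phi>s that] LIMSEQ_const_iff)
    qed
    show "norm (\<phi> (t, \<xi>) - \<phi> (t, \<eta>)) \<le> 1 / 2 * norm (\<xi> - \<eta>)" if "P t \<xi> = \<xi>" "P t \<eta> = \<eta>" for t \<xi> \<eta>
      by (rule LIMSEQ_le_const2[OF tendsto_norm[OF tendsto_diff[OF lim lim]]])
        (use sections_lip[OF \<phi>s that] in blast)
    show "continuous_on (center_bundle P) \<phi>"
      unfolding continuous_on_eq_continuous_within
    proof
      fix p0 assume p0: "p0 \<in> center_bundle P"
      let ?U = "center_bundle P \<inter> ball p0 1"
      have at_within_inter_ball: "at p0 within ?U = at p0 within center_bundle P"
        by (rule at_within_nhd[of p0 "ball p0 1"]) auto
      have "uniform_limit ?U \<phi>s \<phi> sequentially"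
      proof (rule uniform_limitI)
        fix \<epsilon> :: real assume "\<epsilon> > 0"
        moreover have "(\<lambda>n. \<bar>e n\<bar> * (norm p0 + 1)) \<longlonglongrightarrow> 0" using e by (auto intro!: tendsto_eq_intros)
        ultimately have "\<forall>\<^sub>F n in sequentially. \<bar>e n\<bar> * (norm p0 + 1) < \<epsilon>" using order_tendstoD(2) by blast
        then show "\<forall>\<^sub>F n in sequentially. \<forall>p\<in>?U. dist (\<phi>s n p) (\<phi> p) < \<epsilon>"
        proof eventually_elim
          case (elim n)
          have "dist (\<phi>s n p) (\<phi> p) < \<epsilon>" if p: "p \<in> ?U" for p
          proof -
            have "norm (snd p) \<le> norm p" by (metis norm_snd_le prod.collapse)
            also have "\<dots> \<le> norm p0 + norm (p - p0)" by (rule norm_triangle_sub)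
            also have "\<dots> \<le> norm p0 + 1" using p by (simp add: dist_norm norm_minus_commute)
            finally have "e n * section_weight p \<le> \<bar>e n\<bar> * (norm p0 + 1)"
              using p by (intro mult_mono) (auto simp: section_weight_def)
            then show ?thesis using rate[of n p] elim by (simp add: dist_norm)
          qed
          then show ?case by blast
        qed
      qed
      then have "continuous_on ?U \<phi>"
        using \<phi>s by (intro uniform_limit_theorem[of _ \<phi>s sequentially])
          (auto simp: lipschitz_sections_iff intro!: always_eventually intro: continuous_on_subset)
      then have "continuous (at p0 within ?U) \<phi>" using p0 by (simp add: continuous_on_eq_continuous_within)
      then show "continuous (at p0 within center_bundle P) \<phi>"
        by (simp add: continuous_within at_within_inter_ball)
    qed
  qed
qed

section \<open>Fixed points and invariant graphs\<close>

definition flow_invariant :: "(real \<times> 'a \<Rightarrow> 'a) \<Rightarrow> bool" where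
  "flow_invariant \<phi> \<longleftrightarrow> (\<forall>\<tau>. flow_map A f \<tau> ` section_graph P \<phi> \<subseteq> section_graph P \<phi>)"

text \<open>At a fixed point, \<open>\<phi>(t, x(t))\<close> is the hyperbolic part of the forcing, so the center equation and the
equation of the hyperbolic part add up to the full equation.\<close>

lemma solution_on_graph:
  assumes \<phi>: "\<phi> \<in> sections" and fixed: "graph_transform \<phi> = \<phi>" and x: "center_curve \<phi> x"
  shows "global_solution (\<lambda>t x. A t x + f t x) (\<lambda>t. x t + \<phi> (t, x t))"
proof -
  obtain Y where Y: "hyperbolic_part (forcing \<phi> x) Y"
    using center_orbit[OF \<phi> center_curve_in[OF x, of 0]] center_curve_unique[OF \<phi> x] by metis
  have \<phi>Y: "\<phi> (t, x t) = T t 0 (Y t)" for t using graph_transform_eq[OF \<phi> x Y, of t] fixed by simp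
  have "((\<lambda>t. T 0 t (x t) + Y t) has_vector_derivative
      P 0 (T 0 t (forcing \<phi> x t)) + (T 0 t (forcing \<phi> x t) - P 0 (T 0 t (forcing \<phi> x t)))) (at t)" for t
    by (intro has_vector_derivative_add center_curve_deriv[OF x] hyperbolic_part_deriv[OF Y])
  then have "((\<lambda>t. T 0 t (x t) + Y t) has_vector_derivative T 0 t (forcing \<phi> x t)) (at t)" for t by simp
  moreover have "T 0 t (x t + \<phi> (t, x t)) = T 0 t (x t) + Y t" for t by (simp add: \<phi>Y blinfun.add_right)
  ultimately show ?thesis by (simp add: solution_pull_back_iff)
qed

lemma flow_on_graph:
  assumes \<phi>: "\<phi> \<in> sections" and fixed: "graph_transform \<phi> = \<phi>" and x: "center_curve \<phi> x"
  shows "flow_map A f \<tau> (graph_point \<phi> s (x s)) = graph_point \<phi> (s + \<tau>) (x (s + \<tau>))"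
  using solution_through_eq[OF solution_on_graph[OF assms], of s "x s + \<phi> (s, x s)"]
  by (simp add: flow_map_def graph_point_def)

lemma fixed_point_invariant:
  assumes \<phi>: "\<phi> \<in> sections" and fixed: "graph_transform \<phi> = \<phi>"
  shows "flow_invariant \<phi>"
  unfolding flow_invariant_def
proof (intro allI subsetI)
  fix \<tau> p assume "p \<in> flow_map A f \<tau> ` section_graph P \<phi>"
  then obtain s \<xi> where p: "p = flow_map A f \<tau> (graph_point \<phi> s \<xi>)" and \<xi>: "P s \<xi> = \<xi>"
    by (auto simp: section_graph_def)
  obtain x where x: "center_curve \<phi> x" "x s = \<xi>" using center_curve_exists[OF \<phi> \<xi>] by blast
  have "p = graph_point \<phi> (s + \<tau>) (x (s + \<tau>))"
    using flow_on_graph[OF \<phi> fixed x(1), of \<tau> s] by (simp add: p x(2))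
  then show "p \<in> section_graph P \<phi>"
    unfolding section_graph_def using center_curve_in[OF x(1), of "s + \<tau>"] by auto
qed

lemma fixed_point_growth:
  assumes \<phi>: "\<phi> \<in> sections" and fixed: "graph_transform \<phi> = \<phi>" and \<xi>: "P s \<xi> = \<xi>" "P s \<eta> = \<eta>"
  shows "norm (snd (flow_map A f (t - s) (graph_point \<phi> s \<xi>)) - snd (flow_map A f (t - s) (graph_point \<phi> s \<eta>)))
    \<le> 3 * \<alpha> t s * norm (\<xi> - \<eta>)"
proof -
  obtain x where x: "center_curve \<phi> x" "x s = \<xi>" using center_curve_exists[OF \<phi> \<xi>(1)] by blast
  obtain y where y: "center_curve \<phi> y" "y s = \<eta>" using center_curve_exists[OF \<phi> \<xi>(2)] by blast
  have "norm ((x t + \<phi> (t, x t)) - (y t + \<phi> (t, y t))) \<le> norm (x t - y t) + norm (\<phi> (t, x t) - \<phi> (t, y t))"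
    by (metis add_diff_add norm_triangle_ineq)
  also have "\<dots> \<le> 3 / 2 * norm (x t - y t)"
    using sections_lip[OF \<phi> center_curve_in[OF x(1)] center_curve_in[OF y(1)], of t] by simp
  also have "\<dots> \<le> 3 / 2 * (\<alpha> t s * (2 * norm (\<xi> - \<eta>)))"
    using center_curves_diff[OF \<phi> x(1) y(1), of 0 s t] x(2) y(2) by simp
  finally show ?thesis
    using flow_on_graph[OF \<phi> fixed x(1), of "t - s" s] flow_on_graph[OF \<phi> fixed y(1), of "t - s" s] x(2) y(2)
    by (simp add: graph_point_def)
qed

text \<open>A solution \<open>v\<close> that stays in the graph grows at most like \<open>3 \<alpha>\<close>, because its center component does.
Transported to the base time, \<open>Q\<^sup>+ v(r)\<close> is then bounded by \<open>\<beta>\<^sup>+ \<alpha>\<close>, which tends to \<open>0\<close> in the past;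
the same holds for \<open>Q\<^sup>-\<close> in the future. So the hyperbolic components of \<open>v\<close> are the
primitives that define the graph transform.\<close>

lemma invariant_fixed_point:
  assumes \<phi>: "\<phi> \<in> sections" and inv: "flow_invariant \<phi>"
  shows "graph_transform \<phi> = \<phi>"
proof
  fix p
  show "graph_transform \<phi> p = \<phi> p"
  proof (cases "p \<in> center_bundle P")
    case False
    then show ?thesis using sections_undefined[OF \<phi>] by (simp add: graph_transform_def)
  next
    case True
    then obtain s \<xi> where p: "p = (s, \<xi>)" and \<xi>: "P s \<xi> = \<xi>" by (cases p) auto
    obtain v where v: "global_solution (\<lambda>t x. A t x + f t x) v" "v s = \<xi> + \<phi> (s, \<xi>)"
      using solution_exists by blast
    have on_graph: "\<exists>\<zeta>. P t \<zeta> = \<zeta> \<and> v t = \<zeta> + \<phi> (t, \<zeta>)" for t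
    proof -
      have "graph_point \<phi> s \<xi> \<in> section_graph P \<phi>" using \<xi> by (auto simp: section_graph_def)
      then have "flow_map A f (t - s) (graph_point \<phi> s \<xi>) \<in> section_graph P \<phi>"
        using inv by (auto simp: flow_invariant_def)
      moreover have "flow_map A f (t - s) (graph_point \<phi> s \<xi>) = (t, v t)"
        by (simp add: flow_map_def graph_point_def solution_through_eq[OF v])
      ultimately show ?thesis by (auto simp: section_graph_def graph_point_def)
    qed
    define x where "x t = P t (v t)" for t
    have vx: "v t = x t + \<phi> (t, x t)" for t
    proof -
      obtain \<zeta> where "P t \<zeta> = \<zeta>" "v t = \<zeta> + \<phi> (t, \<zeta>)" using on_graph by blast
      then show ?thesis by (simp add: x_def blinfun.add_right sections_P[OF \<phi>])
    qed
    have v': "((\<lambda>t. T 0 t (v t)) has_vector_derivative T 0 t (f t (v t))) (at t)" for t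
      using v(1) by (simp add: solution_pull_back_iff)
    have proj': "((\<lambda>t. B (T 0 t (v t))) has_vector_derivative B (T 0 t (f t (v t)))) (at t)"
      for B :: "'a \<Rightarrow>\<^sub>L 'a" and t
      by (intro bounded_linear.has_vector_derivative[OF blinfun.bounded_linear_right] v')
    have x: "center_curve \<phi> x"
      unfolding center_curve_def
    proof (intro conjI allI)
      show "((\<lambda>t. T 0 t (x t)) has_vector_derivative P 0 (T 0 t (f t (x t + \<phi> (t, x t))))) (at t)" for t
        unfolding vx[symmetric] using proj'[of "P 0" t] by (simp add: x_def P_T)
    qed (simp add: x_def)
    have x_s: "x s = \<xi>" by (simp add: x_def v(2) blinfun.add_right \<xi> sections_P[OF \<phi>])
    have growth: "norm (v r) \<le> 3 * norm \<xi> * \<alpha> r s" for r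
    proof -
      have "norm (v r) \<le> norm (x r) + norm (\<phi> (r, x r))" unfolding vx by (rule norm_triangle_ineq)
      also have "\<dots> \<le> 3 / 2 * norm (x r)" using sections_bound[OF \<phi> center_curve_in[OF x], of r] by simp
      also have "\<dots> \<le> 3 / 2 * (\<alpha> r s * (2 * norm \<xi>))"
        using center_curve_growth[OF \<phi> x, of r s] x_s by (simp add: mult_ac)
      finally show ?thesis by (simp add: mult_ac)
    qed
    have vanish: "((\<lambda>r. B 0 (T 0 r (v r))) \<longlongrightarrow> 0) F"
      if B: "\<And>r x. B 0 (T 0 r x) = T 0 s (T s r (B r x))"
        and bnd: "\<forall>\<^sub>F r in F. \<forall>x. norm (T s r (B r x)) \<le> \<beta> r * norm x \<and> \<beta> r \<ge> 0"
        and lim: "((\<lambda>r. \<beta> r * \<alpha> r s) \<longlongrightarrow> 0) F" for B :: "real \<Rightarrow> 'a \<Rightarrow>\<^sub>L 'a" and \<beta> F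
    proof -
      have "((\<lambda>r. 3 * norm \<xi> * (\<beta> r * \<alpha> r s)) \<longlongrightarrow> 0) F" using tendsto_mult_right_zero[OF lim] by simp
      then have "((\<lambda>r. T s r (B r (v r))) \<longlongrightarrow> 0) F"
      proof (rule Lim_null_comparison[rotated])
        show "\<forall>\<^sub>F r in F. norm (T s r (B r (v r))) \<le> 3 * norm \<xi> * (\<beta> r * \<alpha> r s)"
          using bnd
        proof eventually_elim
          case (elim r)
          have "norm (T s r (B r (v r))) \<le> \<beta> r * norm (v r)" using elim by blast
          also have "\<dots> \<le> \<beta> r * (3 * norm \<xi> * \<alpha> r s)" using elim growth by (intro mult_left_mono) auto
          finally show ?case by (simp add: mult_ac)
        qed
      qed
      then have "((\<lambda>r. T 0 s (T s r (B r (v r)))) \<longlongrightarrow> T 0 s 0) F" by (intro tendsto_T tendsto_const)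
      then show ?thesis unfolding B by (simp add: blinfun.zero_right)
    qed
    have Y: "hyperbolic_part (forcing \<phi> x) (\<lambda>t. Qp 0 (T 0 t (v t)) + Qm 0 (T 0 t (v t)))"
      unfolding hyperbolic_part_def vx[symmetric]
    proof (rule exI[of _ "\<lambda>t. Qp 0 (T 0 t (v t))"], rule exI[of _ "\<lambda>t. Qm 0 (T 0 t (v t))"],
        intro conjI allI refl proj')
      show "((\<lambda>t. Qp 0 (T 0 t (v t))) \<longlongrightarrow> 0) at_bot"
      proof (rule vanish[OF _ _ \<beta>p_lim[of s]])
        show "\<forall>\<^sub>F r in at_bot. \<forall>x. norm (T s r (Qp r x)) \<le> \<beta>p s r * norm x \<and> \<beta>p s r \<ge> 0"
          using eventually_le_at_bot[of s] by eventually_elim (simp add: \<beta>p_bound \<beta>p_nonneg)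
      qed (simp add: Qp_T)
      show "((\<lambda>t. Qm 0 (T 0 t (v t))) \<longlongrightarrow> 0) at_top"
      proof (rule vanish[OF _ _ \<beta>m_lim[of s]])
        show "\<forall>\<^sub>F r in at_top. \<forall>x. norm (T s r (Qm r x)) \<le> \<beta>m s r * norm x \<and> \<beta>m s r \<ge> 0"
          using eventually_ge_at_top[of s] by eventually_elim (simp add: \<beta>m_bound \<beta>m_nonneg)
      qed (simp add: Qm_T)
    qed
    have "graph_transform \<phi> (s, \<xi>) = T s 0 (Qp 0 (T 0 s (v s)) + Qm 0 (T 0 s (v s)))"
      using graph_transform_eq[OF \<phi> x Y, of s] x_s by simp
    also have "\<dots> = v s - P s (v s)" by (simp add: Qp_T Qm_T blinfun.add_right Qm_eq[of s])
    also have "\<dots> = \<phi> (s, \<xi>)" using vx[of s] x_s by (simp add: x_def)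
    finally show ?thesis by (simp add: p)
  qed
qed

lemma omega_le:
  assumes Lip: "\<And>r. Lip (f r) \<le> ennreal (L r)"
    and p: "\<And>s. \<nu>p' s \<in> borel_measurable borel" and m: "\<And>s. \<nu>m' s \<in> borel_measurable borel"
  shows "omega \<alpha> \<beta>p \<beta>m f \<le> ennreal (1 / 8)"
  unfolding omega_def
proof (rule SUP_least)
  fix s
  have step: "ennreal b * Lip (f r) * ennreal (\<alpha> r s) \<le> ennreal c"
    if "b \<ge> 0" "b * L r * \<alpha> r s \<le> c" for b c r
  proof -
    have "ennreal b * Lip (f r) * ennreal (\<alpha> r s) \<le> ennreal b * ennreal (L r) * ennreal (\<alpha> r s)"
      by (intro mult_right_mono mult_left_mono Lip) auto
    also have "\<dots> = ennreal (b * L r * \<alpha> r s)"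
      using that(1) L_nonneg[of r] by (simp add: ennreal_mult')
    also have "\<dots> \<le> ennreal c" by (intro ennreal_leI that(2))
    finally show ?thesis .
  qed
  have seq: "\<exists>n :: nat. u \<le> real n" for u :: real using real_arch_simple by blast
  have "(\<integral>\<^sup>+ r\<in>{..s}. (ennreal (\<beta>p s r) * Lip (f r) * ennreal (\<alpha> r s)) \<partial>lborel)
      \<le> (\<integral>\<^sup>+ r\<in>{..s}. ennreal (\<nu>p' s r) \<partial>lborel)"
    by (intro nn_integral_mono) (auto simp: indicator_def intro!: step \<beta>p_nonneg \<nu>p_bound)
  also have "\<dots> \<le> ennreal (1 / 16)"
  proof (rule nn_integral_le_antiderivative[where x = "\<lambda>n. s - real n" and y = "\<lambda>_. s" and b = "\<nu>p s"])
    show "(\<Union>n. {s - real n..s}) = {..s}"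
      using seq[of "s - u" for u] by (auto simp: algebra_simps)
    show "0 \<le> \<nu>p' s r" if "r \<in> {s - real n..s}" for r n
      using \<nu>p_bound[of r s] \<beta>p_nonneg[of r s] L_nonneg[of r] \<alpha>_pos[of r s] that
      by (auto intro!: order_trans[OF _ \<nu>p_bound[of r s]] mult_nonneg_nonneg simp: less_imp_le)
  qed (use p \<nu>p_deriv \<nu>p_var in \<open>auto simp: incseq_def\<close>)
  finally have plus: "(\<integral>\<^sup>+ r\<in>{..s}. (ennreal (\<beta>p s r) * Lip (f r) * ennreal (\<alpha> r s)) \<partial>lborel) \<le> ennreal (1 / 16)" .
  have "(\<integral>\<^sup>+ r\<in>{s..}. (ennreal (\<beta>m s r) * Lip (f r) * ennreal (\<alpha> r s)) \<partial>lborel)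
      \<le> (\<integral>\<^sup>+ r\<in>{s..}. ennreal (\<nu>m' s r) \<partial>lborel)"
    by (intro nn_integral_mono) (auto simp: indicator_def intro!: step \<beta>m_nonneg \<nu>m_bound)
  also have "\<dots> \<le> ennreal (1 / 16)"
  proof (rule nn_integral_le_antiderivative[where x = "\<lambda>_. s" and y = "\<lambda>n. s + real n" and b = "\<nu>m s"])
    show "(\<Union>n. {s..s + real n}) = {s..}"
      using seq[of "u - s" for u] by (auto simp: algebra_simps)
    show "0 \<le> \<nu>m' s r" if "r \<in> {s..s + real n}" for r n
      using \<nu>m_bound[of s r] \<beta>m_nonneg[of s r] L_nonneg[of r] \<alpha>_pos[of r s] that
      by (auto intro!: order_trans[OF _ \<nu>m_bound[of s r]] mult_nonneg_nonneg simp: less_imp_le)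
  qed (use m \<nu>m_deriv \<nu>m_var in \<open>auto simp: incseq_def\<close>)
  finally have minus: "(\<integral>\<^sup>+ r\<in>{s..}. (ennreal (\<beta>m s r) * Lip (f r) * ennreal (\<alpha> r s)) \<partial>lborel) \<le> ennreal (1 / 16)" .
  have "ennreal (1 / 16) + ennreal (1 / 16) = ennreal (1 / 8)"
    by (subst ennreal_plus[symmetric]) auto
  then show "(\<integral>\<^sup>+ r\<in>{..s}. (ennreal (\<beta>p s r) * Lip (f r) * ennreal (\<alpha> r s)) \<partial>lborel) +
      (\<integral>\<^sup>+ r\<in>{s..}. (ennreal (\<beta>m s r) * Lip (f r) * ennreal (\<alpha> r s)) \<partial>lborel) \<le> ennreal (1 / 8)"
    using add_mono[OF plus minus] by simp
qed

text \<open>The growth constant is \<open>3 = (1 + N) * 2\<close>. The iteration starts from the zero section.\<close>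

theorem center_manifold_theorem:
  "\<exists>\<phi>\<in>sections. flow_invariant \<phi> \<and>
     (\<forall>t s \<xi> \<eta>. P s \<xi> = \<xi> \<longrightarrow> P s \<eta> = \<eta> \<longrightarrow>
        norm (snd (flow_map A f (t - s) (graph_point \<phi> s \<xi>)) - snd (flow_map A f (t - s) (graph_point \<phi> s \<eta>)))
          \<le> 3 * \<alpha> t s * norm (\<xi> - \<eta>)) \<and>
     (\<forall>\<psi>\<in>sections. flow_invariant \<psi> \<longrightarrow> \<psi> = \<phi>)"
proof -
  have zero: "restrict (\<lambda>_. 0) (center_bundle P) \<in> sections"
    by (auto simp: lipschitz_sections_iff blinfun.zero_right)
  have "\<exists>\<phi>\<in>sections. graph_transform \<phi> = \<phi>"
  proof (rule weighted_contraction_fixpoint[where I = "\<lambda>_::unit. UNIV" and w = "\<lambda>_. section_weight",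
        OF zero graph_transform_sections])
    show "\<exists>C\<ge>0. \<forall>p\<in>UNIV. norm (graph_transform (restrict (\<lambda>_. 0) (center_bundle P)) p
        - restrict (\<lambda>_. 0) (center_bundle P) p) \<le> C * section_weight p"
      using sections_close[OF graph_transform_sections[OF zero] zero] by (intro exI[of _ 1]) auto
  next
    fix \<phi>s \<phi>
    assume "\<And>n :: nat. \<phi>s n \<in> sections"
      and "\<And>j::unit. \<exists>e. e \<longlonglongrightarrow> 0 \<and> (\<forall>n. \<forall>p\<in>UNIV. norm (\<phi>s n p - \<phi> p) \<le> e n * section_weight p)"
    then show "\<phi> \<in> sections" using sections_closed by blast
  qed (use graph_transform_contraction in auto)
  then obtain \<phi> where \<phi>: "\<phi> \<in> sections" "graph_transform \<phi> = \<phi>" by blast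
  have "\<psi> = \<phi>" if \<psi>: "\<psi> \<in> sections" "flow_invariant \<psi>" for \<psi>
  proof
    fix p
    show "\<psi> p = \<phi> p"
      by (rule weighted_contraction_unique[where S = sections and c = 1 and I = UNIV and w = section_weight,
            OF graph_transform_sections graph_transform_contraction \<psi>(1) \<phi>(1)
              invariant_fixed_point[OF \<psi>] \<phi>(2)])
        (use sections_close[OF \<psi>(1) \<phi>(1)] in auto)
  qed
  then show ?thesis
    using fixed_point_invariant[OF \<phi>] fixed_point_growth[OF \<phi>] \<phi>(1) by blast
qed

end

section \<open>Polynomial bounds\<close>

text \<open>A bounded primitive of \<open>(\<bar>u\<bar> + 1)\<close> to the power \<open>-p\<close>. To avoid differentiating a formula with cases at the origin, a primitive is
taken from continuity of the integrand, and its variation on each half line is compared with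
the explicit primitive there.\<close>

lemma powr_tail_antiderivative:
  fixes p :: real
  assumes p: "p > 1"
  shows "\<exists>H. (\<forall>u. (H has_real_derivative (\<bar>u\<bar> + 1) powr (- p)) (at u)) \<and>
    (\<forall>u v. \<bar>H u - H v\<bar> \<le> 2 / (p - 1))"
proof -
  have "continuous_on UNIV (\<lambda>u :: real. (\<bar>u\<bar> + 1) powr (- p))"
    by (intro continuous_intros) auto
  then obtain H where H: "\<And>u. (H has_vector_derivative (\<bar>u\<bar> + 1) powr (- p)) (at u)"
    using continuous_has_antiderivative by blast
  have half: "\<bar>H u - H 0\<bar> \<le> 1 / (p - 1)" for u
  proof -
    define \<sigma> :: real where "\<sigma> = (if u \<ge> 0 then 1 else -1)"
    have abs: "\<bar>r\<bar> = \<sigma> * r" "\<sigma> * \<sigma> = 1" if "r \<in> closed_segment 0 u" for r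
      using that by (auto simp: \<sigma>_def closed_segment_eq_real_ivl split: if_splits)
    define b where "b r = - \<sigma> * (\<sigma> * r + 1) powr (1 - p) / (p - 1)" for r
    have "norm (H u - H 0) \<le> \<bar>b u - b 0\<bar>"
    proof (rule norm_diff_le_majorant[OF H])
      fix r assume r: "r \<in> closed_segment 0 u"
      have pos: "\<sigma> * r + 1 > 0" using abs(1)[OF r] by linarith
      have "(b has_real_derivative
          - \<sigma> * ((1 - p) * (\<sigma> * r + 1) powr (1 - p - 1) * \<sigma>) / (p - 1)) (at r)"
        unfolding b_def using p pos by (auto intro!: derivative_eq_intros)
      also have "- \<sigma> * ((1 - p) * (\<sigma> * r + 1) powr (1 - p - 1) * \<sigma>) / (p - 1)
          = (\<sigma> * \<sigma>) * ((p - 1) / (p - 1)) * (\<sigma> * r + 1) powr (- p)"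
        using p by (simp add: field_simps)
      also have "\<dots> = (\<bar>r\<bar> + 1) powr (- p)" using p abs[OF r] by simp
      finally show "(b has_real_derivative (\<bar>r\<bar> + 1) powr (- p)) (at r)" .
    qed simp
    also have "b u - b 0 = \<sigma> * ((1 - (\<bar>u\<bar> + 1) powr (1 - p)) / (p - 1))"
      unfolding b_def abs(1)[OF ends_in_segment(2)] by (simp add: algebra_simps diff_divide_distrib)
    also have "\<bar>\<dots>\<bar> = \<bar>1 - (\<bar>u\<bar> + 1) powr (1 - p)\<bar> / (p - 1)"
      using p by (simp add: abs_mult \<sigma>_def)
    also have "\<dots> \<le> 1 / (p - 1)"
    proof -
      have ne: "\<bar>u\<bar> + 1 \<noteq> 0" by linarith
      have "(\<bar>u\<bar> + 1) powr (1 - p) \<le> (\<bar>u\<bar> + 1) powr 0" using p by (intro powr_mono) auto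
      also have "\<dots> = 1" using ne by simp
      finally have "\<bar>1 - (\<bar>u\<bar> + 1) powr (1 - p)\<bar> \<le> 1"
        using powr_ge_zero[of "\<bar>u\<bar> + 1" "1 - p"] by linarith
      then show ?thesis using p by (intro divide_right_mono) auto
    qed
    finally show ?thesis by simp
  qed
  have "\<bar>H u - H v\<bar> \<le> 2 / (p - 1)" for u v
  proof -
    have "2 / (p - 1) = 1 / (p - 1) + 1 / (p - 1)" by (simp add: add_divide_distrib[symmetric])
    then show ?thesis using half[of u] half[of v] by linarith
  qed
  then show ?thesis using H by (auto simp: has_real_derivative_iff_has_vector_derivative intro!: exI[of _ H])
qed

lemma powr_submultiplicative:
  fixes a X Y :: real
  assumes "a \<le> 0" "X \<ge> 1" "Y \<ge> 1"
  shows "X powr a * Y powr a \<le> (X + Y - 1) powr a"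
proof -
  have "0 \<le> (X - 1) * (Y - 1)" using assms by simp
  then have "X + Y - 1 \<le> X * Y" by (simp add: algebra_simps)
  then have "(X * Y) powr a \<le> (X + Y - 1) powr a" using assms by (intro powr_mono2') auto
  then show ?thesis using assms by (simp add: powr_mult)
qed

text \<open>The estimate that makes \<open>\<omega>\<close> finite uniformly in \<open>s\<close>; it is used with \<open>x = \<bar>\<mu>(s) - \<mu>(r)\<bar> + 1\<close>,
\<open>y = \<bar>\<mu>(r)\<bar> + 1\<close> and \<open>z = \<bar>\<mu>(s)\<bar> + 1\<close>. The factor with \<open>z\<close> is at most \<open>2\<^sup>\<epsilon>\<close> times the larger of \<open>x\<^sup>\<epsilon>\<close> and
\<open>y\<^sup>\<epsilon>\<close>. If \<open>x\<close> is larger, its own power \<open>-q\<close> with \<open>q > \<epsilon>\<close> absorbs this. If \<open>y\<close> is larger, the remaining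
power of \<open>y\<close> is nonpositive and \<open>y\<close> may be replaced by \<open>x\<close>.\<close>

lemma powr_kernel_bound:
  fixes x y z p q \<epsilon> :: real
  assumes "x \<ge> 1" "y \<ge> 1" "0 \<le> z" "z \<le> x + y" "0 \<le> \<epsilon>" "\<epsilon> < q" "\<epsilon> \<le> p"
  shows "x powr (- q) * y powr (- p) * z powr \<epsilon> \<le> 2 powr \<epsilon> * (x powr (- p) + y powr (- p))"
proof (cases "y \<le> x")
  case True
  have "z powr \<epsilon> \<le> (2 * x) powr \<epsilon>" using assms True by (intro powr_mono2) auto
  then have "x powr (- q) * y powr (- p) * z powr \<epsilon> \<le> x powr (- q) * y powr (- p) * (2 * x) powr \<epsilon>"
    by (intro mult_left_mono) auto
  also have "\<dots> = 2 powr \<epsilon> * (x powr (\<epsilon> - q) * y powr (- p))"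
    using assms by (simp add: powr_mult powr_diff powr_minus field_simps)
  also have "\<dots> \<le> 2 powr \<epsilon> * (1 * y powr (- p))"
  proof -
    have "x powr (\<epsilon> - q) \<le> x powr 0" using assms by (intro powr_mono) auto
    then show ?thesis using assms by (intro mult_left_mono mult_right_mono) auto
  qed
  also have "\<dots> \<le> 2 powr \<epsilon> * (x powr (- p) + y powr (- p))" by (intro mult_left_mono) auto
  finally show ?thesis .
next
  case False
  have "z powr \<epsilon> \<le> (2 * y) powr \<epsilon>" using assms False by (intro powr_mono2) auto
  then have "x powr (- q) * y powr (- p) * z powr \<epsilon> \<le> x powr (- q) * y powr (- p) * (2 * y) powr \<epsilon>"
    by (intro mult_left_mono) auto
  also have "\<dots> = 2 powr \<epsilon> * (x powr (- q) * y powr (\<epsilon> - p))"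
    using assms by (simp add: powr_mult powr_diff powr_minus field_simps)
  also have "\<dots> \<le> 2 powr \<epsilon> * (x powr (- q) * x powr (\<epsilon> - p))"
    using assms False by (intro mult_left_mono powr_mono2') auto
  also have "\<dots> = 2 powr \<epsilon> * (x powr (\<epsilon> - q) * x powr (- p))"
    using assms by (simp add: powr_diff powr_minus field_simps)
  also have "\<dots> \<le> 2 powr \<epsilon> * (1 * x powr (- p))"
  proof -
    have "x powr (\<epsilon> - q) \<le> x powr 0" using assms by (intro powr_mono) auto
    then show ?thesis using assms by (intro mult_left_mono mult_right_mono) auto
  qed
  also have "\<dots> \<le> 2 powr \<epsilon> * (x powr (- p) + y powr (- p))" by (intro mult_left_mono) auto
  finally show ?thesis .
qed

text \<open>Both integrands of \<open>\<omega>\<close> have this form, with \<open>(e1, e2) = (d, c)\<close> in the past and \<open>(b, a)\<close> in the future;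
\<open>m\<close> stands for the derivative of \<open>\<mu>\<close>.\<close>

lemma hyperbolic_kernel_bound:
  fixes D \<delta> m x R S e1 e2 \<epsilon> \<gamma> :: real
  assumes "\<delta> \<ge> 0" "m \<ge> 0" "x \<ge> 1" "R \<ge> 1" "0 \<le> S" "S \<le> x + R"
    and "0 \<le> \<epsilon>" "e1 + e2 + \<epsilon> < 0" "2 * \<epsilon> \<le> \<gamma>"
  shows "(D * x powr e1 * R powr \<epsilon>) * (\<delta> * m * R powr (- \<gamma>)) * (D * x powr e2 * S powr \<epsilon>)
    \<le> D\<^sup>2 * \<delta> * 2 powr \<epsilon> * (m * (x powr (- (\<gamma> - \<epsilon>)) + R powr (- (\<gamma> - \<epsilon>))))"
proof -
  have "(D * x powr e1 * R powr \<epsilon>) * (\<delta> * m * R powr (- \<gamma>)) * (D * x powr e2 * S powr \<epsilon>)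
      = D\<^sup>2 * \<delta> * m * ((x powr e1 * x powr e2) * (R powr \<epsilon> * R powr (- \<gamma>)) * S powr \<epsilon>)"
    by (simp add: power2_eq_square mult_ac)
  also have "\<dots> = D\<^sup>2 * \<delta> * m * (x powr (- (- (e1 + e2))) * R powr (- (\<gamma> - \<epsilon>)) * S powr \<epsilon>)"
    by (simp add: powr_add[symmetric] add.commute)
  also have "\<dots> \<le> D\<^sup>2 * \<delta> * m * (2 powr \<epsilon> * (x powr (- (\<gamma> - \<epsilon>)) + R powr (- (\<gamma> - \<epsilon>))))"
    using assms by (intro mult_left_mono powr_kernel_bound) auto
  finally show ?thesis by (simp add: mult_ac)
qed

text \<open>The decay of \<open>\<beta>\<^sup>\<plusminus> \<alpha>\<close>, where \<open>R = \<bar>\<mu>(r)\<bar> + 1\<close> is at most \<open>x S\<close> and so costs only the power \<open>\<epsilon>\<close> of \<open>x\<close>.\<close>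

lemma hyperbolic_weight_tendsto_0:
  fixes D S e1 e2 \<epsilon> :: real and x R :: "real \<Rightarrow> real"
  assumes x: "filterlim x at_top F" and bnd: "\<forall>\<^sub>F r in F. x r \<ge> 1 \<and> 0 \<le> R r \<and> R r \<le> x r * S"
    and "S \<ge> 1" "0 \<le> \<epsilon>" "e1 + e2 + \<epsilon> < 0"
  shows "((\<lambda>r. (D * x r powr e1 * R r powr \<epsilon>) * (D * x r powr e2 * S powr \<epsilon>)) \<longlongrightarrow> 0) F"
proof (rule Lim_null_comparison)
  show "\<forall>\<^sub>F r in F. norm ((D * x r powr e1 * R r powr \<epsilon>) * (D * x r powr e2 * S powr \<epsilon>))
      \<le> D\<^sup>2 * (S powr \<epsilon>)\<^sup>2 * x r powr (e1 + e2 + \<epsilon>)"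
    using bnd
  proof eventually_elim
    case (elim r)
    have "R r powr \<epsilon> \<le> (x r * S) powr \<epsilon>" using elim assms by (intro powr_mono2) auto
    then have R: "R r powr \<epsilon> \<le> x r powr \<epsilon> * S powr \<epsilon>" using elim assms by (simp add: powr_mult)
    have "norm ((D * x r powr e1 * R r powr \<epsilon>) * (D * x r powr e2 * S powr \<epsilon>))
        = D\<^sup>2 * x r powr (e1 + e2) * S powr \<epsilon> * R r powr \<epsilon>"
      by (simp add: abs_mult powr_add power2_eq_square mult_ac)
    also have "\<dots> \<le> D\<^sup>2 * x r powr (e1 + e2) * S powr \<epsilon> * (x r powr \<epsilon> * S powr \<epsilon>)"
      using R by (intro mult_left_mono) auto
    also have "\<dots> = D\<^sup>2 * (S powr \<epsilon>)\<^sup>2 * x r powr (e1 + e2 + \<epsilon>)"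
      by (simp add: powr_add power2_eq_square mult_ac)
    finally show ?case .
  qed
  have "((\<lambda>r. x r powr (e1 + e2 + \<epsilon>)) \<longlongrightarrow> 0) F" by (intro tendsto_neg_powr assms)
  then show "((\<lambda>r. D\<^sup>2 * (S powr \<epsilon>)\<^sup>2 * x r powr (e1 + e2 + \<epsilon>)) \<longlongrightarrow> 0) F"
    by (rule tendsto_mult_right_zero)
qed

lemma growth_rate_deriv: "growth_rate \<mu> \<Longrightarrow> (\<mu> has_real_derivative deriv \<mu> t) (at t)"
  by (simp add: growth_rate_def DERIV_deriv_iff_real_differentiable)

lemma growth_rate_mono:
  assumes "growth_rate \<mu>" "s \<le> t"
  shows "\<mu> s \<le> \<mu> t"
proof (rule DERIV_nonneg_imp_nondecreasing[OF assms(2)])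
  fix x
  have "deriv \<mu> x > 0" using assms(1) by (simp add: growth_rate_def)
  then show "\<exists>y. (\<mu> has_real_derivative y) (at x) \<and> 0 \<le> y"
    using growth_rate_deriv[OF assms(1)] less_imp_le by blast
qed

lemma growth_rate_cont: "growth_rate \<mu> \<Longrightarrow> continuous_on S \<mu>"
  using growth_rate_deriv[of \<mu>] by (auto intro!: continuous_at_imp_continuous_on dest: DERIV_isCont)

text \<open>The derivative is the pointwise limit of difference quotients.\<close>

lemma growth_rate_deriv_measurable:
  assumes "growth_rate \<mu>"
  shows "deriv \<mu> \<in> borel_measurable borel"
proof (rule borel_measurable_LIMSEQ_real)
  have [measurable]: "\<mu> \<in> borel_measurable borel"
    by (intro borel_measurable_continuous_onI growth_rate_cont assms)
  show "(\<lambda>r. (\<mu> (r + 1 / real (Suc n)) - \<mu> r) / (1 / real (Suc n))) \<in> borel_measurable borel" for n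
    by measurable
  show "(\<lambda>n. (\<mu> (r + 1 / real (Suc n)) - \<mu> r) / (1 / real (Suc n))) \<longlonglongrightarrow> deriv \<mu> r" for r
  proof -
    have "(\<lambda>h. (\<mu> (r + h) - \<mu> r) / h) \<midarrow>0\<rightarrow> deriv \<mu> r"
      using growth_rate_deriv[OF assms, of r] by (simp add: DERIV_def)
    moreover have "filterlim (\<lambda>n. 1 / real (Suc n)) (at 0) sequentially"
      using LIMSEQ_inverse_real_of_nat by (auto simp: filterlim_at inverse_eq_divide)
    ultimately show ?thesis by (rule filterlim_compose)
  qed
qed

text \<open>The two formulas for \<open>\<alpha>\<close> agree on the diagonal, so each of them holds on a closed half plane.\<close>

lemma poly_alpha_le:
  "t \<le> s \<Longrightarrow> poly_alpha \<mu> D a c \<epsilon> t s = D * (\<mu> s - \<mu> t + 1) powr c * (\<bar>\<mu> s\<bar> + 1) powr \<epsilon>"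
  by (auto simp: poly_alpha_def)

lemma poly_alpha_ge:
  "s \<le> t \<Longrightarrow> poly_alpha \<mu> D a c \<epsilon> t s = D * (\<mu> t - \<mu> s + 1) powr a * (\<bar>\<mu> s\<bar> + 1) powr \<epsilon>"
  by (simp add: poly_alpha_def)

lemma poly_alpha_cont:
  assumes \<mu>: "growth_rate \<mu>"
  shows "continuous_on UNIV (\<lambda>t. poly_alpha \<mu> D a c \<epsilon> t s)"
proof -
  have "poly_alpha \<mu> D a c \<epsilon> t s =
      D * (max (\<mu> t - \<mu> s) 0 + 1) powr a * (max (\<mu> s - \<mu> t) 0 + 1) powr c * (\<bar>\<mu> s\<bar> + 1) powr \<epsilon>" for t
    using growth_rate_mono[OF \<mu>, of s t] growth_rate_mono[OF \<mu>, of t s]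
    by (cases "s \<le> t") (auto simp: poly_alpha_def max_def)
  moreover have "continuous_on UNIV (\<lambda>t.
      D * (max (\<mu> t - \<mu> s) 0 + 1) powr a * (max (\<mu> s - \<mu> t) 0 + 1) powr c * (\<bar>\<mu> s\<bar> + 1) powr \<epsilon>)"
    by (intro continuous_intros growth_rate_cont[OF \<mu>]) (auto simp: max_def)
  ultimately show ?thesis by simp
qed

text \<open>For exponents \<open>e \<le> 0\<close> the map \<open>X \<mapsto> X\<^sup>e\<close> satisfies \<open>X\<^sup>e Y\<^sup>e \<le> (X + Y - 1)\<^sup>e\<close> on \<open>[1, \<infinity>)\<close>, so passing through
an intermediate time costs only the nonuniformity \<open>D (\<bar>\<mu>(r)\<bar> + 1)\<^sup>\<epsilon>\<close> at that time.\<close>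

lemma poly_alpha_composition:
  assumes \<mu>: "growth_rate \<mu>" and D: "D \<ge> 0" and ac: "a \<le> 0" "c \<le> 0" and r: "r \<in> closed_segment s t"
  shows "poly_alpha \<mu> D a c \<epsilon> t r * poly_alpha \<mu> D a c \<epsilon> r s
    \<le> D * (\<bar>\<mu> r\<bar> + 1) powr \<epsilon> * poly_alpha \<mu> D a c \<epsilon> t s"
proof -
  have main: "(D * X powr e * R) * (D * Y powr e * S) \<le> D * R * (D * Z powr e * S)"
    if "e \<le> 0" "X \<ge> 1" "Y \<ge> 1" "X + Y - 1 = Z" "R \<ge> 0" "S \<ge> 0" for X Y Z e R S :: real
  proof -
    have "(D * R * D * S) * (X powr e * Y powr e) \<le> (D * R * D * S) * Z powr e"
      using powr_submultiplicative[OF that(1-3)] that D by (intro mult_left_mono) auto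
    then show ?thesis by (simp add: mult_ac)
  qed
  show ?thesis
  proof (cases "s \<le> t")
    case True
    then have "s \<le> r" "r \<le> t" using r by (auto simp: closed_segment_eq_real_ivl)
    then show ?thesis
      using True growth_rate_mono[OF \<mu>] ac unfolding poly_alpha_ge[OF \<open>s \<le> r\<close>] poly_alpha_ge[OF \<open>r \<le> t\<close>] poly_alpha_ge[OF True]
      by (intro main) auto
  next
    case False
    then have *: "r \<le> s" "t \<le> r" "t \<le> s" using r by (auto simp: closed_segment_eq_real_ivl)
    then show ?thesis
      using growth_rate_mono[OF \<mu>] ac unfolding poly_alpha_le[OF *(1)] poly_alpha_le[OF *(2)] poly_alpha_le[OF *(3)]
      by (intro main) auto
  qed
qed

lemma Lip_bound:
  assumes "Lip g \<le> ennreal K" "K \<ge> 0"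
  shows "norm (g x - g y) \<le> K * norm (x - y)"
proof (cases "x = y")
  case False
  have "ennreal (norm (g x - g y) / norm (x - y)) \<le> Lip g"
    unfolding Lip_def using False by (intro Sup_upper) blast
  then have "norm (g x - g y) / norm (x - y) \<le> K" using assms by (metis ennreal_le_iff order_trans)
  then show ?thesis using False by (simp add: field_simps)
qed simp

section \<open>The center manifold for polynomial trichotomies\<close>

text \<open>The majorants for polynomial bounds. With \<open>p = \<gamma> - \<epsilon> > 1\<close>, the center kernel has the density
\<open>D \<delta> \<mu>' (\<bar>\<mu>\<bar> + 1)\<^sup>-\<^sup>p\<close>, of total mass at most \<open>2 D \<delta> / (p - 1)\<close>. The kernels of \<open>\<omega>\<close> have mass at most
\<open>K (1 / (p - 1) + 2 / (p - 1))\<close>, which is at most \<open>1/16\<close> if \<open>K \<le> (p - 1) / 48\<close>.\<close>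

lemma polynomial_small_perturbation:
  fixes a b c d D \<epsilon> \<gamma> \<delta> :: real and A :: "real \<Rightarrow> 'a::banach \<Rightarrow>\<^sub>L 'a"
  defines "p \<equiv> \<gamma> - \<epsilon>" and "K \<equiv> D\<^sup>2 * \<delta> * 2 powr \<epsilon>"
  assumes gap: "a + b + \<epsilon> < 0" "c + d + \<epsilon> < 0" and ac: "a \<le> 0" "c \<le> 0"
    and \<gamma>: "\<gamma> > 0" "2 * \<epsilon> \<le> \<gamma>" and p1: "p > 1"
    and \<delta>: "\<delta> \<ge> 0" and K: "K \<le> (p - 1) / 48"
    and A: "continuous_on UNIV A" "evolution_operator A T"
    and tri: "nonuniform_polynomial_trichotomy \<mu> T P Qp Qm a b c d D \<epsilon>"
    and f: "continuous_on UNIV (\<lambda>(t, x). f t x)" "\<And>t. f t 0 = 0"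
    and Lip: "\<And>r. Lip (f r) \<le> ennreal (\<delta> * deriv \<mu> r * (\<bar>\<mu> r\<bar> + 1) powr (- \<gamma>))"
    and H: "\<And>u. (H has_real_derivative (\<bar>u\<bar> + 1) powr (- p)) (at u)"
    and H_var: "\<And>u v. \<bar>H u - H v\<bar> \<le> 2 / (p - 1)"
  shows "small_perturbation A T P Qp Qm f (\<lambda>r. \<delta> * deriv \<mu> r * (\<bar>\<mu> r\<bar> + 1) powr (- \<gamma>))
    (\<lambda>r. \<delta> * \<mu> r) (\<lambda>r. \<delta> * deriv \<mu> r)
    (\<lambda>r. D * \<delta> * H (\<mu> r)) (\<lambda>r. D * \<delta> * ((\<bar>\<mu> r\<bar> + 1) powr (- p) * deriv \<mu> r))
    (poly_alpha \<mu> D a c \<epsilon>) (poly_beta_plus \<mu> D d \<epsilon>) (poly_beta_minus \<mu> D b \<epsilon>)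
    (\<lambda>s r. K * ((\<mu> s - \<mu> r + 1) powr (1 - p) / (p - 1) + H (\<mu> r)))
    (\<lambda>s r. K * (deriv \<mu> r * ((\<mu> s - \<mu> r + 1) powr (- p) + (\<bar>\<mu> r\<bar> + 1) powr (- p))))
    (\<lambda>s r. K * (H (\<mu> r) - (\<mu> r - \<mu> s + 1) powr (1 - p) / (p - 1)))
    (\<lambda>s r. K * (deriv \<mu> r * ((\<mu> r - \<mu> s + 1) powr (- p) + (\<bar>\<mu> r\<bar> + 1) powr (- p))))"
proof -
  have \<mu>: "growth_rate \<mu>" and D: "D \<ge> 1" and \<epsilon>: "\<epsilon> \<ge> 0"
    and gt: "generalized_trichotomy T P Qp Qm (poly_alpha \<mu> D a c \<epsilon>) (poly_beta_plus \<mu> D d \<epsilon>) (poly_beta_minus \<mu> D b \<epsilon>)"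
    using tri by (auto simp: nonuniform_polynomial_trichotomy_def)
  note \<mu>' = growth_rate_deriv[OF \<mu>] and mono = growth_rate_mono[OF \<mu>]
  have \<mu>'_pos: "deriv \<mu> r > 0" for r using \<mu> by (simp add: growth_rate_def)
  have K0: "K \<ge> 0" using \<delta> by (simp add: K_def)
  have H': "((\<lambda>r. H (\<mu> r)) has_real_derivative (\<bar>\<mu> r\<bar> + 1) powr (- p) * deriv \<mu> r) (at r)" for r
    by (rule DERIV_chain2[OF H \<mu>'])
  have blinfun_bound: "norm (B (C x)) \<le> k * norm x" if "norm (B o\<^sub>L C) \<le> k" for B C :: "'a \<Rightarrow>\<^sub>L 'a" and k x
    using norm_blinfun[of "B o\<^sub>L C" x] mult_right_mono[OF that norm_ge_zero[of x]] by simp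
  have nonneg: "0 \<le> \<delta> * deriv \<mu> r * (\<bar>\<mu> r\<bar> + 1) powr (- \<gamma>)" for r
    using \<delta> \<mu>'_pos[of r] by simp
  have R_eq: "(\<bar>\<mu> r\<bar> + 1) powr \<epsilon> * (\<bar>\<mu> r\<bar> + 1) powr (- \<gamma>) = (\<bar>\<mu> r\<bar> + 1) powr (- p)" for r
    by (simp add: powr_add[symmetric] p_def)
  have tail: "(\<mu> r - \<mu> s + 1) powr (1 - p) \<le> 1" "(\<mu> r - \<mu> s + 1) powr (1 - p) \<ge> 0" if "s \<le> r" for r s
    using powr_mono[of "1 - p" 0 "\<mu> r - \<mu> s + 1"] mono[OF that] p1 by auto
  have var: "K * (h + k) \<le> 1 / 16" if "h \<le> 1 / (p - 1)" "k \<le> 2 / (p - 1)" for h k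
  proof -
    have "K * (h + k) \<le> K * (1 / (p - 1) + 2 / (p - 1))" using that K0 by (intro mult_left_mono add_mono)
    also have "\<dots> = K * 3 / (p - 1)" by (simp add: add_divide_distrib[symmetric])
    also have "\<dots> \<le> ((p - 1) / 48) * 3 / (p - 1)" using K p1 by (intro divide_right_mono mult_right_mono) auto
    also have "\<dots> = 1 / 16" using p1 by (simp add: field_simps)
    finally show ?thesis .
  qed
  have tail_top: "filterlim (\<lambda>r. \<mu> r - \<mu> s + 1) at_top at_top" for s
    using filterlim_tendsto_add_at_top[OF tendsto_const[of "1 - \<mu> s"], of \<mu> at_top] \<mu>
    by (simp add: growth_rate_def algebra_simps)
  have tail_bot: "filterlim (\<lambda>r. \<mu> s - \<mu> r + 1) at_top at_bot" for s
    using filterlim_tendsto_add_at_top[OF tendsto_const[of "1 + \<mu> s"], of "\<lambda>r. - \<mu> r" at_bot] \<mu>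
    by (simp add: growth_rate_def algebra_simps)
  have mult_abs: "\<bar>\<mu> r\<bar> + 1 \<le> (\<bar>\<mu> s - \<mu> r\<bar> + 1) * (\<bar>\<mu> s\<bar> + 1)" for r s
  proof -
    have "0 \<le> \<bar>\<mu> s - \<mu> r\<bar> * \<bar>\<mu> s\<bar>" "\<bar>\<mu> r\<bar> \<le> \<bar>\<mu> s\<bar> + \<bar>\<mu> s - \<mu> r\<bar>" by simp_all
    then show ?thesis unfolding distrib_left distrib_right mult_1_left mult_1_right by linarith
  qed
  show ?thesis
  proof unfold_locales
    show "continuous_on UNIV A" "evolution_operator A T" "continuous_on UNIV (\<lambda>(t, x). f t x)" "f t 0 = 0" for t
      by (fact A f)+
    show "invariant_splitting T P Qp Qm" using gt by (simp add: generalized_trichotomy_def)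
    show "norm (f t x - f t y) \<le> \<delta> * deriv \<mu> t * (\<bar>\<mu> t\<bar> + 1) powr (- \<gamma>) * norm (x - y)" for t x y
      by (rule Lip_bound[OF Lip nonneg])
    show "0 \<le> \<delta> * deriv \<mu> t * (\<bar>\<mu> t\<bar> + 1) powr (- \<gamma>)" for t by (rule nonneg)
    show "((\<lambda>r. \<delta> * \<mu> r) has_real_derivative \<delta> * deriv \<mu> t) (at t)" for t by (intro DERIV_cmult \<mu>')
    show "\<delta> * deriv \<mu> t * (\<bar>\<mu> t\<bar> + 1) powr (- \<gamma>) \<le> \<delta> * deriv \<mu> t" for t
    proof -
      have "\<bar>\<mu> t\<bar> + 1 \<noteq> 0" by linarith
      moreover have "(\<bar>\<mu> t\<bar> + 1) powr (- \<gamma>) \<le> (\<bar>\<mu> t\<bar> + 1) powr 0"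
        using \<gamma> by (intro powr_mono) auto
      ultimately have "(\<bar>\<mu> t\<bar> + 1) powr (- \<gamma>) \<le> 1" by simp
      then show ?thesis using \<delta> \<mu>'_pos[of t] by (intro mult_left_le) auto
    qed
    show "0 < poly_alpha \<mu> D a c \<epsilon> t s" for t s using gt by (simp add: generalized_trichotomy_def)
    show "continuous_on UNIV (\<lambda>t. poly_alpha \<mu> D a c \<epsilon> t s)" for s by (rule poly_alpha_cont[OF \<mu>])
    show "norm (T t s (P s x)) \<le> poly_alpha \<mu> D a c \<epsilon> t s * norm x" for t s x
      using gt by (intro blinfun_bound) (simp add: generalized_trichotomy_def)
    show "norm (T t s (Qp s x)) \<le> poly_beta_plus \<mu> D d \<epsilon> t s * norm x" if "s \<le> t" for t s x
      using gt that by (intro blinfun_bound) (simp add: generalized_trichotomy_def)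
    show "norm (T t s (Qm s x)) \<le> poly_beta_minus \<mu> D b \<epsilon> t s * norm x" if "t \<le> s" for t s x
      using gt that by (intro blinfun_bound) (simp add: generalized_trichotomy_def)
    show "0 \<le> poly_beta_plus \<mu> D d \<epsilon> t s" if "s \<le> t" for t s
      using gt that by (simp add: generalized_trichotomy_def less_imp_le)
    show "0 \<le> poly_beta_minus \<mu> D b \<epsilon> t s" if "t \<le> s" for t s
      using gt that by (simp add: generalized_trichotomy_def less_imp_le)
    show "((\<lambda>r. D * \<delta> * H (\<mu> r)) has_real_derivative D * \<delta> * ((\<bar>\<mu> t\<bar> + 1) powr (- p) * deriv \<mu> t)) (at t)" for t
      by (intro DERIV_cmult H')
    show "\<bar>D * \<delta> * H (\<mu> t) - D * \<delta> * H (\<mu> s)\<bar> \<le> 1 / 3" for t s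
    proof -
      have "\<bar>D * \<delta> * H (\<mu> t) - D * \<delta> * H (\<mu> s)\<bar> = D * \<delta> * \<bar>H (\<mu> t) - H (\<mu> s)\<bar>"
        using D \<delta> by (simp add: right_diff_distrib[symmetric] abs_mult)
      also have "\<dots> \<le> K * (2 / (p - 1))"
      proof (intro mult_mono H_var)
        have "1 powr \<epsilon> \<le> 2 powr \<epsilon>" using \<epsilon> by (intro powr_mono2) auto
        then have "D * 1 \<le> D * (D * 2 powr \<epsilon>)"
          using D by (intro mult_left_mono) (auto intro: order_trans[of 1 "D * 1"] mult_left_mono)
        then show "D * \<delta> \<le> K" using mult_right_mono[of D "D * (D * 2 powr \<epsilon>)" \<delta>] \<delta>
          by (simp add: K_def power2_eq_square mult_ac)
      qed (use K0 in auto)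
      also have "\<dots> \<le> ((p - 1) / 48) * (2 / (p - 1))" using K p1 by (intro mult_right_mono) auto
      also have "\<dots> = 1 / 24" using p1 by (simp add: field_simps)
      finally show ?thesis by simp
    qed
    show "poly_alpha \<mu> D a c \<epsilon> t r * (\<delta> * deriv \<mu> r * (\<bar>\<mu> r\<bar> + 1) powr (- \<gamma>)) * poly_alpha \<mu> D a c \<epsilon> r s
        \<le> poly_alpha \<mu> D a c \<epsilon> t s * (D * \<delta> * ((\<bar>\<mu> r\<bar> + 1) powr (- p) * deriv \<mu> r))"
      if "r \<in> closed_segment s t" for r s t
    proof -
      have "(poly_alpha \<mu> D a c \<epsilon> t r * poly_alpha \<mu> D a c \<epsilon> r s) * (\<delta> * deriv \<mu> r * (\<bar>\<mu> r\<bar> + 1) powr (- \<gamma>))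
          \<le> (D * (\<bar>\<mu> r\<bar> + 1) powr \<epsilon> * poly_alpha \<mu> D a c \<epsilon> t s) * (\<delta> * deriv \<mu> r * (\<bar>\<mu> r\<bar> + 1) powr (- \<gamma>))"
        using D that by (intro mult_right_mono nonneg poly_alpha_composition[OF \<mu> _ ac]) auto
      then show ?thesis unfolding R_eq[symmetric] by (simp add: mult_ac)
    qed
    show "((\<lambda>r. K * ((\<mu> s - \<mu> r + 1) powr (1 - p) / (p - 1) + H (\<mu> r))) has_real_derivative
        K * (deriv \<mu> r * ((\<mu> s - \<mu> r + 1) powr (- p) + (\<bar>\<mu> r\<bar> + 1) powr (- p)))) (at r)" if "r \<le> s" for r s
    proof -
      have pos: "\<mu> s - \<mu> r + 1 > 0" using mono[OF that] by simp
      have "((\<lambda>r. (\<mu> s - \<mu> r + 1) powr (1 - p) / (p - 1)) has_real_derivative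
          ((1 - p) * (\<mu> s - \<mu> r + 1) powr (1 - p - 1) * - deriv \<mu> r) / (p - 1)) (at r)"
        using pos p1 by (auto intro!: derivative_eq_intros \<mu>')
      also have "((1 - p) * (\<mu> s - \<mu> r + 1) powr (1 - p - 1) * - deriv \<mu> r) / (p - 1)
          = deriv \<mu> r * (\<mu> s - \<mu> r + 1) powr (- p)" using p1 by (simp add: field_simps)
      finally have "((\<lambda>r. K * ((\<mu> s - \<mu> r + 1) powr (1 - p) / (p - 1) + H (\<mu> r))) has_real_derivative
          K * (deriv \<mu> r * (\<mu> s - \<mu> r + 1) powr (- p) + (\<bar>\<mu> r\<bar> + 1) powr (- p) * deriv \<mu> r)) (at r)"
        by (intro DERIV_cmult DERIV_add H')
      moreover have "deriv \<mu> r * (\<mu> s - \<mu> r + 1) powr (- p) + (\<bar>\<mu> r\<bar> + 1) powr (- p) * deriv \<mu> r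
          = deriv \<mu> r * ((\<mu> s - \<mu> r + 1) powr (- p) + (\<bar>\<mu> r\<bar> + 1) powr (- p))"
        by (simp add: algebra_simps)
      ultimately show ?thesis by (simp only:)
    qed
    show "((\<lambda>r. K * (H (\<mu> r) - (\<mu> r - \<mu> s + 1) powr (1 - p) / (p - 1))) has_real_derivative
        K * (deriv \<mu> r * ((\<mu> r - \<mu> s + 1) powr (- p) + (\<bar>\<mu> r\<bar> + 1) powr (- p)))) (at r)" if "s \<le> r" for r s
    proof -
      have pos: "\<mu> r - \<mu> s + 1 > 0" using mono[OF that] by simp
      have "((\<lambda>r. (\<mu> r - \<mu> s + 1) powr (1 - p) / (p - 1)) has_real_derivative
          ((1 - p) * (\<mu> r - \<mu> s + 1) powr (1 - p - 1) * deriv \<mu> r) / (p - 1)) (at r)"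
        using pos p1 by (auto intro!: derivative_eq_intros \<mu>')
      also have "((1 - p) * (\<mu> r - \<mu> s + 1) powr (1 - p - 1) * deriv \<mu> r) / (p - 1)
          = - (deriv \<mu> r * (\<mu> r - \<mu> s + 1) powr (- p))" using p1 by (simp add: field_simps)
      finally have "((\<lambda>r. K * (H (\<mu> r) - (\<mu> r - \<mu> s + 1) powr (1 - p) / (p - 1))) has_real_derivative
          K * ((\<bar>\<mu> r\<bar> + 1) powr (- p) * deriv \<mu> r - - (deriv \<mu> r * (\<mu> r - \<mu> s + 1) powr (- p)))) (at r)"
        by (intro DERIV_cmult DERIV_diff H')
      moreover have "(\<bar>\<mu> r\<bar> + 1) powr (- p) * deriv \<mu> r - - (deriv \<mu> r * (\<mu> r - \<mu> s + 1) powr (- p))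
          = deriv \<mu> r * ((\<mu> r - \<mu> s + 1) powr (- p) + (\<bar>\<mu> r\<bar> + 1) powr (- p))"
        by (simp add: algebra_simps)
      ultimately show ?thesis by (simp only:)
    qed
    show "K * ((\<mu> s - \<mu> s + 1) powr (1 - p) / (p - 1) + H (\<mu> s))
        - K * ((\<mu> s - \<mu> r + 1) powr (1 - p) / (p - 1) + H (\<mu> r)) \<le> 1 / 16" if "r \<le> s" for r s
    proof -
      have "K * ((1 - (\<mu> s - \<mu> r + 1) powr (1 - p)) / (p - 1) + (H (\<mu> s) - H (\<mu> r))) \<le> 1 / 16"
        using tail[OF that] p1 H_var[of "\<mu> s" "\<mu> r"] by (intro var divide_right_mono) auto
      then show ?thesis by (simp add: algebra_simps diff_divide_distrib)
    qed
    show "K * (H (\<mu> r) - (\<mu> r - \<mu> s + 1) powr (1 - p) / (p - 1))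
        - K * (H (\<mu> s) - (\<mu> s - \<mu> s + 1) powr (1 - p) / (p - 1)) \<le> 1 / 16" if "s \<le> r" for r s
    proof -
      have "K * ((1 - (\<mu> r - \<mu> s + 1) powr (1 - p)) / (p - 1) + (H (\<mu> r) - H (\<mu> s))) \<le> 1 / 16"
        using tail[OF that] p1 H_var[of "\<mu> r" "\<mu> s"] by (intro var divide_right_mono) auto
      then show ?thesis by (simp add: algebra_simps diff_divide_distrib)
    qed
    show "poly_beta_plus \<mu> D d \<epsilon> s r * (\<delta> * deriv \<mu> r * (\<bar>\<mu> r\<bar> + 1) powr (- \<gamma>)) * poly_alpha \<mu> D a c \<epsilon> r s
        \<le> K * (deriv \<mu> r * ((\<mu> s - \<mu> r + 1) powr (- p) + (\<bar>\<mu> r\<bar> + 1) powr (- p)))" if "r \<le> s" for r s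
      unfolding poly_beta_plus_def poly_alpha_le[OF that] K_def p_def
      using mono[OF that] \<delta> \<mu>'_pos[of r] \<epsilon> \<gamma> gap by (intro hyperbolic_kernel_bound) auto
    show "poly_beta_minus \<mu> D b \<epsilon> s r * (\<delta> * deriv \<mu> r * (\<bar>\<mu> r\<bar> + 1) powr (- \<gamma>)) * poly_alpha \<mu> D a c \<epsilon> r s
        \<le> K * (deriv \<mu> r * ((\<mu> r - \<mu> s + 1) powr (- p) + (\<bar>\<mu> r\<bar> + 1) powr (- p)))" if "s \<le> r" for r s
      unfolding poly_beta_minus_def poly_alpha_ge[OF that] K_def p_def
      using mono[OF that] \<delta> \<mu>'_pos[of r] \<epsilon> \<gamma> gap by (intro hyperbolic_kernel_bound) auto
    show "((\<lambda>r. poly_beta_plus \<mu> D d \<epsilon> s r * poly_alpha \<mu> D a c \<epsilon> r s) \<longlongrightarrow> 0) at_bot" for s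
    proof (rule Lim_transform_eventually)
      show "((\<lambda>r. (D * (\<mu> s - \<mu> r + 1) powr d * (\<bar>\<mu> r\<bar> + 1) powr \<epsilon>)
          * (D * (\<mu> s - \<mu> r + 1) powr c * (\<bar>\<mu> s\<bar> + 1) powr \<epsilon>)) \<longlongrightarrow> 0) at_bot"
      proof (rule hyperbolic_weight_tendsto_0[OF tail_bot])
        show "\<forall>\<^sub>F r in at_bot. 1 \<le> \<mu> s - \<mu> r + 1 \<and> 0 \<le> \<bar>\<mu> r\<bar> + 1 \<and>
            \<bar>\<mu> r\<bar> + 1 \<le> (\<mu> s - \<mu> r + 1) * (\<bar>\<mu> s\<bar> + 1)"
          using eventually_le_at_bot[of s]
        proof eventually_elim
          case (elim r)
          show ?case using mono[OF elim] mult_abs[of r s] by simp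
        qed
      qed (use \<epsilon> gap in auto)
      show "\<forall>\<^sub>F r in at_bot. (D * (\<mu> s - \<mu> r + 1) powr d * (\<bar>\<mu> r\<bar> + 1) powr \<epsilon>)
          * (D * (\<mu> s - \<mu> r + 1) powr c * (\<bar>\<mu> s\<bar> + 1) powr \<epsilon>) =
          poly_beta_plus \<mu> D d \<epsilon> s r * poly_alpha \<mu> D a c \<epsilon> r s"
        using eventually_le_at_bot[of s] by eventually_elim (simp add: poly_beta_plus_def poly_alpha_le)
    qed
    show "((\<lambda>r. poly_beta_minus \<mu> D b \<epsilon> s r * poly_alpha \<mu> D a c \<epsilon> r s) \<longlongrightarrow> 0) at_top" for s
    proof (rule Lim_transform_eventually)
      show "((\<lambda>r. (D * (\<mu> r - \<mu> s + 1) powr b * (\<bar>\<mu> r\<bar> + 1) powr \<epsilon>)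
          * (D * (\<mu> r - \<mu> s + 1) powr a * (\<bar>\<mu> s\<bar> + 1) powr \<epsilon>)) \<longlongrightarrow> 0) at_top"
      proof (rule hyperbolic_weight_tendsto_0[OF tail_top])
        show "\<forall>\<^sub>F r in at_top. 1 \<le> \<mu> r - \<mu> s + 1 \<and> 0 \<le> \<bar>\<mu> r\<bar> + 1 \<and>
            \<bar>\<mu> r\<bar> + 1 \<le> (\<mu> r - \<mu> s + 1) * (\<bar>\<mu> s\<bar> + 1)"
          using eventually_ge_at_top[of s]
        proof eventually_elim
          case (elim r)
          show ?case using mono[OF elim] mult_abs[of r s] by simp
        qed
      qed (use \<epsilon> gap in auto)
      show "\<forall>\<^sub>F r in at_top. (D * (\<mu> r - \<mu> s + 1) powr b * (\<bar>\<mu> r\<bar> + 1) powr \<epsilon>)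
          * (D * (\<mu> r - \<mu> s + 1) powr a * (\<bar>\<mu> s\<bar> + 1) powr \<epsilon>) =
          poly_beta_minus \<mu> D b \<epsilon> s r * poly_alpha \<mu> D a c \<epsilon> r s"
        using eventually_ge_at_top[of s] by eventually_elim (simp add: poly_beta_minus_def poly_alpha_ge)
    qed
  qed
qed

theorem theorem4p5:
  fixes a b c d D \<epsilon> \<gamma> :: real
  assumes "\<gamma> > 0"
    and "a + b + \<epsilon> < 0" and "c + d + \<epsilon> < 0"
    and "a \<le> 0" and "c \<le> 0" and "2 * \<epsilon> \<le> \<gamma>" and "\<epsilon> - \<gamma> + 1 < 0"
  shows "\<exists>\<delta>0 > 0. \<forall>\<delta> (A :: real \<Rightarrow> 'a::banach \<Rightarrow>\<^sub>L 'a) T P Qp Qm \<mu> f.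
    0 \<le> \<delta> \<longrightarrow> \<delta> < \<delta>0 \<longrightarrow>
    continuous_on UNIV A \<longrightarrow>
    evolution_operator A T \<longrightarrow>
    nonuniform_polynomial_trichotomy \<mu> T P Qp Qm a b c d D \<epsilon> \<longrightarrow>
    continuous_on UNIV (\<lambda>(t, x). f t x) \<longrightarrow>
    (\<forall>t. f t 0 = 0) \<longrightarrow>
    (\<forall>t. Lip (f t) < \<infinity>) \<longrightarrow>
    (\<forall>r. Lip (f r) \<le> ennreal (\<delta> * deriv \<mu> r * (\<bar>\<mu> r\<bar> + 1) powr (- \<gamma>))) \<longrightarrow>
    (\<exists>N. 0 < N \<and> N < 1 \<and>
      (\<exists>!\<phi>. \<phi> \<in> lipschitz_sections P Qp Qm N \<and>
        (\<forall>\<tau>. flow_map A f \<tau> ` section_graph P \<phi> \<subseteq> section_graph P \<phi>) \<and>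
        (\<forall>t s \<xi> \<xi>'. (s, \<xi>) \<in> center_bundle P \<longrightarrow> (s, \<xi>') \<in> center_bundle P \<longrightarrow>
          ennreal (norm (snd (flow_map A f (t - s) (graph_point \<phi> s \<xi>)) -
                         snd (flow_map A f (t - s) (graph_point \<phi> s \<xi>'))))
          \<le> ennreal (D * N) /
              omega (poly_alpha \<mu> D a c \<epsilon>) (poly_beta_plus \<mu> D d \<epsilon>) (poly_beta_minus \<mu> D b \<epsilon>) f *
            ennreal ((if t \<ge> s then (\<mu> t - \<mu> s + 1) powr a else (\<mu> s - \<mu> t + 1) powr c) *
              (\<bar>\<mu> s\<bar> + 1) powr \<epsilon> * norm (\<xi> - \<xi>')))))"
proof -
  have p1: "\<gamma> - \<epsilon> > 1" using assms by simp
  obtain H where H: "\<And>u. (H has_real_derivative (\<bar>u\<bar> + 1) powr (- (\<gamma> - \<epsilon>))) (at u)"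
    and H_var: "\<And>u v. \<bar>H u - H v\<bar> \<le> 2 / (\<gamma> - \<epsilon> - 1)"
    using powr_tail_antiderivative[OF p1] by blast
  define E where "E = D\<^sup>2 + 1"
  have E: "E > 0" "D\<^sup>2 \<le> E" by (auto simp: E_def add_nonneg_pos)
  \<comment> \<open>Chosen so that \<open>D\<^sup>2 * \<delta> * 2 powr \<epsilon> \<le> (\<gamma> - \<epsilon> - 1) / 48\<close>; using \<open>D\<^sup>2 + 1\<close> avoids a case distinction for \<open>D = 0\<close>.\<close>
  define \<delta>0 where "\<delta>0 = (\<gamma> - \<epsilon> - 1) / 48 / 2 powr \<epsilon> / E"
  show ?thesis
  proof (rule exI[of _ \<delta>0], rule conjI; (intro allI impI)?)
    show "\<delta>0 > 0" using p1 E by (simp add: \<delta>0_def)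
  next
    fix \<delta> :: real and A :: "real \<Rightarrow> 'a \<Rightarrow>\<^sub>L 'a" and T P Qp Qm \<mu>
      and f :: "real \<Rightarrow> 'a \<Rightarrow> 'a"
    assume \<delta>: "0 \<le> \<delta>" "\<delta> < \<delta>0" and A: "continuous_on UNIV A" "evolution_operator A T"
      and tri: "nonuniform_polynomial_trichotomy \<mu> T P Qp Qm a b c d D \<epsilon>"
      and f: "continuous_on UNIV (\<lambda>(t, x). f t x)" "\<forall>t. f t 0 = 0"
      and Lip: "\<forall>r. Lip (f r) \<le> ennreal (\<delta> * deriv \<mu> r * (\<bar>\<mu> r\<bar> + 1) powr (- \<gamma>))"
    let ?\<alpha> = "poly_alpha \<mu> D a c \<epsilon>"
    let ?\<omega> = "omega ?\<alpha> (poly_beta_plus \<mu> D d \<epsilon>) (poly_beta_minus \<mu> D b \<epsilon>) f"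
    have \<mu>: "growth_rate \<mu>" and D: "D \<ge> 1" using tri by (auto simp: nonuniform_polynomial_trichotomy_def)
    have K: "D\<^sup>2 * \<delta> * 2 powr \<epsilon> \<le> (\<gamma> - \<epsilon> - 1) / 48"
    proof -
      have "D\<^sup>2 * (\<delta> * 2 powr \<epsilon>) \<le> E * (\<delta>0 * 2 powr \<epsilon>)"
        using \<delta> E by (intro mult_mono) auto
      also have "\<dots> = (\<gamma> - \<epsilon> - 1) / 48" using E by (simp add: \<delta>0_def)
      finally show ?thesis by (simp add: mult_ac)
    qed
    interpret small_perturbation A T P Qp Qm f "\<lambda>r. \<delta> * deriv \<mu> r * (\<bar>\<mu> r\<bar> + 1) powr (- \<gamma>)"
      "\<lambda>r. \<delta> * \<mu> r" "\<lambda>r. \<delta> * deriv \<mu> r" "\<lambda>r. D * \<delta> * H (\<mu> r)"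
      "\<lambda>r. D * \<delta> * ((\<bar>\<mu> r\<bar> + 1) powr (- (\<gamma> - \<epsilon>)) * deriv \<mu> r)"
      "poly_alpha \<mu> D a c \<epsilon>" "poly_beta_plus \<mu> D d \<epsilon>" "poly_beta_minus \<mu> D b \<epsilon>"
      "\<lambda>s r. D\<^sup>2 * \<delta> * 2 powr \<epsilon> * ((\<mu> s - \<mu> r + 1) powr (1 - (\<gamma> - \<epsilon>)) / (\<gamma> - \<epsilon> - 1) + H (\<mu> r))"
      "\<lambda>s r. D\<^sup>2 * \<delta> * 2 powr \<epsilon> *
         (deriv \<mu> r * ((\<mu> s - \<mu> r + 1) powr (- (\<gamma> - \<epsilon>)) + (\<bar>\<mu> r\<bar> + 1) powr (- (\<gamma> - \<epsilon>))))"
      "\<lambda>s r. D\<^sup>2 * \<delta> * 2 powr \<epsilon> * (H (\<mu> r) - (\<mu> r - \<mu> s + 1) powr (1 - (\<gamma> - \<epsilon>)) / (\<gamma> - \<epsilon> - 1))"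
      "\<lambda>s r. D\<^sup>2 * \<delta> * 2 powr \<epsilon> *
         (deriv \<mu> r * ((\<mu> r - \<mu> s + 1) powr (- (\<gamma> - \<epsilon>)) + (\<bar>\<mu> r\<bar> + 1) powr (- (\<gamma> - \<epsilon>))))"
      by (rule polynomial_small_perturbation)
        (rule assms p1 \<delta>(1) K A tri f(1) f(2)[rule_format] Lip[rule_format] H H_var)+
    have [measurable]: "\<mu> \<in> borel_measurable borel" "deriv \<mu> \<in> borel_measurable borel"
      by (intro borel_measurable_continuous_onI growth_rate_cont \<mu> growth_rate_deriv_measurable)+
    have \<omega>: "?\<omega> \<le> ennreal (1 / 8)"
      by (rule omega_le[OF Lip[rule_format]]) measurable
    have ratio: "ennreal (3 * D) \<le> ennreal (D * (1 / 2)) / ?\<omega>"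
    proof -
      \<comment> \<open>If \<open>\<omega> = 0\<close>, the quotient is infinite.\<close>
      obtain w where w: "?\<omega> = ennreal w" "w \<ge> 0" "w \<le> 1 / 8"
        using \<omega> by (cases ?\<omega>) (auto simp: top_unique)
      show ?thesis
      proof (cases "w = 0")
        case False
        have "D * w \<le> D * (1 / 8)" using D w(3) by (intro mult_left_mono) auto
        then have "3 * D \<le> D * (1 / 2) / w" using False w(2) D by (simp add: field_simps)
        then show ?thesis using False w(2) D unfolding w(1)
          by (subst divide_ennreal) (auto intro: ennreal_leI)
      qed (use D w(1) in simp)
    qed
    obtain \<phi> where \<phi>: "\<phi> \<in> sections" "flow_invariant \<phi>"
      and growth: "\<forall>t s \<xi> \<eta>. P s \<xi> = \<xi> \<longrightarrow> P s \<eta> = \<eta> \<longrightarrow>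
        norm (snd (flow_map A f (t - s) (graph_point \<phi> s \<xi>)) - snd (flow_map A f (t - s) (graph_point \<phi> s \<eta>)))
          \<le> 3 * ?\<alpha> t s * norm (\<xi> - \<eta>)"
      and unique: "\<forall>\<psi>\<in>sections. flow_invariant \<psi> \<longrightarrow> \<psi> = \<phi>"
      using center_manifold_theorem by (elim bexE conjE)
    have bound: "ennreal (norm (snd (flow_map A f (t - s) (graph_point \<phi> s \<xi>)) -
                         snd (flow_map A f (t - s) (graph_point \<phi> s \<xi>'))))
          \<le> ennreal (D * (1 / 2)) / ?\<omega> *
            ennreal ((if t \<ge> s then (\<mu> t - \<mu> s + 1) powr a else (\<mu> s - \<mu> t + 1) powr c) *
              (\<bar>\<mu> s\<bar> + 1) powr \<epsilon> * norm (\<xi> - \<xi>'))" (is "ennreal ?l \<le> _ * ennreal ?w")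
      if "(s, \<xi>) \<in> center_bundle P" "(s, \<xi>') \<in> center_bundle P" for t s \<xi> \<xi>'
    proof -
      have "?l \<le> 3 * ?\<alpha> t s * norm (\<xi> - \<xi>')" using that growth[rule_format, of s \<xi> \<xi>' t] by simp
      also have "\<dots> = (3 * D) * ?w" by (simp add: poly_alpha_def)
      finally have "ennreal ?l \<le> ennreal (3 * D) * ennreal ?w"
        using D by (subst ennreal_mult[symmetric]) (auto intro: ennreal_leI)
      also have "\<dots> \<le> ennreal (D * (1 / 2)) / ?\<omega> * ennreal ?w" by (intro mult_right_mono ratio) auto
      finally show ?thesis .
    qed
    show "\<exists>N. 0 < N \<and> N < 1 \<and>
      (\<exists>!\<phi>. \<phi> \<in> lipschitz_sections P Qp Qm N \<and>
        (\<forall>\<tau>. flow_map A f \<tau> ` section_graph P \<phi> \<subseteq> section_graph P \<phi>) \<and>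
        (\<forall>t s \<xi> \<xi>'. (s, \<xi>) \<in> center_bundle P \<longrightarrow> (s, \<xi>') \<in> center_bundle P \<longrightarrow>
          ennreal (norm (snd (flow_map A f (t - s) (graph_point \<phi> s \<xi>)) -
                         snd (flow_map A f (t - s) (graph_point \<phi> s \<xi>'))))
          \<le> ennreal (D * N) / ?\<omega> *
            ennreal ((if t \<ge> s then (\<mu> t - \<mu> s + 1) powr a else (\<mu> s - \<mu> t + 1) powr c) *
              (\<bar>\<mu> s\<bar> + 1) powr \<epsilon> * norm (\<xi> - \<xi>'))))"
    proof (rule exI[of _ "1 / 2"], intro conjI)
      show "\<exists>!\<phi>. \<phi> \<in> sections \<and>
        (\<forall>\<tau>. flow_map A f \<tau> ` section_graph P \<phi> \<subseteq> section_graph P \<phi>) \<and>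
        (\<forall>t s \<xi> \<xi>'. (s, \<xi>) \<in> center_bundle P \<longrightarrow> (s, \<xi>') \<in> center_bundle P \<longrightarrow>
          ennreal (norm (snd (flow_map A f (t - s) (graph_point \<phi> s \<xi>)) -
                         snd (flow_map A f (t - s) (graph_point \<phi> s \<xi>'))))
          \<le> ennreal (D * (1 / 2)) / ?\<omega> *
            ennreal ((if t \<ge> s then (\<mu> t - \<mu> s + 1) powr a else (\<mu> s - \<mu> t + 1) powr c) *
              (\<bar>\<mu> s\<bar> + 1) powr \<epsilon> * norm (\<xi> - \<xi>')))"
      proof (rule ex1I[of _ \<phi>], intro conjI allI impI)
        show "flow_map A f \<tau> ` section_graph P \<phi> \<subseteq> section_graph P \<phi>" for \<tau>
          using \<phi>(2) unfolding flow_invariant_def by (rule spec)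
      qed (rule \<phi>(1), rule bound, assumption+, elim conjE,
          rule unique[unfolded flow_invariant_def, rule_format], assumption, erule spec)
    qed simp_all
  qed
qed

end
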